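(* Let $M=(M_k)$ be a non-quasianalytic log-convex positive sequence and let $X\subseteq\mathbb{R}^d$ be a Lipschitz set. Then \[ \mathcal{C}^M(X)\subseteq\mathcal{A}^M(X)\subseteq\mathcal{C}^{M^{(2)}}(X), \] where $M^{(2)}$ is the sequence $M^{(2)}_k:=M_{2k}$.
   Context: $M$ is non-quasianalytic if $\sum_k M_k/((k+1)M_{k+1})<\infty$. For a positive sequence $N$, $\mathcal{C}^N(\mathbb{R},\mathbb{R}^m)$ is the set of smooth $c$ such that for every compact $K\subseteq\mathbb{R}$ there are $C,\rho>0$ with $|c^{(k)}(t)|\le C\rho^k k!\,N_k$ for all $k$, $t\in K$. $\mathcal{A}^M(X)$ is the set of $f:X\to\mathbb{R}$ with $f\circ c\in\mathcal{C}^M(\mathbb{R},\mathbb{R})$ for every $c\in\mathcal{C}^M(\mathbb{R},\mathbb{R}^d)$ with $c(\mathbb{R})\subseteq X$. $\mathcal{C}^\infty(X)$ is the set of $f:X\to\mathbb{R}$ that locally near each point of $X$ are restrictions of smooth functions on open subsets of $\mathbb{R}^d$; since $X$ is fat, the Fréchet derivatives $f^{(k)}(x)\in L_k(\mathbb{R}^d,\mathbb{R})$ are well defined on $X$. $\mathcal{C}^N(X)$ is the set of $f\in\mathcal{C}^\infty(X)$ such that for every compact $K\subseteq X$ there are $C,\rho>0$ with $\|f^{(k)}(x)\|_{L_k(\mathbb{R}^d,\mathbb{R})}\le C\rho^k k!\,N_k$ for all $k\in\mathbb{N}$, $x\in K$. Lipschitz set: for $r,h>0$ let $\Gamma_d(r,h)=\{(x',x_d)\in\mathbb{R}^{d-1}\times\mathbb{R}: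 |x'|<r,\ h|x'|/r<x_d<h\}$ (truncated open cone). An open $U$ has the uniform cone property if for every $x\in\partial U$ there are $\epsilon>0$, some $\Gamma=\Gamma_d(r,h)$ and $A\in O(d)$ with $y+A\Gamma\subseteq U$ for all $y\in\overline U\cap B(x,\epsilon)$. A Lipschitz set is a closed set $X$ with $X=\overline{\mathrm{int}(X)}\neq\emptyset$ such that $\mathrm{int}(X)$ has the uniform cone property. *)

theory Defs
  imports "HOL-Analysis.Analysis"
begin

definition positive_seq :: "(nat \<Rightarrow> real) \<Rightarrow> bool" where
  "positive_seq M \<longleftrightarrow> (\<forall>k. M k > 0)"

definition log_convex :: "(nat \<Rightarrow> real) \<Rightarrow> bool" where
  "log_convex M \<longleftrightarrow> (\<forall>k\<ge>1. (M k)\<^sup>2 \<le> M (k - 1) * M (k + 1))"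

text \<open>For a positive sequence the series has positive terms, so finiteness of the sum
  is summability.\<close>
definition non_quasianalytic :: "(nat \<Rightarrow> real) \<Rightarrow> bool" where
  "non_quasianalytic M \<longleftrightarrow> summable (\<lambda>k. M k / ((real k + 1) * M (k + 1)))"

definition seq2 :: "(nat \<Rightarrow> real) \<Rightarrow> nat \<Rightarrow> real" where
  "seq2 M k = M (2 * k)"

definition curve_class :: "(nat \<Rightarrow> real) \<Rightarrow> (real \<Rightarrow> 'b::real_normed_vector) set" where
  "curve_class N = {c. \<exists>D. D 0 = c \<and>
      (\<forall>k t. (D k has_vector_derivative D (Suc k) t) (at t)) \<and>
      (\<forall>K. compact K \<longrightarrow> (\<exists>C \<rho>. C > 0 \<and> \<rho> > 0 \<and>
          (\<forall>k. \<forall>t\<in>K. norm (D k t) \<le> C * \<rho> ^ k * fact k * N k)))}"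

definition arc_class :: "(nat \<Rightarrow> real) \<Rightarrow> 'a::euclidean_space set \<Rightarrow> ('a \<Rightarrow> real) set" where
  "arc_class M X = {f. \<forall>c::real \<Rightarrow> 'a. c \<in> curve_class M \<and> range c \<subseteq> X
       \<longrightarrow> f \<circ> c \<in> curve_class M}"

text \<open>\<open>smooth_jet U g D\<close>: g is smooth on the open set U and \<open>D k x [v1,...,vk]\<close> is
  the k-th Frechet derivative of g at x applied to \<open>(v1,...,vk)\<close>
  (defined recursively: \<open>D (k+1) x (v # vs)\<close> is the derivative of \<open>y \<mapsto> D k y vs\<close>
  at x in direction v).  On lists of length k these values are uniquely determined by g.\<close>
definition smooth_jet :: "'a::euclidean_space set \<Rightarrow> ('a \<Rightarrow> real) \<Rightarrow> (nat \<Rightarrow> 'a \<Rightarrow> 'a list \<Rightarrow> real) \<Rightarrow> bool" where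
  "smooth_jet U g D \<longleftrightarrow> (\<forall>x\<in>U. D 0 x [] = g x) \<and>
     (\<forall>k. \<forall>x\<in>U. \<forall>vs. length vs = k \<longrightarrow>
        ((\<lambda>y. D k y vs) has_derivative (\<lambda>v. D (Suc k) x (v # vs))) (at x))"

definition local_ext :: "'a::euclidean_space set \<Rightarrow> ('a \<Rightarrow> real) \<Rightarrow> 'a \<Rightarrow> 'a set \<Rightarrow> ('a \<Rightarrow> real) \<Rightarrow> (nat \<Rightarrow> 'a \<Rightarrow> 'a list \<Rightarrow> real) \<Rightarrow> bool" where
  "local_ext X f x U g D \<longleftrightarrow> open U \<and> x \<in> U \<and> smooth_jet U g D \<and> (\<forall>y\<in>X \<inter> U. g y = f y)"

definition smooth_on_set :: "'a::euclidean_space set \<Rightarrow> ('a \<Rightarrow> real) set" where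
  "smooth_on_set X = {f. \<forall>x\<in>X. \<exists>U g D. local_ext X f x U g D}"

text \<open>\<open>C^N(X)\<close>.  The bound \<open>\<bar>D k x vs\<bar> \<le> B\<close> for all unit-ball vectors vs is the operator
  norm bound \<open>\<parallel>f^(k)(x)\<parallel> \<le> B\<close>; for fat X the derivatives do not depend on the
  chosen local extension, so we require the bound for every local extension.\<close>
definition ultra_class :: "(nat \<Rightarrow> real) \<Rightarrow> 'a::euclidean_space set \<Rightarrow> ('a \<Rightarrow> real) set" where
  "ultra_class N X = {f. f \<in> smooth_on_set X \<and>
     (\<forall>K. compact K \<and> K \<subseteq> X \<longrightarrow> (\<exists>C \<rho>. C > 0 \<and> \<rho> > 0 \<and>
        (\<forall>k. \<forall>x\<in>K. \<forall>U g D. local_ext X f x U g D \<longrightarrow>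
           (\<forall>vs. length vs = k \<and> (\<forall>v\<in>set vs. norm v \<le> 1) \<longrightarrow>
              \<bar>D k x vs\<bar> \<le> C * \<rho> ^ k * fact k * N k))))}"

text \<open>A fixed unit vector playing the role of the last coordinate direction \<open>e_d\<close>.\<close>
definition last_dir :: "'a::euclidean_space" where
  "last_dir = (SOME b. b \<in> Basis)"

definition trunc_cone :: "real \<Rightarrow> real \<Rightarrow> 'a::euclidean_space set" where
  "trunc_cone r h = {x. let x' = x - (x \<bullet> last_dir) *\<^sub>R last_dir; xd = x \<bullet> last_dir in
      norm x' < r \<and> h * norm x' / r < xd \<and> xd < h}"

definition uniform_cone_property :: "'a::euclidean_space set \<Rightarrow> bool" where
  "uniform_cone_property U \<longleftrightarrow> (\<forall>x\<in>frontier U. \<exists>\<epsilon>>0. \<exists>r>0. \<exists>h>0. \<exists>A::'a \<Rightarrow> 'a.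
      orthogonal_transformation A \<and>
      (\<forall>y\<in>closure U \<inter> ball x \<epsilon>. (\<lambda>z. y + A z) ` trunc_cone r h \<subseteq> U))"

definition lipschitz_set :: "'a::euclidean_space set \<Rightarrow> bool" where
  "lipschitz_set X \<longleftrightarrow> closed X \<and> X = closure (interior X) \<and> X \<noteq> {} \<and>
      uniform_cone_property (interior X)"

end

theory Submission
  imports Defs
begin

text \<open>The first inclusion is a Faa di Bruno estimate: log-convexity pulls the weights out of the
  recursion for the derivatives of \<open>f \<circ> c\<close>, leaving a composition of geometric series.

  For the second inclusion let \<open>f\<close> be in the arc class. Non-quasianalyticity provides cutoffs that are
  flatter than the class requires, so that countably many pieces of curves can be glued inside
  \<open>X\<close>, using the cones. If the derivatives of \<open>f\<close> in cone directions at interior points \<open>y\<close> near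
  \<open>x0\<close> violated the bounds \<open>C \<rho>\<^sup>k k! M (2k)\<close>, then one glued curve running through pieces \<open>y + s\<^sup>2 v\<close>
  would give a contradiction. Hence \<open>f\<close> is Lipschitz near \<open>x0\<close> and has bounded derivatives of all
  orders along the cone directions. Extrapolating \<open>f\<close> from points \<open>y + i h z\<close>, \<open>i = 1, 2, \<dots>\<close>, with
  binomial weights and averaging over the cone directions \<open>z\<close> gives smooth functions \<open>f\<^sub>k\<close> whose
  differences are smaller than every power of \<open>h = (1/2)\<^sup>k\<close> in an \<open>h\<close>-neighbourhood of \<open>X\<close>; summing them
  with cutoffs yields a smooth extension of \<open>f\<close>. Polarization turns the bounds in cone
  directions into bounds for the full derivatives, which pass to the boundary by continuity.\<close>

section \<open>Composition with curves\<close>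

text \<open>Near a boundary point a curve in \<open>X\<close> can use a direction \<open>v\<close>
  only one-sidedly, so it runs through it as \<open>s\<^sup>2 v\<close>. This alone costs the
  passage from \<open>M k\<close> to \<open>M (2 * k)\<close>: the factor (2k)!/k! between the
  Taylor coefficients reduces the (2k)! of the class bound to k!.

  The obstacle in gluing is that squeezing a piece into a window of width r multiplies its j-th
  derivative by r^-j, which an estimate with one fixed \<rho> cannot absorb. An estimate for every
  \<rho> turns this factor into one constant per piece, and the amplitude of the piece compensates
  that constant. The amplitude in turn enters the detected derivative of order k only as a k-th
  power, so it can be hidden in the constants of the violations, which are chosen after the
  geometry.

  The obstacle in extending is that the boundary is only Lipschitz and \<open>f\<close> has no jets
  there yet, so neither flattening the boundary nor Whitney's theorem can start. Known are one-sided
  segments, and extrapolation uses just these: two successive extrapolations approximate the same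
  Taylor value at the missing end point.\<close>

lemma log_convex_ratio_mono:
  assumes "positive_seq M" "log_convex M" "k \<le> l"
  shows "M (Suc k) * M l \<le> M (Suc l) * M k"
  using \<open>k \<le> l\<close>
proof (induction l rule: dec_induct)
  case base
  then show ?case by simp
next
  case (step l)
  have pos: "M i > 0" for i using assms(1) by (simp add: positive_seq_def)
  have lc: "M (Suc l) * M (Suc l) \<le> M l * M (Suc (Suc l))"
    using assms(2) unfolding log_convex_def by (auto dest!: spec[of _ "Suc l"] simp: power2_eq_square)
  have "M l * (M (Suc k) * M (Suc l)) = (M (Suc k) * M l) * M (Suc l)" by simp
  also have "\<dots> \<le> (M (Suc l) * M k) * M (Suc l)"
    using step pos[of "Suc l"] by (simp add: mult_right_mono)
  also have "\<dots> = M k * (M (Suc l) * M (Suc l))" by simp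
  also have "\<dots> \<le> M k * (M l * M (Suc (Suc l)))"
    using lc pos[of k] by (simp add: mult_left_mono)
  finally have "M l * (M (Suc k) * M (Suc l)) \<le> M l * (M (Suc (Suc l)) * M k)"
    by (simp add: mult_ac)
  then show ?case using pos[of l] by simp
qed

text \<open>Raising \<open>p\<close> by one multiplies the left side by
  \<open>M (p + 2) / M (p + 1)\<close> and the right side by
  \<open>M (p + q + 2) / M (p + q + 1)\<close>, and quotients of consecutive terms increase. This is
  the form in which log-convexity enters the composition estimate.\<close>

lemma log_convex_mult_le:
  assumes "positive_seq M" "log_convex M"
  shows "M (Suc p) * M (Suc q) \<le> M 1 * M (Suc (p + q))"
proof (induction p)
  case 0
  then show ?case by simp
next
  case (Suc p)
  have pos: "M i > 0" for i using assms(1) by (simp add: positive_seq_def)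
  have "M (Suc p) * (M (Suc (Suc p)) * M (Suc q)) = M (Suc (Suc p)) * (M (Suc p) * M (Suc q))" by simp
  also have "\<dots> \<le> M (Suc (Suc p)) * (M 1 * M (Suc (p + q)))"
    using Suc pos[of "Suc (Suc p)"] by (simp add: mult_left_mono)
  also have "\<dots> = M 1 * (M (Suc (Suc p)) * M (Suc (p + q)))" by simp
  also have "\<dots> \<le> M 1 * (M (Suc (Suc (p + q))) * M (Suc p))"
    using log_convex_ratio_mono[OF assms, of "Suc p" "Suc (p+q)"] pos[of 1]
    by (intro mult_left_mono) auto
  finally have "M (Suc p) * (M (Suc (Suc p)) * M (Suc q)) \<le> M (Suc p) * (M 1 * M (Suc (Suc p + q)))"
    by (simp add: mult_ac)
  then show ?case using pos[of "Suc p"] by simp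
qed

lemma log_convex_le_Suc:
  assumes "positive_seq M" "log_convex M"
  shows "M k \<le> M 0 / M 1 * M (Suc k)"
proof -
  have pos: "M i > 0" for i using assms(1) by (simp add: positive_seq_def)
  show ?thesis using log_convex_ratio_mono[OF assms, of 0 k] pos[of 1]
    by (simp add: field_simps)
qed

text \<open>All derivatives are carried as an explicit sequence, which makes sums and rescalings of
  vector-valued curves easy to handle. On an open \<open>S\<close> a real sequence is determined by
  \<open>Q 0\<close>, through its iterated \<open>deriv\<close>.\<close>

definition jets_on :: "real set \<Rightarrow> (nat \<Rightarrow> real \<Rightarrow> 'b::real_normed_vector) \<Rightarrow> bool" where
  "jets_on S Q \<longleftrightarrow> (\<forall>k. \<forall>s\<in>S. (Q k has_vector_derivative Q (Suc k) s) (at s))"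

lemma jets_onD: "jets_on S Q \<Longrightarrow> s \<in> S \<Longrightarrow> (Q k has_vector_derivative Q (Suc k) s) (at s)"
  by (simp add: jets_on_def)

lemma jets_on_deriv:
  fixes Q :: "nat \<Rightarrow> real \<Rightarrow> real"
  assumes "open S" "jets_on S Q" "\<And>s. s \<in> S \<Longrightarrow> q s = Q 0 s" "s \<in> S"
  shows "(deriv ^^ k) q s = Q k s"
  using \<open>s \<in> S\<close>
proof (induction k arbitrary: s)
  case 0
  then show ?case using assms(3) by simp
next
  case (Suc k)
  have "(Q k has_real_derivative Q (Suc k) s) (at s)"
    using jets_onD[OF assms(2) Suc.prems] by (simp add: has_real_derivative_iff_has_vector_derivative)
  then have "((deriv ^^ k) q has_real_derivative Q (Suc k) s) (at s)"
    by (rule has_field_derivative_transform_within_open[OF _ \<open>open S\<close> Suc.prems])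
       (simp add: Suc.IH)
  then show ?case by (simp add: DERIV_imp_deriv)
qed

text \<open>Iterated \<open>deriv\<close> depends only on the germ of \<open>q\<close>, so local
  jets, which may come from different extensions at different points, fit together.\<close>

lemma jets_on_deriv_local:
  fixes q :: "real \<Rightarrow> real"
  assumes "\<And>t. t \<in> S \<Longrightarrow> \<exists>I Q. open I \<and> t \<in> I \<and> jets_on I Q \<and> (\<forall>s\<in>I. q s = Q 0 s)"
  shows "jets_on S (\<lambda>k. (deriv ^^ k) q)"
  unfolding jets_on_def
proof (intro allI ballI)
  fix k t assume "t \<in> S"
  then obtain I Q where I: "open I" "t \<in> I" "jets_on I Q" "\<forall>s\<in>I. q s = Q 0 s"
    using assms by blast
  have eq: "(deriv ^^ j) q s = Q j s" if "s \<in> I" for j s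
    using jets_on_deriv[OF I(1,3) _ that] I(4) by simp
  have "(Q k has_vector_derivative Q (Suc k) t) (at t)" using jets_onD[OF I(3,2)] .
  then have "((deriv ^^ k) q has_vector_derivative Q (Suc k) t) (at t)"
    by (rule has_vector_derivative_transform_within_open[OF _ I(1,2)]) (simp add: eq)
  then show "((deriv ^^ k) q has_vector_derivative (deriv ^^ Suc k) q t) (at t)"
    using eq[OF I(2), of "Suc k"] by simp
qed

text \<open>The \<open>n\<close>-th derivative in \<open>s\<close> of
  \<open>D (length bs) (c 0 s) bs\<close>: the first derivative is a sum over coordinates of
  products, and the Leibniz rule of order \<open>n\<close> is applied to these. A recursion thus
  replaces the sum over partitions in Faa di Bruno's formula; \<open>bs\<close> has to be general
  because each step adds a direction.\<close>

fun comp_jet :: "(nat \<Rightarrow> 'a::euclidean_space \<Rightarrow> 'a list \<Rightarrow> real) \<Rightarrow> (nat \<Rightarrow> real \<Rightarrow> 'a) \<Rightarrow>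
    nat \<Rightarrow> 'a list \<Rightarrow> real \<Rightarrow> real" where
  "comp_jet D c 0 bs s = D (length bs) (c 0 s) bs"
| "comp_jet D c (Suc n) bs s =
    (\<Sum>b\<in>Basis. \<Sum>i\<le>n. real (n choose i) * comp_jet D c i (b # bs) s * (c (Suc (n - i)) s \<bullet> b))"

text \<open>Differentiating the Leibniz sum of order \<open>m\<close> gives the one of order
  \<open>m + 1\<close>. With \<open>y\<close> constantly 1 it is also the induction step for
  binomial expansions and finite differences, and is used so later.\<close>

lemma pascal_sum:
  fixes x y :: "nat \<Rightarrow> real"
  shows "(\<Sum>i\<le>m. real (m choose i) * (x (Suc i) * y (Suc (m - i)) + x i * y (Suc (Suc (m - i)))))
    = (\<Sum>i\<le>Suc m. real (Suc m choose i) * x i * y (Suc (Suc m - i)))"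
proof -
  have "(\<Sum>i\<le>Suc m. real (Suc m choose i) * x i * y (Suc (Suc m - i)))
    = x 0 * y (Suc (Suc m)) + (\<Sum>i\<le>m. real (Suc m choose Suc i) * x (Suc i) * y (Suc (m - i)))"
    by (subst sum.atMost_Suc_shift) simp
  also have "(\<Sum>i\<le>m. real (Suc m choose Suc i) * x (Suc i) * y (Suc (m - i)))
    = (\<Sum>i\<le>m. real (m choose i) * x (Suc i) * y (Suc (m - i)))
    + (\<Sum>i\<le>m. real (m choose Suc i) * x (Suc i) * y (Suc (m - i)))"
    by (simp add: sum.distrib[symmetric] algebra_simps)
  also have "(\<Sum>i\<le>m. real (m choose Suc i) * x (Suc i) * y (Suc (m - i)))
    = (\<Sum>i\<le>Suc m. real (m choose i) * x i * y (Suc (Suc m - i))) - x 0 * y (Suc (Suc m))"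
    by (subst sum.atMost_Suc_shift) simp
  also have "(\<Sum>i\<le>Suc m. real (m choose i) * x i * y (Suc (Suc m - i)))
    = (\<Sum>i\<le>m. real (m choose i) * x i * y (Suc (Suc (m - i))))"
    by (simp add: Suc_diff_le)
  finally show ?thesis by (simp add: sum.distrib[symmetric] algebra_simps)
qed

lemma smooth_jetD:
  "smooth_jet U g D \<Longrightarrow> x \<in> U \<Longrightarrow>
    ((\<lambda>y. D (length vs) y vs) has_derivative (\<lambda>v. D (Suc (length vs)) x (v # vs))) (at x)"
  by (simp add: smooth_jet_def)

lemma smooth_jet_line_derivative:
  assumes "smooth_jet U g D" "y + t *\<^sub>R v \<in> U"
  shows "((\<lambda>t. D (length vs) (y + t *\<^sub>R v) vs) has_real_derivative D (Suc (length vs)) (y + t *\<^sub>R v) (v # vs)) (at t)"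
proof -
  have "((\<lambda>t. y + t *\<^sub>R v) has_vector_derivative v) (at t)" by (auto intro!: derivative_eq_intros)
  from vector_derivative_diff_chain_within[OF this, of "\<lambda>y. D (length vs) y vs" "\<lambda>w. D (Suc (length vs)) (y + t *\<^sub>R v) (w # vs)"]
  show ?thesis using smooth_jetD[OF assms, of vs]
    by (simp add: o_def has_real_derivative_iff_has_vector_derivative has_derivative_at_withinI)
qed

lemma has_derivative_euclidean_expand:
  fixes v :: "'a::euclidean_space"
  assumes "(f has_derivative (f' :: 'a \<Rightarrow> real)) F"
  shows "f' v = (\<Sum>b\<in>Basis. (v \<bullet> b) * f' b)"
proof -
  have "linear f'" using assms has_derivative_linear by blast
  then have "f' (\<Sum>b\<in>Basis. (v \<bullet> b) *\<^sub>R b) = (\<Sum>b\<in>Basis. (v \<bullet> b) * f' b)"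
    by (simp add: linear_sum linear_scale)
  then show ?thesis by (simp add: euclidean_representation)
qed

lemma comp_jet_has_derivative:
  fixes c :: "nat \<Rightarrow> real \<Rightarrow> 'a::euclidean_space"
  assumes D: "smooth_jet U g D" and c: "\<And>k t. (c k has_vector_derivative c (Suc k) t) (at t)"
    and s: "c 0 s \<in> U"
  shows "(comp_jet D c n bs has_real_derivative comp_jet D c (Suc n) bs s) (at s)"
proof (induction n arbitrary: bs rule: less_induct)
  case (less n)
  show ?case
  proof (cases n)
    case 0
    have d: "((\<lambda>y. D (length bs) y bs) has_derivative (\<lambda>v. D (Suc (length bs)) (c 0 s) (v # bs))) (at (c 0 s))"
      using smooth_jetD[OF D s] .
    have "((\<lambda>y. D (length bs) y bs) \<circ> c 0 has_vector_derivative D (Suc (length bs)) (c 0 s) (c (Suc 0) s # bs)) (at s)"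
      by (rule vector_derivative_diff_chain_within[OF c]) (use d has_derivative_at_withinI in blast)
    moreover have "comp_jet D c 0 bs = (\<lambda>y. D (length bs) y bs) \<circ> c 0" by (auto simp: fun_eq_iff)
    ultimately have "(comp_jet D c 0 bs has_real_derivative D (Suc (length bs)) (c 0 s) (c (Suc 0) s # bs)) (at s)"
      by (simp add: has_real_derivative_iff_has_vector_derivative)
    moreover have "comp_jet D c (Suc 0) bs s = D (Suc (length bs)) (c 0 s) (c (Suc 0) s # bs)"
      by (simp add: has_derivative_euclidean_expand[OF d, of "c (Suc 0) s"] mult.commute)
    ultimately show ?thesis by (simp only: 0)
  next
    case (Suc m)
    have ci: "((\<lambda>s. c k s \<bullet> b) has_real_derivative c (Suc k) s \<bullet> b) (at s)" for k b
      using c[of k s] unfolding has_real_derivative_iff_has_vector_derivative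
      by (rule bounded_linear.has_vector_derivative[OF bounded_linear_inner_left])
    have "((\<lambda>s. \<Sum>b\<in>Basis. \<Sum>i\<le>m. real (m choose i) * comp_jet D c i (b # bs) s * (c (Suc (m - i)) s \<bullet> b))
      has_real_derivative (\<Sum>b\<in>Basis. \<Sum>i\<le>m. real (m choose i) *
        (comp_jet D c (Suc i) (b # bs) s * (c (Suc (m - i)) s \<bullet> b)
         + comp_jet D c i (b # bs) s * (c (Suc (Suc (m - i))) s \<bullet> b)))) (at s)"
      (is "(_ has_real_derivative ?R) _")
    proof (intro DERIV_sum)
      fix b i assume "i \<in> {..m}"
      then have "i < n" using Suc by simp
      from DERIV_cmult[OF DERIV_mult[OF less(1)[OF this, of "b # bs"] ci[of "Suc (m-i)" b]], of "real (m choose i)"]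
      show "((\<lambda>x. real (m choose i) * comp_jet D c i (b # bs) x * (c (Suc (m - i)) x \<bullet> b)) has_real_derivative
            real (m choose i) *
            (comp_jet D c (Suc i) (b # bs) s * (c (Suc (m - i)) s \<bullet> b) +
             comp_jet D c i (b # bs) s * (c (Suc (Suc (m - i))) s \<bullet> b))) (at s)"
        by (simp only: mult_ac add_ac)
    qed
    moreover have "?R = comp_jet D c (Suc n) bs s"
      unfolding Suc comp_jet.simps(2)[of D c "Suc m"]
    proof (rule sum.cong[OF refl])
      fix b :: 'a
      show "(\<Sum>i\<le>m. real (m choose i) * (comp_jet D c (Suc i) (b # bs) s * (c (Suc (m - i)) s \<bullet> b) +
               comp_jet D c i (b # bs) s * (c (Suc (Suc (m - i))) s \<bullet> b)))
         = (\<Sum>i\<le>Suc m. real (Suc m choose i) * comp_jet D c i (b # bs) s * (c (Suc (Suc m - i)) s \<bullet> b))"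
        using pascal_sum[of m "\<lambda>i. comp_jet D c i (b # bs) s" "\<lambda>k. c k s \<bullet> b"] .
    qed
    ultimately show ?thesis using Suc by simp
  qed
qed

text \<open>After division by \<open>T ^ Suc n\<close> the left side is \<open>B\<close> times a
  partial sum of the series of \<open>(r / T) ^ j\<close>, starting at j = 1, whose total r/(T - r)
  equals 1/B for \<open>T = r * (1 + B)\<close>. So the powers of \<open>T\<close> reproduce
  themselves under the recursion of \<open>comp_jet\<close>.\<close>

lemma geometric_convolution_le:
  fixes B r T :: real
  assumes "B \<ge> 0" "r \<ge> 0" "T \<ge> r * (1 + B)"
  shows "B * (\<Sum>i\<le>n. r ^ (Suc n - i) * T ^ i) \<le> T ^ Suc n"
proof (induction n)
  case 0
  show ?case using assms by (simp add: algebra_simps)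
next
  case (Suc n)
  have T: "T \<ge> 0" using assms by (meson add_nonneg_nonneg mult_nonneg_nonneg order_trans zero_le_one)
  have "(\<Sum>i\<le>Suc n. r ^ (Suc (Suc n) - i) * T ^ i) = (\<Sum>i\<le>n. r ^ (Suc (Suc n) - i) * T ^ i) + r * T ^ Suc n"
    by simp
  also have "(\<Sum>i\<le>n. r ^ (Suc (Suc n) - i) * T ^ i) = r * (\<Sum>i\<le>n. r ^ (Suc n - i) * T ^ i)"
    unfolding sum_distrib_left by (intro sum.cong) (auto simp: Suc_diff_le)
  finally have "B * (\<Sum>i\<le>Suc n. r ^ (Suc (Suc n) - i) * T ^ i)
     = r * (B * (\<Sum>i\<le>n. r ^ (Suc n - i) * T ^ i)) + r * B * T ^ Suc n"
    by (simp add: algebra_simps)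
  also have "\<dots> \<le> r * T ^ Suc n + r * B * T ^ Suc n"
    using Suc assms by (simp add: mult_left_mono)
  also have "\<dots> = r * (1 + B) * T ^ Suc n" by (simp add: algebra_simps)
  also have "\<dots> \<le> T * T ^ Suc n" using assms T by (intro mult_right_mono) auto
  finally show ?case by simp
qed

text \<open>Writing the binomial coefficient with factorials splits the claim into (i + j + 1)!/i!
  \<le> (n + j + 1)!/n! and n - i + 1 \<le> 2^(n - i + 1). The power of 2 becomes the factor 2 in
  \<open>2 * \<rho>\<close> of the composition estimate.\<close>

lemma choose_fact_le:
  assumes "i \<le> n"
  shows "real (n choose i) * fact (Suc (n - i)) * fact (i + Suc j) \<le> 2 ^ Suc (n - i) * fact (n + Suc j)"
proof -
  have mono: "fact (i + Suc j) * fact n \<le> (fact (n + Suc j) * fact i :: real)"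
  proof -
    have "fact (i + Suc j) * fact (i + d) \<le> (fact (i + d + Suc j) * fact i :: real)" for d
    proof (induction d)
      case 0 then show ?case by simp
    next
      case (Suc d)
      have "fact (i + Suc j) * fact (i + Suc d) = real (i + Suc d) * (fact (i + Suc j) * fact (i + d))" by simp
      also have "\<dots> \<le> real (i + Suc d + Suc j) * (fact (i + d + Suc j) * fact i)"
        by (rule mult_mono[OF _ Suc]) auto
      also have "\<dots> = fact (i + Suc d + Suc j) * fact i" by simp
      finally show ?case .
    qed
    from this[of "n - i"] show ?thesis using assms by simp
  qed
  have l: "real (Suc l) \<le> 2 ^ Suc l" for l by (induction l) auto
  have "real (n choose i) * fact (n - i) * fact i = fact n"
    using binomial_fact_lemma[OF assms] by (metis (no_types) mult.commute mult.left_commute of_nat_fact of_nat_mult)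
  then have e: "(fact n :: real) = real (n choose i) * fact (n - i) * fact i" by simp
  have "(real (n choose i) * fact (Suc (n - i)) * fact (i + Suc j)) * fact i
      = real (Suc (n - i)) * (fact (i + Suc j) * fact n)"
    unfolding e fact_Suc[of "n - i"] by (simp only: mult_ac)
  also have "\<dots> \<le> 2 ^ Suc (n - i) * (fact (n + Suc j) * fact i)"
    by (rule mult_mono[OF l mono]) auto
  finally have "(real (n choose i) * fact (Suc (n - i)) * fact (i + Suc j)) * fact i
     \<le> (2 ^ Suc (n - i) * fact (n + Suc j)) * fact i" by (simp add: mult_ac)
  then show ?thesis by simp
qed

text \<open>By log-convexity \<open>M (i + j + 1) * M (n - i + 1) \<le> M 1 * M (n + j + 1)\<close>, so the weights
  leave the recursion and what remains is the composition of two geometric majorants.\<close>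

lemma comp_jet_bound:
  fixes c :: "nat \<Rightarrow> real \<Rightarrow> 'a::euclidean_space"
  assumes M: "positive_seq M" "log_convex M"
    and pos: "C > 0" "\<sigma> > 0" "B > 0" "\<rho> > 0"
    and D: "\<And>bs. set bs \<subseteq> Basis \<Longrightarrow> \<bar>D (length bs) (c 0 s) bs\<bar> \<le> C * \<sigma> ^ length bs * fact (length bs) * M (length bs)"
    and c: "\<And>k. norm (c k s) \<le> B * \<rho> ^ k * fact k * M k"
    and \<tau>: "\<tau> = 2 * \<rho> * (1 + real DIM('a) * B * M 1 * \<sigma>)"
    and bs: "set bs \<subseteq> Basis"
  shows "\<bar>comp_jet D c n bs s\<bar> \<le> C * \<sigma> ^ length bs * \<tau> ^ n * fact (n + length bs) * M (n + length bs)"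
  using bs
proof (induction n arbitrary: bs rule: less_induct)
  case (less n)
  have Mp: "M i > 0" for i using M(1) by (simp add: positive_seq_def)
  have \<tau>0: "\<tau> > 0" unfolding \<tau> using pos Mp[of 1] by (intro mult_pos_pos add_pos_nonneg) auto
  show ?case
  proof (cases n)
    case 0
    then show ?thesis using D[OF less.prems] by simp
  next
    case (Suc m)
    let ?j = "length bs"
    define W where "W = C * \<sigma> ^ Suc ?j * B * M 1 * M (Suc (m + ?j)) * fact (m + Suc ?j)"
    have W0: "W \<ge> 0" unfolding W_def using pos Mp by (simp add: less_imp_le)
    have trm: "\<bar>real (m choose i) * comp_jet D c i (b # bs) s * (c (Suc (m - i)) s \<bullet> b)\<bar>
       \<le> W * ((2 * \<rho>) ^ (Suc m - i) * \<tau> ^ i)" if "i \<le> m" "b \<in> Basis" for i b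
    proof -
      have 1: "\<bar>comp_jet D c i (b # bs) s\<bar> \<le> C * \<sigma> ^ Suc ?j * \<tau> ^ i * fact (i + Suc ?j) * M (i + Suc ?j)"
        using less.IH[of i "b # bs"] that Suc less.prems by simp
      have 2: "\<bar>c (Suc (m - i)) s \<bullet> b\<bar> \<le> B * \<rho> ^ Suc (m - i) * fact (Suc (m - i)) * M (Suc (m - i))"
        using c[of "Suc (m - i)"] Basis_le_norm[OF that(2), of "c (Suc (m - i)) s"] by linarith
      have "\<bar>real (m choose i) * comp_jet D c i (b # bs) s * (c (Suc (m - i)) s \<bullet> b)\<bar>
        = real (m choose i) * (\<bar>comp_jet D c i (b # bs) s\<bar> * \<bar>c (Suc (m - i)) s \<bullet> b\<bar>)"
        by (simp add: abs_mult)
      also have "\<dots> \<le> real (m choose i) * ((C * \<sigma> ^ Suc ?j * \<tau> ^ i * fact (i + Suc ?j) * M (i + Suc ?j)) *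
            (B * \<rho> ^ Suc (m - i) * fact (Suc (m - i)) * M (Suc (m - i))))"
        by (rule mult_left_mono[OF mult_mono[OF 1 2]]) (use 1 in linarith, auto)
      also have "\<dots> = (C * \<sigma> ^ Suc ?j * B) * (\<rho> ^ Suc (m - i) * \<tau> ^ i) *
          ((real (m choose i) * fact (Suc (m - i)) * fact (i + Suc ?j)) * (M (Suc (i + ?j)) * M (Suc (m - i))))"
        by (simp only: mult_ac add_Suc_right)
      also have "\<dots> \<le> (C * \<sigma> ^ Suc ?j * B) * (\<rho> ^ Suc (m - i) * \<tau> ^ i) *
          ((2 ^ Suc (m - i) * fact (m + Suc ?j)) * (M 1 * M (Suc (m + ?j))))"
      proof (rule mult_left_mono[OF mult_mono[OF choose_fact_le[OF that(1)]]])
        show "M (Suc (i + ?j)) * M (Suc (m - i)) \<le> M 1 * M (Suc (m + ?j))"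
          using log_convex_mult_le[OF M, of "i + ?j" "m - i"] that(1) by (simp add: algebra_simps)
      qed (use pos \<tau>0 Mp in \<open>auto simp: less_imp_le\<close>)
      also have "\<dots> = W * ((2 * \<rho>) ^ Suc (m - i) * \<tau> ^ i)"
        unfolding W_def power_mult_distrib by (simp only: mult_ac)
      finally show ?thesis using that(1) by (simp add: Suc_diff_le)
    qed
    have "\<bar>comp_jet D c (Suc m) bs s\<bar> \<le> (\<Sum>b\<in>(Basis::'a set). \<Sum>i\<le>m. W * ((2 * \<rho>) ^ (Suc m - i) * \<tau> ^ i))"
      unfolding comp_jet.simps
      by (intro order_trans[OF sum_abs] sum_mono) (use trm in auto)
    also have "\<dots> = W * (real DIM('a) * (\<Sum>i\<le>m. (2 * \<rho>) ^ (Suc m - i) * \<tau> ^ i))"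
      by (simp add: sum_distrib_left mult_ac)
    also have "\<dots> = C * \<sigma> ^ ?j * M (Suc (m + ?j)) * fact (m + Suc ?j) *
        ((real DIM('a) * B * M 1 * \<sigma>) * (\<Sum>i\<le>m. (2 * \<rho>) ^ (Suc m - i) * \<tau> ^ i))"
      unfolding W_def by (simp add: mult_ac)
    also have "\<dots> \<le> C * \<sigma> ^ ?j * M (Suc (m + ?j)) * fact (m + Suc ?j) * \<tau> ^ Suc m"
      by (rule mult_left_mono[OF geometric_convolution_le]) (use pos Mp in \<open>auto simp: \<tau> less_imp_le\<close>)
    finally show ?thesis using Suc by (simp add: mult_ac)
  qed
qed

lemma curve_class_iff:
  "c \<in> curve_class N \<longleftrightarrow> (\<exists>D. D 0 = c \<and> jets_on UNIV D \<and> (\<forall>K. compact K \<longrightarrow> (\<exists>C \<rho>. C > 0 \<and> \<rho> > 0 \<and>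
          (\<forall>k. \<forall>t\<in>K. norm (D k t) \<le> C * \<rho> ^ k * fact k * N k))))"
  by (simp add: curve_class_def jets_on_def)

theorem ultra_class_subset_arc_class:
  fixes X :: "'a::euclidean_space set"
  assumes M: "positive_seq M" "log_convex M"
  shows "ultra_class M X \<subseteq> arc_class M X"
proof
  fix f assume f: "f \<in> ultra_class M X"
  show "f \<in> arc_class M X"
    unfolding arc_class_def
  proof (safe)
    fix c :: "real \<Rightarrow> 'a" assume "c \<in> curve_class M" and X: "range c \<subseteq> X"
    obtain cj where "cj 0 = c \<and> jets_on UNIV cj \<and> (\<forall>K. compact K \<longrightarrow>
        (\<exists>C \<rho>. C > 0 \<and> \<rho> > 0 \<and> (\<forall>k. \<forall>t\<in>K. norm (cj k t) \<le> C * \<rho> ^ k * fact k * M k)))"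
      using \<open>c \<in> curve_class M\<close> unfolding curve_class_iff by (rule exE)
    then have cj: "cj 0 = c" "jets_on UNIV cj" and cjb: "\<forall>K. compact K \<longrightarrow>
        (\<exists>C \<rho>. C > 0 \<and> \<rho> > 0 \<and> (\<forall>k. \<forall>t\<in>K. norm (cj k t) \<le> C * \<rho> ^ k * fact k * M k))"
      by simp_all
    have cX: "c t \<in> X" for t using X by auto
    have cont: "continuous_on UNIV c"
      using jets_onD[OF cj(2), of _ 0] cj(1)
      by (auto intro!: continuous_at_imp_continuous_on has_vector_derivative_continuous)
    have loc: "\<exists>U g D. local_ext X f (c t) U g D" for t
    proof -
      have "f \<in> smooth_on_set X" using f by (simp add: ultra_class_def)
      then show ?thesis using cX[of t] by (simp add: smooth_on_set_def)
    qed
    have jet: "open (c -` U) \<and> t \<in> c -` U \<and> jets_on (c -` U) (\<lambda>n. comp_jet D cj n []) \<and>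
        (\<forall>s\<in>c -` U. (f \<circ> c) s = comp_jet D cj 0 [] s)"
      if "local_ext X f (c t) U g D" for t U g D
    proof (intro conjI)
      show "open (c -` U)" using cont that by (simp add: local_ext_def continuous_on_open_vimage)
      show "t \<in> c -` U" using that by (simp add: local_ext_def)
      show "jets_on (c -` U) (\<lambda>n. comp_jet D cj n [])"
        unfolding jets_on_def has_real_derivative_iff_has_vector_derivative[symmetric]
        using that cj(1)
        by (intro allI ballI comp_jet_has_derivative[of U g D cj] jets_onD[OF cj(2)]) (auto simp: local_ext_def)
      show "\<forall>s\<in>c -` U. (f \<circ> c) s = comp_jet D cj 0 [] s"
        using that cX cj(1) by (auto simp: local_ext_def smooth_jet_def)
    qed
    \<comment> \<open>The extension changes with \<open>t\<close>, so the jet of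
      \<open>f \<circ> c\<close> is defined intrinsically; \<open>Heq\<close> identifies it at each
      point with the \<open>comp_jet\<close> of whichever extension is at hand.\<close>
    define H where "H = (\<lambda>k. (deriv ^^ k) (f \<circ> c))"
    have Hj: "jets_on UNIV H" unfolding H_def
    proof (rule jets_on_deriv_local)
      fix t obtain U g D where "local_ext X f (c t) U g D" using loc by blast
      from jet[OF this] show "\<exists>I Q. open I \<and> t \<in> I \<and> jets_on I Q \<and> (\<forall>s\<in>I. (f \<circ> c) s = Q 0 s)" 
        by (intro exI[of _ "c -` U"] exI[of _ "\<lambda>n. comp_jet D cj n []"]) simp
    qed
    have Heq: "H k t = comp_jet D cj k [] t" if "local_ext X f (c t) U g D" for t U g D k
      unfolding H_def using jet[OF that] by (intro jets_on_deriv[of "c -` U"]) auto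
    have "\<exists>C \<rho>. C > 0 \<and> \<rho> > 0 \<and> (\<forall>k. \<forall>t\<in>K. norm (H k t) \<le> C * \<rho> ^ k * fact k * M k)" if K: "compact K" for K
    proof -
      obtain B \<rho> where B: "B > 0" "\<rho> > 0" "\<And>k t. t \<in> K \<Longrightarrow> norm (cj k t) \<le> B * \<rho> ^ k * fact k * M k"
        using cjb K by meson
      have "compact (c ` K)" using K cont by (meson compact_continuous_image continuous_on_subset subset_UNIV)
      moreover have "c ` K \<subseteq> X" using X by auto
      ultimately obtain C \<sigma> where "C > 0 \<and> \<sigma> > 0 \<and> (\<forall>k. \<forall>x\<in>c ` K. \<forall>U g D. local_ext X f x U g D \<longrightarrow>
          (\<forall>vs. length vs = k \<and> (\<forall>v\<in>set vs. norm v \<le> 1) \<longrightarrow> \<bar>D k x vs\<bar> \<le> C * \<sigma> ^ k * fact k * M k))"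
        using f unfolding ultra_class_def mem_Collect_eq by meson
      then have C: "C > 0" "\<sigma> > 0" "\<And>k x U g D vs. \<lbrakk>x \<in> c ` K; local_ext X f x U g D;
          length vs = k; \<forall>v\<in>set vs. norm v \<le> 1\<rbrakk> \<Longrightarrow> \<bar>D k x vs\<bar> \<le> C * \<sigma> ^ k * fact k * M k"
        by (blast+)
      define \<tau> where "\<tau> = 2 * \<rho> * (1 + real DIM('a) * B * M 1 * \<sigma>)"
      have "M 1 > 0" using M(1) by (simp add: positive_seq_def)
      then have \<tau>0: "\<tau> > 0" unfolding \<tau>_def using B C by (intro mult_pos_pos add_pos_nonneg) auto
      have "norm (H k t) \<le> C * \<tau> ^ k * fact k * M k" if t: "t \<in> K" for k t
      proof -
        obtain U g D where l: "local_ext X f (c t) U g D" using loc by blast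
        have "\<bar>D (length bs) (cj 0 t) bs\<bar> \<le> C * \<sigma> ^ length bs * fact (length bs) * M (length bs)" 
          if "set bs \<subseteq> Basis" for bs
          using C(3)[OF _ l refl] that t cj(1) by (auto simp: subset_iff norm_Basis)
        from comp_jet_bound[where M = M and C = C and \<sigma> = \<sigma> and B = B and \<rho> = \<rho> and D = D and c = cj
            and s = t and bs = "[]" and n = k, OF M C(1,2) B(1,2) this B(3)[OF t] \<tau>_def]
        show ?thesis by (simp add: Heq[OF l])
      qed
      then show ?thesis using C(1) \<tau>0 by blast
    qed
    then show "f \<circ> c \<in> curve_class M"
      using Hj unfolding curve_class_iff by (intro exI[of _ H]) (auto simp: H_def)
  qed
qed

section \<open>Non-quasianalytic cutoff functions\<close>

lemma antiderivative_exists: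
  fixes g :: "real \<Rightarrow> real"
  assumes "continuous_on UNIV g"
  shows "\<exists>G. \<forall>x. (G has_real_derivative g x) (at x)"
proof -
  have int: "g integrable_on {u..v}" for u v
    using assms by (intro integrable_continuous_real) (meson continuous_on_subset subset_UNIV)
  define G where "G = (\<lambda>x. if x \<ge> 0 then integral {0..x} g else - integral {x..0} g)"
  have "(G has_real_derivative g x) (at x)" for x
  proof -
    define N where "N = \<bar>x\<bar> + 1"
    have eq: "G u = integral {-N..u} g - integral {-N..0} g" if "u \<in> {-N<..<N}" for u
      using Henstock_Kurzweil_Integration.integral_combine[of "-N" 0 u g]
        Henstock_Kurzweil_Integration.integral_combine[of "-N" u 0 g] that int
      by (auto simp: G_def N_def)
    have "((\<lambda>u. integral {-N..u} g) has_real_derivative g x) (at x within {-N..N})"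
      using assms by (intro integral_has_real_derivative) (auto simp: N_def intro: continuous_on_subset)
    then have "((\<lambda>u. integral {-N..u} g) has_real_derivative g x) (at x within {-N<..<N})"
      by (rule DERIV_subset) auto
    then have "((\<lambda>u. integral {-N..u} g) has_real_derivative g x) (at x)"
      by (subst (asm) at_within_open) (auto simp: N_def)
    then have "((\<lambda>u. integral {-N..u} g - integral {-N..0} g) has_real_derivative g x - 0) (at x)"
      by (intro DERIV_diff DERIV_const)
    then have "((\<lambda>u. integral {-N..u} g - integral {-N..0} g) has_real_derivative g x) (at x)" by simp
    then show ?thesis
      by (rule has_field_derivative_transform_within_open[where S = "{-N<..<N}"]) (auto simp: N_def eq)
  qed
  then show ?thesis by blast
qed

definition antiderivative :: "(real \<Rightarrow> real) \<Rightarrow> real \<Rightarrow> real" where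
  "antiderivative g = (SOME G. \<forall>x. (G has_real_derivative g x) (at x))"

lemma antiderivative_has_derivative:
  assumes "continuous_on UNIV g"
  shows "(antiderivative g has_real_derivative g x) (at x)"
  using someI_ex[OF antiderivative_exists[OF assms]] unfolding antiderivative_def by blast

text \<open>Convolution with the normalised indicator function of the interval from
  \<open>- a\<close> to \<open>a\<close>. Written with a primitive, its derivative is visibly a
  difference quotient of \<open>g\<close>.\<close>

definition box_avg :: "real \<Rightarrow> (real \<Rightarrow> real) \<Rightarrow> real \<Rightarrow> real" where
  "box_avg a g x = (antiderivative g (x + a) - antiderivative g (x - a)) / (2 * a)"

text \<open>The mean value theorem for the difference of the two primitives. With
  \<open>d = 0\<close> it compares the averages of two functions, with \<open>g1 = g2\<close> one
  average at two points, so estimates for averages reduce to pointwise ones.\<close>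

lemma box_avg_diff_mvt:
  assumes "continuous_on UNIV g1" "continuous_on UNIV g2" "a > 0"
  shows "\<exists>\<xi>. \<bar>\<xi> - x\<bar> < a \<and> box_avg a g1 (x + d) - box_avg a g2 x = g1 (\<xi> + d) - g2 \<xi>"
proof -
  define H where "H = (\<lambda>u. antiderivative g1 (u + d) - antiderivative g2 u)"
  have H: "(H has_real_derivative g1 (u + d) - g2 u) (at u)" for u
    unfolding H_def
    by (intro DERIV_diff antiderivative_has_derivative assms DERIV_shift[THEN iffD1])
  obtain \<xi> where \<xi>: "\<xi> > x - a" "\<xi> < x + a" "H (x + a) - H (x - a) = (x + a - (x - a)) * (g1 (\<xi> + d) - g2 \<xi>)"
    using MVT2[of "x - a" "x + a" H "\<lambda>u. g1 (u + d) - g2 u"] H assms(3) by auto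
  have "box_avg a g1 (x + d) - box_avg a g2 x = (H (x + a) - H (x - a)) / (2 * a)"
  proof -
    have "x + d + a = x + a + d" "x + d - a = x - a + d" by simp_all
    then show ?thesis by (simp only: box_avg_def H_def diff_divide_distrib)
  qed
  also have "\<dots> = g1 (\<xi> + d) - g2 \<xi>" using \<xi>(3) assms(3) by simp
  finally show ?thesis using \<xi>(1,2) by (intro exI[of _ \<xi>]) auto
qed

lemma box_avg_const [simp]: "a > 0 \<Longrightarrow> box_avg a (\<lambda>_. c) x = c"
proof -
  assume "a > 0"
  have "\<exists>\<xi>. \<xi> > x - a \<and> \<xi> < x + a \<and> antiderivative (\<lambda>_. c) (x + a) - antiderivative (\<lambda>_. c) (x - a) = (x + a - (x - a)) * c"
    using \<open>a > 0\<close> by (intro MVT2) (auto intro!: antiderivative_has_derivative)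
  then show ?thesis using \<open>a > 0\<close> by (auto simp: box_avg_def)
qed

lemma box_avg_mvt:
  assumes "continuous_on UNIV g" "a > 0"
  shows "\<exists>\<xi>. \<bar>\<xi> - x\<bar> < a \<and> box_avg a g x = g \<xi>"
  using box_avg_diff_mvt[OF assms(1) _ assms(2), of "\<lambda>_. 0" x 0] assms(2) by simp

lemma box_avg_has_derivative:
  assumes "continuous_on UNIV g" "a > 0"
  shows "(box_avg a g has_real_derivative (g (x + a) - g (x - a)) / (2 * a)) (at x)"
proof -
  have "((\<lambda>x. antiderivative g (x + a)) has_real_derivative g (x + a)) (at x)"
    by (intro antiderivative_has_derivative assms DERIV_shift[THEN iffD1])
  moreover have "((\<lambda>x. antiderivative g (x + - a)) has_real_derivative g (x + - a)) (at x)"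
    by (intro antiderivative_has_derivative assms DERIV_shift[THEN iffD1])
  ultimately show ?thesis unfolding box_avg_def
    by (intro DERIV_cdivide DERIV_diff) auto
qed

definition trapezoid :: "real \<Rightarrow> real" where "trapezoid t = max 0 (min 1 (2 - \<bar>t\<bar>))"

text \<open>\<open>iter_avg a n j\<close> is \<open>trapezoid\<close> convolved with the boxes of
  half-widths \<open>a j\<close>, ..., \<open>a (j + n - 1)\<close>. The starting index is kept
  because a \<open>k\<close>-th derivative consumes the first \<open>k\<close> boxes and leaves a
  convolution that starts at \<open>k\<close>.\<close>

primrec iter_avg :: "(nat \<Rightarrow> real) \<Rightarrow> nat \<Rightarrow> nat \<Rightarrow> real \<Rightarrow> real" where
  "iter_avg a 0 = (\<lambda>j. trapezoid)"
| "iter_avg a (Suc n) = (\<lambda>j. box_avg (a j) (iter_avg a n (Suc j)))"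

lemma lipschitz_imp_continuous_real:
  assumes "\<And>x y. \<bar>g x - g y\<bar> \<le> \<bar>x - y :: real\<bar>"
  shows "continuous_on UNIV (g :: real \<Rightarrow> real)"
proof -
  have "dist (g x') (g x) < e" if "dist x' x < e" for x x' e
    using assms[of x' x] that by (simp add: dist_real_def)
  then show ?thesis unfolding continuous_on_iff by blast
qed

lemma iter_avg_lipschitz:
  assumes "\<And>j. a j > 0"
  shows "\<bar>iter_avg a n j x - iter_avg a n j y\<bar> \<le> \<bar>x - y\<bar>"
proof (induction n arbitrary: j x y)
  case 0
  have "\<bar>\<bar>x\<bar> - \<bar>y\<bar>\<bar> \<le> \<bar>x - y\<bar>" by simp
  then show ?case unfolding iter_avg.simps trapezoid_def max_def min_def by (smt (verit))
next
  case (Suc n)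
  have c: "continuous_on UNIV (iter_avg a n (Suc j))" by (rule lipschitz_imp_continuous_real) (rule Suc)
  obtain \<xi> where "box_avg (a j) (iter_avg a n (Suc j)) (y + (x - y)) - box_avg (a j) (iter_avg a n (Suc j)) y
      = iter_avg a n (Suc j) (\<xi> + (x - y)) - iter_avg a n (Suc j) \<xi>"
    using box_avg_diff_mvt[OF c c assms] by blast
  then show ?case using Suc[of "Suc j" "\<xi> + (x - y)" \<xi>] by simp
qed

lemma iter_avg_continuous:
  assumes "\<And>j. a j > 0"
  shows "continuous_on UNIV (iter_avg a n j)"
  by (rule lipschitz_imp_continuous_real) (rule iter_avg_lipschitz[OF assms])

lemma iter_avg_range:
  assumes "\<And>j. a j > 0"
  shows "0 \<le> iter_avg a n j x \<and> iter_avg a n j x \<le> 1"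
proof (induction n arbitrary: j x)
  case 0
  then show ?case by (auto simp: trapezoid_def)
next
  case (Suc n)
  obtain \<xi> where "box_avg (a j) (iter_avg a n (Suc j)) x = iter_avg a n (Suc j) \<xi>"
    using box_avg_mvt[OF iter_avg_continuous[of a, OF assms] assms] by blast
  then show ?case using Suc by simp
qed

lemma iter_avg_values:
  assumes "\<And>j. a j > 0"
  shows "(\<bar>x\<bar> + (\<Sum>i<n. a (j + i)) \<le> 1 \<longrightarrow> iter_avg a n j x = 1) \<and>
    (2 + (\<Sum>i<n. a (j + i)) \<le> \<bar>x\<bar> \<longrightarrow> iter_avg a n j x = 0)"
proof (induction n arbitrary: j x)
  case 0
  show ?case by (auto simp: trapezoid_def)
next
  case (Suc n)
  obtain \<xi> where \<xi>: "\<bar>\<xi> - x\<bar> < a j" "box_avg (a j) (iter_avg a n (Suc j)) x = iter_avg a n (Suc j) \<xi>"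
    using box_avg_mvt[OF iter_avg_continuous[of a, OF assms] assms] by blast
  have s: "(\<Sum>i<Suc n. a (j + i)) = a j + (\<Sum>i<n. a (Suc j + i))"
    by (subst sum.lessThan_Suc_shift) simp
  show ?case unfolding s using \<xi> Suc[of \<xi> "Suc j"] by simp
qed

lemma iter_avg_step:
  assumes "\<And>j. a j > 0"
  shows "\<bar>iter_avg a (Suc n) j x - iter_avg a n j x\<bar> \<le> a (j + n)"
proof (induction n arbitrary: j x)
  case 0
  have "continuous_on UNIV trapezoid" using iter_avg_continuous[of a 0 j, OF assms] by simp
  then obtain \<xi> where "\<bar>\<xi> - x\<bar> < a j" "box_avg (a j) trapezoid x = trapezoid \<xi>"
    using box_avg_mvt[OF _ assms] by blast
  then show ?case using iter_avg_lipschitz[of a 0 j \<xi> x, OF assms] by simp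
next
  case (Suc n)
  obtain \<xi> where "box_avg (a j) (iter_avg a (Suc n) (Suc j)) (x + 0) - box_avg (a j) (iter_avg a n (Suc j)) x
     = iter_avg a (Suc n) (Suc j) (\<xi> + 0) - iter_avg a n (Suc j) \<xi>"
    using box_avg_diff_mvt[OF iter_avg_continuous[of a, OF assms] iter_avg_continuous[of a, OF assms] assms] by blast
  then show ?case using Suc[of "Suc j" \<xi>] by simp
qed

text \<open>The symmetric difference quotients with steps \<open>a (k - 1)\<close> down to
  \<open>a 0\<close>; the successor case applies the new step \<open>a k\<close> first. As finite
  combinations of translates they commute with differentiation.\<close>

primrec iter_diffq :: "(nat \<Rightarrow> real) \<Rightarrow> nat \<Rightarrow> (real \<Rightarrow> real) \<Rightarrow> real \<Rightarrow> real" where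
  "iter_diffq a 0 g = g"
| "iter_diffq a (Suc k) g = iter_diffq a k (\<lambda>x. (g (x + a k) - g (x - a k)) / (2 * a k))"

lemma iter_diffq_has_derivative:
  assumes "\<And>x. (g has_real_derivative g' x) (at x)"
  shows "(iter_diffq a k g has_real_derivative iter_diffq a k g' x) (at x)"
  using assms
proof (induction k arbitrary: g g' x)
  case 0
  then show ?case by simp
next
  case (Suc k)
  have "((\<lambda>x. (g (x + a k) - g (x - a k)) / (2 * a k)) has_real_derivative (g' (x + a k) - g' (x - a k)) / (2 * a k)) (at x)" for x
  proof -
    have "((\<lambda>x. g (x + a k)) has_real_derivative g' (x + a k)) (at x)"
      by (intro Suc.prems DERIV_shift[THEN iffD1])
    moreover have "((\<lambda>x. g (x + - a k)) has_real_derivative g' (x + - a k)) (at x)"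
      by (intro Suc.prems DERIV_shift[THEN iffD1])
    ultimately show ?thesis by (intro DERIV_cdivide DERIV_diff) auto
  qed
  from Suc.IH[OF this] show ?case by simp
qed

lemma iter_diffq_bound:
  assumes "\<And>j. a j > 0" "\<And>x. \<bar>g x\<bar> \<le> B"
  shows "\<bar>iter_diffq a k g x\<bar> \<le> B * (\<Prod>j<k. 1 / a j)"
  using assms(2)
proof (induction k arbitrary: g B)
  case 0
  then show ?case by simp
next
  case (Suc k)
  have "\<bar>(g (x + a k) - g (x - a k)) / (2 * a k)\<bar> \<le> B / a k" for x
    using Suc.prems[of "x + a k"] Suc.prems[of "x - a k"] assms(1)[of k]
    by (simp add: abs_mult field_simps)
  from Suc.IH[OF this] show ?case by simp
qed

text \<open>The infinite convolution of boxes of half-widths \<open>a j\<close> with a trapezoid: its \<open>k\<close>-th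
  derivative is obtained by letting the first \<open>k\<close> boxes act as difference quotients.\<close>

lemma infinite_convolution_cutoff:
  assumes a: "\<And>j. a j > 0" and sa: "summable a" "suminf a \<le> 1/4"
  shows "\<exists>D. jets_on UNIV D \<and> (\<forall>k t. \<bar>D k t\<bar> \<le> (\<Prod>j<k. 1 / a j)) \<and> (\<forall>t. 0 \<le> D 0 t \<and> D 0 t \<le> (1::real)) \<and>
    (\<forall>t. \<bar>t\<bar> \<le> 3/4 \<longrightarrow> D 0 t = 1) \<and> (\<forall>t. \<bar>t\<bar> \<ge> 9/4 \<longrightarrow> D 0 t = 0)"
proof -
  let ?W = "iter_avg a"
  define T where "T = (\<lambda>n. \<Sum>i. a (i + n))"
  have sum_le: "(\<Sum>i<m. a (n + i)) \<le> T n" for m n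
    unfolding T_def using sa(1) a
    by (subst add.commute) (intro sum_le_suminf, auto simp: summable_iff_shift less_imp_le)
  have T0: "T 0 \<le> 1/4" using sa by (simp add: T_def)
  have Tlim: "T \<longlonglongrightarrow> 0"
    unfolding LIMSEQ_def T_def dist_real_def
    using suminf_exist_split[OF _ sa(1)] by simp
  have diff: "\<bar>?W (n + m) j x - ?W n j x\<bar> \<le> (\<Sum>i<m. a (j + n + i))" for n m j x
  proof (induction m)
    case (Suc m)
    then show ?case using iter_avg_step[of a "n + m" j x, OF a] by (simp add: add_ac)
  qed simp
  have "Cauchy (\<lambda>n. ?W n j x)" for j x
  proof (rule metric_CauchyI)
    fix e :: real assume "e > 0"
    then obtain N where N: "\<And>n. n \<ge> N \<Longrightarrow> \<bar>T n\<bar> < e / 2"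
      using Tlim unfolding LIMSEQ_def dist_real_def by (metis diff_zero half_gt_zero)
    have *: "\<bar>?W n j x - ?W N j x\<bar> < e/2" if "n \<ge> N" for n
      using diff[of N "n - N" j x] sum_le[of "j + N" "n - N"] N[of "j + N"] that by simp
    have "dist (?W m j x) (?W n j x) < e" if "m \<ge> N" "n \<ge> N" for m n
      using *[OF that(1)] *[OF that(2)] unfolding dist_real_def by linarith
    then show "\<exists>N. \<forall>m\<ge>N. \<forall>n\<ge>N. dist (?W m j x) (?W n j x) < e" by blast
  qed
  then have "\<exists>l. (\<lambda>n. ?W n j x) \<longlonglongrightarrow> l" for j x
    using Cauchy_convergent_iff convergent_def by blast
  then obtain \<psi> where \<psi>: "\<And>j x. (\<lambda>n. ?W n j x) \<longlonglongrightarrow> \<psi> j x" by metis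
  have tail: "\<bar>\<psi> j x - ?W n j x\<bar> \<le> T (j + n)" for j x n
  proof -
    have "(\<lambda>m. \<bar>?W (n + m) j x - ?W n j x\<bar>) \<longlonglongrightarrow> \<bar>\<psi> j x - ?W n j x\<bar>"
      using LIMSEQ_ignore_initial_segment[OF \<psi>[of j x], of n]
      by (intro tendsto_intros) (simp add: add.commute)
    then show ?thesis using diff[of n _ j x] sum_le[of "j + n"]
      by (intro LIMSEQ_le_const2) (auto intro: order_trans)
  qed
  have lip: "\<bar>\<psi> j x - \<psi> j y\<bar> \<le> \<bar>x - y\<bar>" for j x y
    by (rule LIMSEQ_le_const2[where X = "\<lambda>n. \<bar>?W n j x - ?W n j y\<bar>"])
       (auto intro!: tendsto_intros \<psi> iter_avg_lipschitz[OF a])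
  have cont: "continuous_on UNIV (\<psi> j)" for j by (rule lipschitz_imp_continuous_real) (rule lip)
  have range: "0 \<le> \<psi> j x" "\<psi> j x \<le> 1" for j x
    using iter_avg_range[of a _ j x, OF a]
    by (auto intro!: LIMSEQ_le_const[OF \<psi>] LIMSEQ_le_const2[OF \<psi>])
  \<comment> \<open>The recursion of \<open>iter_avg\<close> passes to the limit: averaging does not
    increase distances, so both sides are within \<open>T (j + Suc n)\<close> of the same finite
    convolution.\<close>
  have rec: "\<psi> j = box_avg (a j) (\<psi> (Suc j))" for j
  proof
    fix x
    have b: "\<bar>box_avg (a j) (\<psi> (Suc j)) x - \<psi> j x\<bar> \<le> T (j + Suc n) + T (j + Suc n)" for n
    proof -
      obtain \<xi> where "box_avg (a j) (\<psi> (Suc j)) (x + 0) - box_avg (a j) (?W n (Suc j)) x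
         = \<psi> (Suc j) (\<xi> + 0) - ?W n (Suc j) \<xi>"
        using box_avg_diff_mvt[OF cont iter_avg_continuous[of a, OF a] a] by blast
      then show ?thesis using tail[of "Suc j" \<xi> n] tail[of j x "Suc n"] by simp
    qed
    have "(\<lambda>n. T (n + Suc j) + T (n + Suc j)) \<longlonglongrightarrow> 0 + 0"
      by (intro tendsto_add LIMSEQ_ignore_initial_segment Tlim)
    then have "\<bar>box_avg (a j) (\<psi> (Suc j)) x - \<psi> j x\<bar> \<le> 0 + 0"
      by (rule LIMSEQ_le_const) (use b in \<open>auto simp: add_ac\<close>)
    then show "\<psi> j x = box_avg (a j) (\<psi> (Suc j)) x" by simp
  qed
  \<comment> \<open>\<open>\<psi> k\<close> lacks the first \<open>k\<close> boxes, which act as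
    difference quotients instead. Differentiating \<open>\<psi> k\<close> trades the box
    \<open>a k\<close> for a difference quotient of \<open>\<psi> (Suc k)\<close>, so
    \<open>D (Suc k)\<close> is the derivative of \<open>D k\<close>; the bounds come from
    \<open>\<psi> k\<close> lying between 0 and 1.\<close>
  define D where "D = (\<lambda>k. iter_diffq a k (\<psi> k))"
  have "(D k has_real_derivative D (Suc k) x) (at x)" for k x
  proof -
    have "(\<psi> k has_real_derivative (\<psi> (Suc k) (x + a k) - \<psi> (Suc k) (x - a k)) / (2 * a k)) (at x)" for x
      by (subst rec) (rule box_avg_has_derivative[OF cont a])
    from iter_diffq_has_derivative[OF this] show ?thesis by (simp add: D_def)
  qed
  then have "jets_on UNIV D" by (simp add: jets_on_def has_real_derivative_iff_has_vector_derivative)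
  moreover have "\<bar>D k t\<bar> \<le> (\<Prod>j<k. 1 / a j)" for k t
    using iter_diffq_bound[of a "\<psi> k" 1 k t, OF a] range by (simp add: D_def)
  \<comment> \<open>\<open>trapezoid\<close> is 1 up to 1 and 0 from 2 on, and the boxes have total
    half-width at most 1/4; hence the constants 3/4 and 9/4 in everything that follows.\<close>
  moreover have "D 0 t = 1" if "\<bar>t\<bar> \<le> 3/4" for t
  proof -
    have "?W n 0 t = 1" for n
      using iter_avg_values[of a t 0 n, OF a] sum_le[of 0 n] T0 that by simp
    then show ?thesis using \<psi>[of 0 t] by (simp add: D_def LIMSEQ_const_iff)
  qed
  moreover have "D 0 t = 0" if "\<bar>t\<bar> \<ge> 9/4" for t
  proof -
    have "?W n 0 t = 0" for n
      using iter_avg_values[of a t 0 n, OF a] sum_le[of 0 n] T0 that by simp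
    then show ?thesis using \<psi>[of 0 t] by (simp add: D_def LIMSEQ_const_iff)
  qed
  moreover have "0 \<le> D 0 t \<and> D 0 t \<le> 1" for t using range by (simp add: D_def)
  ultimately show ?thesis by blast
qed

text \<open>No convergent series converges most slowly: with the tails \<open>R n\<close> the
  weights \<open>1 / sqrt (R n)\<close> tend to infinity, while \<open>b n / sqrt (R n)\<close> is
  at most \<open>2 * (sqrt (R n) - sqrt (R (Suc n)))\<close>, which telescopes. This gain makes the
  cutoffs flatter than \<open>M\<close> demands.\<close>

lemma summable_improve:
  fixes b :: "nat \<Rightarrow> real"
  assumes b: "\<And>k. b k > 0" and s: "summable b"
  shows "\<exists>\<omega>. (\<forall>k. \<omega> k > 0) \<and> filterlim \<omega> at_top sequentially \<and> summable (\<lambda>k. \<omega> k * b k)"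
proof -
  define R where "R = (\<lambda>n. \<Sum>i. b (i + n))"
  have Rpos: "R n > 0" for n
    unfolding R_def using b s by (intro suminf_pos) (auto simp: summable_iff_shift)
  have Rstep: "R n = b n + R (Suc n)" for n
    using suminf_split_head[of "\<lambda>i. b (i + n)"] s by (simp add: R_def summable_iff_shift)
  have Rlim: "R \<longlonglongrightarrow> 0"
    unfolding LIMSEQ_def R_def dist_real_def using suminf_exist_split[OF _ s] by simp
  define \<omega> where "\<omega> = (\<lambda>n. 1 / sqrt (R n))"
  have "((\<lambda>n. sqrt (R n)) \<longlongrightarrow> sqrt 0) sequentially" by (intro tendsto_intros Rlim)
  then have "filterlim (\<lambda>n. sqrt (R n)) (at_right 0) sequentially"
    using Rpos by (auto simp: filterlim_at less_imp_neq[THEN not_sym])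
  then have "filterlim \<omega> at_top sequentially"
    using filterlim_compose[OF filterlim_inverse_at_top_right, of "\<lambda>n. sqrt (R n)"]
    by (simp add: \<omega>_def inverse_eq_divide)
  moreover have "summable (\<lambda>k. \<omega> k * b k)"
  proof (rule summable_comparison_test')
    show "summable (\<lambda>n. 2 * (sqrt (R n) - sqrt (R (Suc n))))"
      by (intro summable_mult telescope_summable'[of _ "sqrt 0"] tendsto_intros Rlim)
    fix n
    have "(sqrt (R n) - sqrt (R (Suc n))) * (sqrt (R n) + sqrt (R (Suc n))) = R n - R (Suc n)"
      using Rpos[of n] Rpos[of "Suc n"] by (simp add: algebra_simps)
    also have "\<dots> = b n" by (simp add: Rstep[of n])
    finally have e: "b n = (sqrt (R n) - sqrt (R (Suc n))) * (sqrt (R n) + sqrt (R (Suc n)))" ..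
    have le: "sqrt (R (Suc n)) \<le> sqrt (R n)" using Rstep[of n] b[of n] by simp
    then have "b n \<le> (sqrt (R n) - sqrt (R (Suc n))) * (2 * sqrt (R n))"
      unfolding e by (intro mult_left_mono) auto
    then have "\<omega> n * b n \<le> 2 * (sqrt (R n) - sqrt (R (Suc n)))"
      using Rpos[of n] by (simp add: \<omega>_def field_simps)
    then show "norm (\<omega> n * b n) \<le> 2 * (sqrt (R n) - sqrt (R (Suc n)))"
      using b[of n] Rpos[of n] by (simp add: \<omega>_def)
  qed
  moreover have "\<omega> k > 0" for k using Rpos[of k] by (simp add: \<omega>_def)
  ultimately show ?thesis by blast
qed

text \<open>Once \<open>1 / \<omega> j \<le> A\<close>, the product divided by \<open>A ^ k\<close>
  no longer grows, so \<open>C\<close> can be its maximum over finitely many indices. Divergence of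
  \<open>\<omega>\<close> thus becomes a geometric bound with arbitrarily small ratio.\<close>

lemma prod_inverse_le_geometric:
  fixes \<omega> :: "nat \<Rightarrow> real"
  assumes pos: "\<And>k. \<omega> k > 0" and lim: "filterlim \<omega> at_top sequentially" and A: "A > 0"
  shows "\<exists>C>0. \<forall>k. (\<Prod>j<k. 1 / \<omega> j) \<le> C * A ^ k"
proof -
  obtain N where N: "\<And>n. n \<ge> N \<Longrightarrow> \<omega> n \<ge> 1 / A"
    using lim unfolding filterlim_at_top eventually_sequentially by blast
  define u where "u = (\<lambda>k. (\<Prod>j<k. 1 / \<omega> j) / A ^ k)"
  have upos: "u k > 0" for k unfolding u_def using pos A by (simp add: prod_pos)
  have step: "u (Suc k) \<le> u k" if "k \<ge> N" for k
  proof -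
    have "u (Suc k) = u k * (1 / (\<omega> k * A))" by (simp add: u_def)
    moreover have "1 / (\<omega> k * A) \<le> 1" using N[OF that] A pos[of k] by (simp add: field_simps)
    ultimately show ?thesis using mult_left_mono[of "1 / (\<omega> k * A)" 1 "u k"] upos[of k] by simp
  qed
  have "u (N + i) \<le> u N" for i
    by (induction i) (auto intro: order_trans[OF step])
  then have "u k \<le> Max (u ` {..N})" for k
  proof (cases "k \<le> N")
    case False
    then have "u k \<le> u N" using \<open>\<And>i. u (N + i) \<le> u N\<close>[of "k - N"] by simp
    also have "\<dots> \<le> Max (u ` {..N})" by (intro Max_ge) auto
    finally show ?thesis .
  qed (intro Max_ge, auto)
  then have "(\<Prod>j<k. 1 / \<omega> j) \<le> Max (u ` {..N}) * A ^ k" for k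
    using A by (simp add: u_def divide_le_eq)
  moreover have "Max (u ` {..N}) > 0" using upos by (subst Max_gr_iff) auto
  ultimately show ?thesis by blast
qed

text \<open>An estimate for every \<open>\<delta>\<close> (Beurling type), in contrast to the one
  for some \<open>\<rho>\<close> in \<open>curve_class\<close> (Roumieu type). The bounds are
  uniform on the line, as suits the compactly supported functions it is used for.\<close>

definition beurling :: "(nat \<Rightarrow> real) \<Rightarrow> (nat \<Rightarrow> real \<Rightarrow> real) \<Rightarrow> bool" where
  "beurling M D \<longleftrightarrow> jets_on UNIV D \<and> (\<forall>\<delta>>0. \<exists>C>0. \<forall>k t. \<bar>D k t\<bar> \<le> C * \<delta> ^ k * fact k * M k)"

text \<open>The half-widths are \<open>s * (\<omega> k * b k)\<close> with \<open>b k\<close> the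
  terms of the series of non-quasianalyticity. The product of the \<open>1 / b j\<close> telescopes
  to \<open>fact k * M k / M 0\<close>, that of the \<open>1 / \<omega> j\<close> is below any
  geometric sequence up to a constant, and \<open>s\<close> normalises the sum of the half-widths to
  1/4.\<close>

lemma beurling_cutoff_exists:
  assumes M: "positive_seq M" and nq: "non_quasianalytic M"
  shows "\<exists>D. beurling M D \<and> (\<forall>t. 0 \<le> D 0 t \<and> D 0 t \<le> 1) \<and>
    (\<forall>t. \<bar>t\<bar> \<le> 3/4 \<longrightarrow> D 0 t = 1) \<and> (\<forall>t. \<bar>t\<bar> \<ge> 9/4 \<longrightarrow> D 0 t = 0)"
proof -
  have Mp: "M i > 0" for i using M by (simp add: positive_seq_def)
  define b where "b = (\<lambda>k. M k / ((real k + 1) * M (k + 1)))"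
  have b: "b k > 0" for k unfolding b_def using Mp by simp
  have pb: "(\<Prod>j<k. 1 / b j) = fact k * M k / M 0" for k
  proof (induction k)
    case 0 then show ?case using Mp[of 0] by simp
  next
    case (Suc k)
    have "1 / b k = (real k + 1) * M (Suc k) / M k" by (simp add: b_def)
    then have "(\<Prod>j<Suc k. 1 / b j) = fact k * M k / M 0 * ((real k + 1) * M (Suc k) / M k)"
      using Suc by simp
    then show ?case using Mp[of k] by (simp add: mult_ac)
  qed
  obtain \<omega> where \<omega>: "\<And>k. \<omega> k > 0" "filterlim \<omega> at_top sequentially" "summable (\<lambda>k. \<omega> k * b k)"
    using summable_improve[of b] b nq by (auto simp: non_quasianalytic_def b_def)
  define S where "S = (\<Sum>k. \<omega> k * b k)"
  have S: "S > 0" unfolding S_def using \<omega> b by (intro suminf_pos) auto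
  define s where "s = 1 / (4 * S)"
  have s: "s > 0" using S by (simp add: s_def)
  define a where "a = (\<lambda>k. s * (\<omega> k * b k))"
  have a: "a k > 0" for k unfolding a_def using s \<omega> b by simp
  have sa: "summable a" unfolding a_def using \<omega>(3) by (rule summable_mult)
  have "suminf a = s * S" unfolding a_def S_def using \<omega>(3) by (rule suminf_mult)
  then have sa': "suminf a \<le> 1/4" using S by (simp add: s_def)
  obtain D where D: "jets_on UNIV D" "\<forall>k t. \<bar>D k t\<bar> \<le> (\<Prod>j<k. 1 / a j)"
      "\<forall>t. 0 \<le> D 0 t \<and> D 0 t \<le> 1"
      "\<forall>t. \<bar>t\<bar> \<le> 3/4 \<longrightarrow> D 0 t = 1" "\<forall>t. \<bar>t\<bar> \<ge> 9/4 \<longrightarrow> D 0 t = 0"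
    using infinite_convolution_cutoff[of a, OF a sa sa'] by blast
  have "\<exists>C>0. \<forall>k t. \<bar>D k t\<bar> \<le> C * \<delta> ^ k * fact k * M k" if \<delta>: "\<delta> > 0" for \<delta>
  proof -
    obtain C where C: "C > 0" "\<And>k. (\<Prod>j<k. 1 / \<omega> j) \<le> C * (\<delta> * s) ^ k"
      using prod_inverse_le_geometric[of \<omega> "\<delta> * s", OF \<omega>(1,2)] \<delta> s by auto
    have "\<bar>D k t\<bar> \<le> C / M 0 * \<delta> ^ k * fact k * M k" for k t
    proof -
      have "(\<Prod>j<k. 1 / a j) = (1 / s) ^ k * ((\<Prod>j<k. 1 / \<omega> j) * (\<Prod>j<k. 1 / b j))"
        by (simp add: a_def prod_dividef prod.distrib power_one_over)
      also have "\<dots> \<le> (1 / s) ^ k * ((C * (\<delta> * s) ^ k) * (\<Prod>j<k. 1 / b j))"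
        using C(2)[of k] s b by (intro mult_left_mono mult_right_mono prod_nonneg) (auto simp: less_imp_le)
      also have "\<dots> = C / M 0 * \<delta> ^ k * fact k * M k"
        using s unfolding pb by (simp add: power_mult_distrib power_one_over)
      finally show ?thesis using D(2) by (meson order_trans)
    qed
    then show ?thesis using C(1) Mp[of 0] by (intro exI[of _ "C / M 0"]) auto
  qed
  then have "beurling M D" using D(1) by (auto simp: beurling_def)
  then show ?thesis using D(3-5) by blast
qed

section \<open>Derivatives in cone directions\<close>

lemma jets_on_affine:
  assumes "jets_on S Q" "\<And>t. t \<in> T \<Longrightarrow> \<alpha> * t + \<beta> \<in> S"
  shows "jets_on T (\<lambda>k t. \<alpha> ^ k *\<^sub>R Q k (\<alpha> * t + \<beta>))"
  unfolding jets_on_def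
proof (intro allI ballI)
  fix k t assume "t \<in> T"
  have "((\<lambda>t. \<alpha> * t + \<beta>) has_vector_derivative \<alpha>) (at t)"
    by (auto simp: has_real_derivative_iff_has_vector_derivative[symmetric] intro!: derivative_eq_intros)
  from vector_diff_chain_at[OF this jets_onD[OF assms(1) assms(2)[OF \<open>t \<in> T\<close>]]]
  have "((\<lambda>t. Q k (\<alpha> * t + \<beta>)) has_vector_derivative \<alpha> *\<^sub>R Q (Suc k) (\<alpha> * t + \<beta>)) (at t)"
    by (simp add: o_def)
  from has_vector_derivative_scaleR[OF DERIV_const this, of "\<alpha> ^ k"]
  show "((\<lambda>t. \<alpha> ^ k *\<^sub>R Q k (\<alpha> * t + \<beta>)) has_vector_derivative \<alpha> ^ Suc k *\<^sub>R Q (Suc k) (\<alpha> * t + \<beta>)) (at t)"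
    by (simp add: mult.commute)
qed

lemma jets_on_add:
  "jets_on S P \<Longrightarrow> jets_on S Q \<Longrightarrow> jets_on S (\<lambda>k t. P k t + Q k t)"
  unfolding jets_on_def by (auto intro: has_vector_derivative_add)

lemma jets_on_const: "jets_on S (\<lambda>k t. if k = 0 then y else 0)"
  unfolding jets_on_def by (auto intro: has_vector_derivative_const)

lemma jets_on_scaleR_right:
  assumes "jets_on S (Q :: nat \<Rightarrow> real \<Rightarrow> real)"
  shows "jets_on S (\<lambda>k t. Q k t *\<^sub>R (v :: 'b :: real_normed_vector))"
  unfolding jets_on_def
proof (intro allI ballI)
  fix k s assume "s \<in> S"
  from bounded_linear.has_vector_derivative[OF bounded_linear_scaleR_left jets_onD[OF assms this, of k], of v]
  show "((\<lambda>t. Q k t *\<^sub>R v) has_vector_derivative Q (Suc k) s *\<^sub>R v) (at s)" .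
qed

lemma jets_on_vanish:
  assumes "open S" "jets_on S (Q :: nat \<Rightarrow> real \<Rightarrow> real)" "\<And>s. s \<in> S \<Longrightarrow> Q 0 s = 0" "s \<in> S"
  shows "Q k s = 0"
proof -
  have "(deriv ^^ k) (\<lambda>_. 0 :: real) s = Q k s"
    using assms by (intro jets_on_deriv[OF assms(1)]) auto
  moreover have "(deriv ^^ k) (\<lambda>_. 0 :: real) s = (if k = 0 then 0 else 0)"
    by (rule jets_on_deriv[OF assms(1) jets_on_const _ assms(4)]) simp
  ultimately show ?thesis by simp
qed

lemma beurling_support:
  assumes "beurling M D" "\<And>t. \<bar>t\<bar> \<ge> R \<Longrightarrow> D 0 t = 0" "\<bar>t\<bar> > R"
  shows "D k t = 0"
proof (rule jets_on_vanish[where S = "{t. \<bar>t\<bar> > R}" and Q = D and s = t])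
  show "open {t :: real. \<bar>t\<bar> > R}" by (intro open_Collect_less continuous_intros)
  show "jets_on {t. \<bar>t\<bar> > R} D" using assms(1) by (auto simp: beurling_def jets_on_def)
qed (use assms in auto)

text \<open>The Leibniz rule gives \<open>t * D k t + real k * D (k - 1) t\<close>. Compact support
  bounds \<open>t\<close>, and log-convexity in the form of \<open>log_convex_le_Suc\<close> pays
  for the lower order. Applied once and twice to a cutoff it yields functions equal to
  \<open>t\<close> and \<open>t\<^sup>2\<close> near 0.\<close>

lemma beurling_mult_id:
  assumes M: "positive_seq M" "log_convex M" and D: "beurling M D"
    and supp: "\<And>t. \<bar>t\<bar> \<ge> R \<Longrightarrow> D 0 t = 0" and R: "R > 0"
  shows "\<exists>E. beurling M E \<and> (\<forall>t. E 0 t = t * D 0 t)"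
proof -
  define E where "E = (\<lambda>k t. t * D k t + real k * D (k - 1) t)"
  have Mp: "M i > 0" for i using M by (simp add: positive_seq_def)
  have dD: "(D k has_real_derivative D (Suc k) t) (at t)" for k t
    using D unfolding beurling_def jets_on_def has_real_derivative_iff_has_vector_derivative by blast
  have "(E k has_real_derivative E (Suc k) t) (at t)" for k t
  proof (cases k)
    case 0
    have "((\<lambda>t. t * D 0 t) has_real_derivative 1 * D 0 t + D (Suc 0) t * t) (at t)"
      by (intro DERIV_mult DERIV_ident dD)
    then show ?thesis using 0 by (simp add: E_def algebra_simps)
  next
    case (Suc j)
    have "((\<lambda>t. t * D k t + real k * D j t) has_real_derivative (1 * D k t + D (Suc k) t * t) + real k * D (Suc j) t) (at t)"
      by (intro DERIV_add DERIV_mult DERIV_ident DERIV_cmult dD)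
    then show ?thesis using Suc by (simp add: E_def algebra_simps)
  qed
  then have "jets_on UNIV E" by (simp add: jets_on_def has_real_derivative_iff_has_vector_derivative)
  moreover have "\<exists>C>0. \<forall>k t. \<bar>E k t\<bar> \<le> C * \<delta> ^ k * fact k * M k" if \<delta>: "\<delta> > 0" for \<delta>
  proof -
    obtain C where C: "C > 0" "\<And>k t. \<bar>D k t\<bar> \<le> C * \<delta> ^ k * fact k * M k"
      using D \<delta> unfolding beurling_def by blast
    have 1: "\<bar>t * D k t\<bar> \<le> R * (C * \<delta> ^ k * fact k * M k)" for k t
    proof (cases "\<bar>t\<bar> > R")
      case True
      then show ?thesis using beurling_support[OF D supp True, of k] C(1) Mp[of k] R \<delta> by simp
    next
      case False
      then show ?thesis unfolding abs_mult using C(2)[of k t] R by (intro mult_mono) auto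
    qed
    have 2: "\<bar>real k * D (k - 1) t\<bar> \<le> M 0 / M 1 / \<delta> * (C * \<delta> ^ k * fact k * M k)" for k t
    proof (cases k)
      case 0
      then show ?thesis using C(1) Mp \<delta> by (simp add: less_imp_le)
    next
      case (Suc j)
      have "\<bar>real k * D (k - 1) t\<bar> \<le> real k * (C * \<delta> ^ j * fact j * M j)"
        using C(2)[of j t] Suc by (simp add: abs_mult)
      also have "\<dots> \<le> real k * (C * \<delta> ^ j * fact j * (M 0 / M 1 * M (Suc j)))"
        using log_convex_le_Suc[OF M, of j] C(1) \<delta> by (intro mult_left_mono) auto
      also have "\<dots> = M 0 / M 1 / \<delta> * (C * \<delta> ^ k * fact k * M k)"
        using Suc \<delta> Mp[of 1] by (simp add: field_simps)
      finally show ?thesis .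
    qed
    have "\<bar>E k t\<bar> \<le> ((R + M 0 / M 1 / \<delta>) * C) * \<delta> ^ k * fact k * M k" for k t
    proof -
      have "\<bar>E k t\<bar> \<le> \<bar>t * D k t\<bar> + \<bar>real k * D (k - 1) t\<bar>" unfolding E_def by (rule abs_triangle_ineq)
      also have "\<dots> \<le> R * (C * \<delta> ^ k * fact k * M k) + M 0 / M 1 / \<delta> * (C * \<delta> ^ k * fact k * M k)"
        using 1 2 by (rule add_mono)
      also have "\<dots> = ((R + M 0 / M 1 / \<delta>) * C) * \<delta> ^ k * fact k * M k" by (simp add: distrib_right mult.assoc)
      finally show ?thesis .
    qed
    moreover have "(R + M 0 / M 1 / \<delta>) * C > 0" using R C(1) Mp[of 0] Mp[of 1] \<delta> by (simp add: add_pos_pos)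
    ultimately show ?thesis by blast
  qed
  ultimately have "beurling M E" by (simp add: beurling_def)
  then show ?thesis by (intro exI[of _ E]) (simp add: E_def)
qed

lemma beurling_scale:
  assumes "beurling M D" "\<alpha> > 0"
  shows "beurling M (\<lambda>k t. \<alpha> ^ k * D k (\<alpha> * t))"
  unfolding beurling_def
proof (intro conjI allI impI)
  have "jets_on UNIV D" using assms by (simp add: beurling_def)
  from jets_on_affine[OF this, of UNIV \<alpha> 0] show "jets_on UNIV (\<lambda>k t. \<alpha> ^ k * D k (\<alpha> * t))" by simp
  fix \<delta> :: real assume "\<delta> > 0"
  then have "\<delta> / \<alpha> > 0" using assms(2) by simp
  then obtain C where C: "C > 0" "\<And>k t. \<bar>D k t\<bar> \<le> C * (\<delta> / \<alpha>) ^ k * fact k * M k"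
    using assms(1) unfolding beurling_def by blast
  have "\<bar>\<alpha> ^ k * D k (\<alpha> * t)\<bar> \<le> C * \<delta> ^ k * fact k * M k" for k t
  proof -
    have "\<bar>\<alpha> ^ k * D k (\<alpha> * t)\<bar> \<le> \<alpha> ^ k * (C * (\<delta> / \<alpha>) ^ k * fact k * M k)"
      using C(2)[of k "\<alpha> * t"] assms(2) by (simp add: abs_mult)
    also have "\<dots> = C * \<delta> ^ k * fact k * M k" using assms(2) by (simp add: power_divide)
    finally show ?thesis .
  qed
  then show "\<exists>C>0. \<forall>k t. \<bar>\<alpha> ^ k * D k (\<alpha> * t)\<bar> \<le> C * \<delta> ^ k * fact k * M k" using C(1) by blast
qed

lemma jets_on_suminf:
  fixes P :: "nat \<Rightarrow> nat \<Rightarrow> real \<Rightarrow> 'b::banach"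
  assumes P: "\<And>n. jets_on UNIV (P n)" and bound: "\<And>n k t. norm (P n k t) \<le> (1/2) ^ n * B k"
  shows "jets_on UNIV (\<lambda>k t. \<Sum>n. P n k t)"
  unfolding jets_on_def
proof (intro allI ballI)
  fix k :: nat and t :: real
  have sm: "summable (\<lambda>n. P n j s)" for j s
    by (rule summable_comparison_test'[where g = "\<lambda>n. (1/2) ^ n * B j"]) (use bound in \<open>auto intro: summable_mult2 summable_geometric\<close>)
  have ul: "uniform_limit UNIV (\<lambda>n x. \<Sum>i<n. P i (Suc k) x) (\<lambda>x. \<Sum>i. P i (Suc k) x) sequentially"
    by (rule Weierstrass_m_test[where M = "\<lambda>n. (1/2) ^ n * B (Suc k)"])
       (use bound in \<open>auto intro: summable_mult2 summable_geometric\<close>)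
  have "\<exists>g. \<forall>x\<in>UNIV. (\<lambda>n. P n k x) sums (g x) \<and> (g has_derivative (\<lambda>h. h *\<^sub>R (\<Sum>n. P n (Suc k) x))) (at x within UNIV)"
  proof (rule has_derivative_series[where f' = "\<lambda>n x h. h *\<^sub>R P n (Suc k) x" and x = 0 and l = "\<Sum>n. P n k 0"])
    show "(P n k has_derivative (\<lambda>h. h *\<^sub>R P n (Suc k) x)) (at x within UNIV)" for n x
      using jets_onD[OF P, of x n k] by (simp add: has_vector_derivative_def)
    show "(\<lambda>n. P n k 0) sums (\<Sum>n. P n k 0)" using sm by (rule summable_sums)
    fix e :: real assume "e > 0"
    from uniform_limitD[OF ul this]
    show "\<forall>\<^sub>F n in sequentially. \<forall>x\<in>UNIV. \<forall>h. norm ((\<Sum>i<n. h *\<^sub>R P i (Suc k) x) - h *\<^sub>R (\<Sum>n. P n (Suc k) x)) \<le> e * norm h"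
    proof (eventually_elim, intro ballI allI)
      fix n x and h :: real
      assume "\<forall>x\<in>UNIV. dist (\<Sum>i<n. P i (Suc k) x) (\<Sum>i. P i (Suc k) x) < e"
      then have "norm ((\<Sum>i<n. P i (Suc k) x) - (\<Sum>i. P i (Suc k) x)) \<le> e" by (simp add: dist_norm less_imp_le)
      then have "\<bar>h\<bar> * norm ((\<Sum>i<n. P i (Suc k) x) - (\<Sum>i. P i (Suc k) x)) \<le> \<bar>h\<bar> * e"
        by (intro mult_left_mono) auto
      then show "norm ((\<Sum>i<n. h *\<^sub>R P i (Suc k) x) - h *\<^sub>R (\<Sum>n. P n (Suc k) x)) \<le> e * norm h"
        by (simp add: scaleR_sum_right[symmetric] scaleR_diff_right[symmetric] mult.commute)
    qed
  qed auto
  then obtain g where g: "\<And>x. (\<lambda>n. P n k x) sums (g x)"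
    "\<And>x. (g has_derivative (\<lambda>h. h *\<^sub>R (\<Sum>n. P n (Suc k) x))) (at x)" by auto
  have "g = (\<lambda>x. \<Sum>n. P n k x)" using sums_unique[OF g(1)] by auto
  then show "((\<lambda>t. \<Sum>n. P n k t) has_vector_derivative (\<Sum>n. P n (Suc k) t)) (at t)"
    using g(2) by (simp add: has_vector_derivative_def)
qed

lemma curve_class_const_add:
  assumes M: "positive_seq M" and D: "jets_on UNIV D" and C: "C > 0"
    and bound: "\<And>k t. norm (D k t) \<le> C * fact k * M k"
  shows "(\<lambda>t. y + D 0 t) \<in> curve_class M"
proof -
  let ?D = "\<lambda>k t. (if k = 0 then y else 0) + D k t"
  have M0: "M 0 > 0" using M by (simp add: positive_seq_def)
  have "jets_on UNIV ?D" by (intro jets_on_add jets_on_const D)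
  moreover have "norm (?D k t) \<le> (C + norm y / M 0) * 1 ^ k * fact k * M k" for k t
  proof -
    have "M k > 0" using M by (simp add: positive_seq_def)
    then have "C * fact k * M k \<le> (C + norm y / M 0) * fact k * M k"
      using M0 by (intro mult_right_mono) auto
    moreover have "norm (?D k t) \<le> (if k = 0 then norm y else 0) + C * fact k * M k"
      using bound[of k t] by (intro order_trans[OF norm_triangle_ineq] add_mono) auto
    ultimately show "norm (?D k t) \<le> (C + norm y / M 0) * 1 ^ k * fact k * M k"
      using M0 by (cases "k = 0") (auto simp: distrib_right)
  qed
  moreover have "0 < C + norm y / M 0" using C M0 by (simp add: add_pos_nonneg)
  ultimately show ?thesis unfolding curve_class_iff
    by (intro exI[of _ ?D] conjI allI impI exI[of _ "C + norm y / M 0"] exI[of _ 1]) auto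
qed

lemma beurling_curve:
  assumes M: "positive_seq M" and D: "beurling M D"
  shows "(\<lambda>t. y + D 0 t *\<^sub>R v) \<in> curve_class M"
proof -
  obtain C where C: "C > 0" "\<And>k t. \<bar>D k t\<bar> \<le> C * 1 ^ k * fact k * M k"
    using D zero_less_one unfolding beurling_def by blast
  have "norm (D k t *\<^sub>R v) \<le> (C * (norm v + 1)) * fact k * M k" for k t
  proof -
    have "M k > 0" using M by (simp add: positive_seq_def)
    have "norm (D k t *\<^sub>R v) \<le> (C * fact k * M k) * (norm v + 1)"
      unfolding norm_scaleR using C(2)[of k t] by (intro mult_mono) (auto intro: order_trans)
    then show ?thesis by (simp add: mult_ac)
  qed
  moreover have "jets_on UNIV (\<lambda>k t. D k t *\<^sub>R v)" using D by (intro jets_on_scaleR_right) (simp add: beurling_def)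
  ultimately show ?thesis
    using curve_class_const_add[OF M, of "\<lambda>k t. D k t *\<^sub>R v" "C * (norm v + 1)" y] C(1)
    by (simp add: add_nonneg_pos)
qed

lemma glued_curve:
  fixes P :: "nat \<Rightarrow> nat \<Rightarrow> real \<Rightarrow> 'b::banach"
  assumes M: "positive_seq M" and P: "\<And>n. jets_on UNIV (P n)"
    and bound: "\<And>n k t. norm (P n k t) \<le> (1/2) ^ n * (fact k * M k)"
  shows "(\<lambda>t. y + (\<Sum>n. P n 0 t)) \<in> curve_class M"
proof (rule curve_class_const_add[OF M])
  show "jets_on UNIV (\<lambda>k t. \<Sum>n. P n k t)" using P bound by (rule jets_on_suminf)
  show "(2::real) > 0" by simp
  fix k t
  have "norm (\<Sum>n. P n k t) \<le> (\<Sum>n. (1/2) ^ n * (fact k * M k))"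
    by (rule norm_suminf_le[OF bound]) (auto intro: summable_mult2 summable_geometric)
  also have "\<dots> = (\<Sum>n. (1/2) ^ n) * (fact k * M k)" by (rule suminf_mult2[symmetric]) (simp add: summable_geometric)
  also have "\<dots> = 2 * fact k * M k" by (simp add: suminf_geometric)
  finally show "norm (\<Sum>n. P n k t) \<le> 2 * fact k * M k" .
qed

section \<open>Taylor coefficients under the substitution of a square\<close>

lemma poly_small_imp_zero:
  fixes c :: "nat \<Rightarrow> real"
  assumes "\<eta> > 0" "\<And>s. s \<noteq> 0 \<Longrightarrow> \<bar>s\<bar> \<le> \<eta> \<Longrightarrow> \<bar>\<Sum>j\<le>n. c j * s ^ j\<bar> \<le> A * \<bar>s\<bar> ^ Suc n" "j \<le> n"
  shows "c j = 0"
  using assms(2,3)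
proof (induction n arbitrary: c j)
  case (0 c j)
  have ev: "\<forall>\<^sub>F s in at 0. \<bar>c 0\<bar> \<le> A * \<bar>s\<bar>"
    unfolding eventually_at using 0(1) \<open>\<eta> > 0\<close> by (intro exI[of _ \<eta>]) (auto simp: dist_real_def)
  have "((\<lambda>s. A * \<bar>s\<bar>) \<longlongrightarrow> A * \<bar>0\<bar>) (at (0::real))" by (intro tendsto_intros)
  then have "\<bar>c 0\<bar> \<le> A * \<bar>0\<bar>" by (rule tendsto_lowerbound[OF _ ev]) simp
  then show ?case using 0 by simp
next
  case (Suc n c j)
  have ev: "\<forall>\<^sub>F s in at 0. \<bar>\<Sum>j\<le>Suc n. c j * s ^ j\<bar> \<le> A * \<bar>s\<bar> ^ Suc (Suc n)"
    unfolding eventually_at using Suc(2) \<open>\<eta> > 0\<close> by (intro exI[of _ \<eta>]) (auto simp: dist_real_def)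
  have "((\<lambda>s. \<bar>\<Sum>j\<le>Suc n. c j * s ^ j\<bar>) \<longlongrightarrow> \<bar>\<Sum>j\<le>Suc n. c j * 0 ^ j\<bar>) (at (0::real))" by (intro tendsto_intros)
  moreover have "((\<lambda>s. A * \<bar>s\<bar> ^ Suc (Suc n)) \<longlongrightarrow> A * \<bar>0\<bar> ^ Suc (Suc n)) (at (0::real))" by (intro tendsto_intros)
  ultimately have "\<bar>\<Sum>j\<le>Suc n. c j * 0 ^ j\<bar> \<le> A * \<bar>0::real\<bar> ^ Suc (Suc n)"
    using ev by (intro tendsto_le[of "at (0::real)"]) auto
  moreover have sh: "(\<Sum>j\<le>Suc n. c j * s ^ j) = c 0 + s * (\<Sum>j\<le>n. c (Suc j) * s ^ j)" for s
    by (subst sum.atMost_Suc_shift) (simp add: sum_distrib_left mult_ac)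
  ultimately have c0: "c 0 = 0" by (simp del: sum.atMost_Suc)
  have "c (Suc i) = 0" if "i \<le> n" for i
  proof (rule Suc.IH[OF _ that])
    fix s :: real assume s: "s \<noteq> 0" "\<bar>s\<bar> \<le> \<eta>"
    have "\<bar>s\<bar> * \<bar>\<Sum>j\<le>n. c (Suc j) * s ^ j\<bar> \<le> \<bar>s\<bar> * (A * \<bar>s\<bar> ^ Suc n)"
      using Suc.prems(1)[OF s] unfolding sh by (simp add: c0 abs_mult mult_ac)
    then show "\<bar>\<Sum>j\<le>n. c (Suc j) * s ^ j\<bar> \<le> A * \<bar>s\<bar> ^ Suc n" using s by simp
  qed
  then show ?case using c0 Suc.prems(2) by (cases j) auto
qed

lemma jets_maclaurin_bound:
  fixes Q :: "nat \<Rightarrow> real \<Rightarrow> real"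
  assumes Q: "jets_on {-\<epsilon><..<\<epsilon>} Q" and \<eta>: "0 < \<eta>" "\<eta> < \<epsilon>"
  shows "\<exists>A. \<forall>s. \<bar>s\<bar> \<le> \<eta> \<longrightarrow> \<bar>Q 0 s - (\<Sum>i<n. Q i 0 / fact i * s ^ i)\<bar> \<le> A * \<bar>s\<bar> ^ n"
proof -
  have d: "(Q k has_real_derivative Q (Suc k) s) (at s)" if "\<bar>s\<bar> \<le> \<eta>" for k s
  proof -
    have "s \<in> {-\<epsilon><..<\<epsilon>}" using that \<eta> by auto
    from jets_onD[OF Q this, of k] show ?thesis by (simp add: has_real_derivative_iff_has_vector_derivative)
  qed
  have "continuous_on {-\<eta>..\<eta>} (Q n)"
    by (rule continuous_at_imp_continuous_on, rule ballI, rule DERIV_isCont, rule d) auto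
  then have "bounded (Q n ` {-\<eta>..\<eta>})" by (intro compact_imp_bounded compact_continuous_image) auto
  then obtain A where A: "\<And>s. \<bar>s\<bar> \<le> \<eta> \<Longrightarrow> \<bar>Q n s\<bar> \<le> A" by (force simp: bounded_iff)
  have "\<bar>Q 0 s - (\<Sum>i<n. Q i 0 / fact i * s ^ i)\<bar> \<le> A * \<bar>s\<bar> ^ n" if s: "\<bar>s\<bar> \<le> \<eta>" for s
  proof -
    obtain t where t: "\<bar>t\<bar> \<le> \<bar>s\<bar>" "Q 0 s = (\<Sum>m<n. Q m 0 / fact m * s ^ m) + Q n t / fact n * s ^ n"
      using Maclaurin_bi_le[of Q "Q 0" n s] d s by auto
    have "\<bar>Q n t\<bar> / fact n \<le> A / 1" using A[of t] t(1) s by (intro frac_le) auto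
    then have "\<bar>Q n t\<bar> / fact n * \<bar>s\<bar> ^ n \<le> A * \<bar>s\<bar> ^ n" by (intro mult_right_mono) auto
    then show ?thesis using t(2) by (simp add: abs_mult power_abs)
  qed
  then show ?thesis by blast
qed

text \<open>Taylor's formula on both sides gives two polynomials in \<open>s\<close> of degree at
  most \<open>2 * k\<close> whose difference is at most a multiple of
  \<open>\<bar>s\<bar> ^ Suc (2 * k)\<close>, so their coefficients agree. The factor
  \<open>fact (2 * k) / fact k\<close> later turns the \<open>fact (2 * k)\<close> of the class
  bound into \<open>fact k\<close>.\<close>

lemma jets_even_substitution:
  fixes P Q :: "nat \<Rightarrow> real \<Rightarrow> real"
  assumes Q: "jets_on {-\<epsilon><..<\<epsilon>} Q" and P: "jets_on {-\<epsilon>'<..<\<epsilon>'} P" and pos: "\<epsilon> > 0" "\<epsilon>' > 0" "\<mu> > 0"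
    and eq: "\<And>s. \<bar>s\<bar> < \<epsilon>' \<Longrightarrow> \<mu> * s\<^sup>2 < \<epsilon> \<Longrightarrow> P 0 s = Q 0 (\<mu> * s\<^sup>2)"
  shows "P (2 * k) 0 = fact (2 * k) / fact k * \<mu> ^ k * Q k 0"
proof -
  obtain A where A: "\<And>s. \<bar>s\<bar> \<le> \<epsilon>'/2 \<Longrightarrow> \<bar>P 0 s - (\<Sum>i<Suc (2*k). P i 0 / fact i * s ^ i)\<bar> \<le> A * \<bar>s\<bar> ^ Suc (2*k)"
    using jets_maclaurin_bound[OF P, of "\<epsilon>'/2" "Suc (2*k)"] pos by auto
  obtain B where B: "\<And>s. \<bar>s\<bar> \<le> \<epsilon>/2 \<Longrightarrow> \<bar>Q 0 s - (\<Sum>i<Suc k. Q i 0 / fact i * s ^ i)\<bar> \<le> B * \<bar>s\<bar> ^ Suc k"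
    using jets_maclaurin_bound[OF Q, of "\<epsilon>/2" "Suc k"] pos by auto
  define q where "q = (\<lambda>i. \<mu> ^ i * Q i 0 / fact i)"
  define c where "c = (\<lambda>j. P j 0 / fact j - (if even j then q (j div 2) else 0))"
  have re: "(\<Sum>j\<le>2*m. (if even j then q (j div 2) else 0) * s ^ j) = (\<Sum>i\<le>m. q i * (s\<^sup>2) ^ i)" for m s
    by (induction m) (auto simp: power_mult power2_eq_square power_mult_distrib)
  define \<eta> where "\<eta> = min (\<epsilon>'/2) (min 1 (\<epsilon> / (2 * \<mu>)))"
  have \<eta>: "\<eta> > 0" "\<eta> \<le> \<epsilon>'/2" "\<eta> \<le> 1" "\<eta> \<le> \<epsilon> / (2 * \<mu>)" unfolding \<eta>_def using pos by auto
  have "\<bar>\<Sum>j\<le>2*k. c j * s ^ j\<bar> \<le> (A + \<bar>B\<bar> * \<mu> ^ Suc k) * \<bar>s\<bar> ^ Suc (2*k)" if s: "\<bar>s\<bar> \<le> \<eta>" for s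
  proof -
    have s1: "\<bar>s\<bar> \<le> 1" "\<bar>s\<bar> \<le> \<epsilon>'/2" "\<bar>s\<bar> < \<epsilon>'" using s \<eta> pos by auto
    have "s\<^sup>2 \<le> \<bar>s\<bar>" using mult_left_mono[OF s1(1), of "\<bar>s\<bar>"] by (simp add: power2_eq_square abs_mult_self_eq)
    then have "\<mu> * s\<^sup>2 \<le> \<mu> * (\<epsilon> / (2 * \<mu>))" using s \<eta> pos by (intro mult_left_mono) auto
    then have l: "\<mu> * s\<^sup>2 \<le> \<epsilon>/2" using pos by simp
    then have l': "\<bar>\<mu> * s\<^sup>2\<bar> \<le> \<epsilon>/2" "\<mu> * s\<^sup>2 < \<epsilon>" using pos by (auto simp: abs_mult)
    have Bs: "\<bar>P 0 s - (\<Sum>i\<le>k. q i * (s\<^sup>2) ^ i)\<bar> \<le> \<bar>B\<bar> * \<mu> ^ Suc k * \<bar>s\<bar> ^ Suc (2*k)"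
    proof -
      have "(\<Sum>i<Suc k. Q i 0 / fact i * (\<mu> * s\<^sup>2) ^ i) = (\<Sum>i\<le>k. q i * (s\<^sup>2) ^ i)"
        unfolding lessThan_Suc_atMost by (intro sum.cong) (auto simp: q_def power_mult_distrib)
      then have "\<bar>P 0 s - (\<Sum>i\<le>k. q i * (s\<^sup>2) ^ i)\<bar> \<le> B * \<bar>\<mu> * s\<^sup>2\<bar> ^ Suc k"
        using B[OF l'(1)] eq[OF s1(3) l'(2)] by simp
      also have "\<dots> \<le> \<bar>B\<bar> * \<bar>\<mu> * s\<^sup>2\<bar> ^ Suc k" by (intro mult_right_mono) auto
      also have "\<bar>\<mu> * s\<^sup>2\<bar> ^ Suc k = \<mu> ^ Suc k * (\<bar>s\<bar> ^ Suc (2*k) * \<bar>s\<bar>)"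
      proof -
        have "\<bar>\<mu> * s\<^sup>2\<bar> = \<mu> * (\<bar>s\<bar> * \<bar>s\<bar>)" using pos by (simp add: abs_mult power2_eq_square)
        then show ?thesis by (simp only: power_mult_distrib) (simp add: mult_2_right power_add mult_ac)
      qed
      also have "\<bar>B\<bar> * (\<mu> ^ Suc k * (\<bar>s\<bar> ^ Suc (2*k) * \<bar>s\<bar>)) \<le> \<bar>B\<bar> * (\<mu> ^ Suc k * (\<bar>s\<bar> ^ Suc (2*k) * 1))"
        using s1 pos by (intro mult_left_mono) auto
      finally show ?thesis by (simp add: mult_ac)
    qed
    have "(\<Sum>j\<le>2*k. c j * s ^ j) = (\<Sum>j\<le>2*k. P j 0 / fact j * s ^ j) - (\<Sum>i\<le>k. q i * (s\<^sup>2) ^ i)"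
      unfolding c_def left_diff_distrib sum_subtractf re ..
    moreover have "\<bar>P 0 s - (\<Sum>j\<le>2*k. P j 0 / fact j * s ^ j)\<bar> \<le> A * \<bar>s\<bar> ^ Suc (2*k)"
      using A[OF s1(2)] by (simp only: lessThan_Suc_atMost)
    ultimately show ?thesis using Bs by (simp only: distrib_right)
  qed
  from poly_small_imp_zero[OF \<eta>(1) this, of "2*k"] have "c (2*k) = 0" by simp
  then show ?thesis by (simp add: c_def q_def field_simps)
qed

text \<open>A full ball of directions around the axis \<open>e\<close>, at every point of
  \<open>X\<close> near \<open>x0\<close> and not only at interior ones. An open set of directions
  survives small shifts of the base point: a shift by \<eta> s tilts the direction of a step with
  parameter \<open>s\<close> by \<eta>. The bound \<open>c \<le> 1/2\<close> keeps the directions of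
  comparable length.\<close>

definition cone_at :: "'a::euclidean_space set \<Rightarrow> 'a \<Rightarrow> real \<Rightarrow> real \<Rightarrow> real \<Rightarrow> 'a \<Rightarrow> bool" where
  "cone_at X x0 \<epsilon> c \<tau> e \<longleftrightarrow> \<epsilon> > 0 \<and> 0 < c \<and> c \<le> 1/2 \<and> \<tau> > 0 \<and> norm e = 1 \<and>
    (\<forall>y\<in>X \<inter> ball x0 \<epsilon>. \<forall>v\<in>ball e c. \<forall>s. 0 < s \<and> s \<le> \<tau> \<longrightarrow> y + s *\<^sub>R v \<in> interior X)"

lemma norm_last_dir: "norm (last_dir :: 'a::euclidean_space) = 1"
  unfolding last_dir_def by (rule someI2_ex) (auto simp: norm_Basis)

lemma trunc_cone_contains_ball_directions:
  assumes r: "r > 0" and h: "h > 0"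
  shows "\<exists>c \<tau>. 0 < c \<and> c \<le> 1/2 \<and> \<tau> > 0 \<and>
    (\<forall>w\<in>ball (last_dir :: 'a::euclidean_space) c. \<forall>s. 0 < s \<and> s \<le> \<tau> \<longrightarrow> s *\<^sub>R w \<in> trunc_cone r h)"
proof -
  \<comment> \<open>For \<open>w\<close> within \<open>c\<close> of the axis the transversal part is
    below \<open>c\<close> and the axial part between 1/2 and 3/2; \<open>r / (2 * h)\<close> then
    gives \<open>h * norm w' / r < 1/2\<close>, and \<open>\<tau> \<le> h / 2\<close> keeps the
    height below \<open>h\<close>.\<close>
  define c where "c = min (1/2) (r / (2 * h))"
  define \<tau> where "\<tau> = min r (h / 2)"
  have c: "0 < c" "c \<le> 1/2" "c \<le> r / (2 * h)" using r h by (auto simp: c_def)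
  have \<tau>: "\<tau> > 0" "\<tau> \<le> r" "\<tau> \<le> h/2" using r h by (auto simp: \<tau>_def)
  have "s *\<^sub>R w \<in> trunc_cone r h" if w: "w \<in> ball last_dir c" and s: "0 < s" "s \<le> \<tau>" for w :: 'a and s
  proof -
    let ?e = "last_dir :: 'a"
    have ee: "?e \<bullet> ?e = 1" using norm_last_dir by (simp add: norm_eq_1)
    have nw: "norm (w - ?e) < c" using w by (simp add: dist_norm norm_minus_commute)
    have "\<bar>(w - ?e) \<bullet> ?e\<bar> \<le> norm (w - ?e) * norm ?e" by (rule Cauchy_Schwarz_ineq2)
    then have wd: "\<bar>w \<bullet> ?e - 1\<bar> < c" using nw ee by (simp add: inner_diff_left norm_last_dir)
    define w' where "w' = w - (w \<bullet> ?e) *\<^sub>R ?e"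
    have "w' = (w - ?e) - ((w - ?e) \<bullet> ?e) *\<^sub>R ?e" by (simp add: w'_def inner_diff_left ee algebra_simps)
    moreover have "norm ((w - ?e) - ((w - ?e) \<bullet> ?e) *\<^sub>R ?e) \<le> norm (w - ?e)"
    proof -
      have "((w - ?e) - ((w - ?e) \<bullet> ?e) *\<^sub>R ?e) \<bullet> ((w - ?e) - ((w - ?e) \<bullet> ?e) *\<^sub>R ?e)
        = (w - ?e) \<bullet> (w - ?e) - ((w - ?e) \<bullet> ?e)\<^sup>2"
        by (simp only: inner_diff_left[of "w - ?e"] inner_diff_right[of _ "w - ?e"] inner_scaleR_left inner_scaleR_right ee
            inner_commute[of ?e "w - ?e"] power2_eq_square) (simp add: algebra_simps)
      then show ?thesis by (simp add: norm_le)
    qed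
    ultimately have nw': "norm w' < c" using nw by simp
    have wdp: "w \<bullet> ?e > 1/2" "w \<bullet> ?e < 3/2" using wd c by auto
    have 1: "norm (s *\<^sub>R w') < r"
    proof -
      have "s * norm w' \<le> \<tau> * norm w'" using s by (intro mult_right_mono) auto
      also have "\<dots> < \<tau> * 1" using \<tau> nw' c by (intro mult_strict_left_mono) auto
      finally show ?thesis using \<tau> s by simp
    qed
    have "h * norm w' / r < w \<bullet> ?e"
    proof -
      have "h * norm w' < h * (r / (2 * h))" using nw' c h by (intro mult_strict_left_mono) auto
      then have "h * norm w' / r < 1/2" using r h by (simp add: field_simps)
      then show ?thesis using wdp(1) by linarith
    qed
    then have 2: "h * norm (s *\<^sub>R w') / r < s * (w \<bullet> ?e)"
      using mult_strict_left_mono[of "h * norm w' / r" "w \<bullet> ?e" s] s by (simp add: mult_ac)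
    have 3: "s * (w \<bullet> ?e) < h"
    proof -
      have "s * (w \<bullet> ?e) < s * (3/2)" using wdp s by (intro mult_strict_left_mono) auto
      also have "\<dots> \<le> h/2 * (3/2)" using s \<tau> by (intro mult_right_mono) auto
      finally show ?thesis using h by simp
    qed
    have "s *\<^sub>R w - ((s *\<^sub>R w) \<bullet> ?e) *\<^sub>R ?e = s *\<^sub>R w'" by (simp add: w'_def scaleR_diff_right)
    then show ?thesis unfolding trunc_cone_def Let_def mem_Collect_eq using 1 2 3 by simp
  qed
  then show ?thesis using c \<tau> by blast
qed

lemma lipschitz_set_cone_at:
  fixes X :: "'a::euclidean_space set"
  assumes X: "lipschitz_set X" and x0: "x0 \<in> X"
  shows "\<exists>\<epsilon> c \<tau> e. cone_at X x0 \<epsilon> c \<tau> e"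
proof (cases "x0 \<in> interior X")
  case True
  then obtain \<epsilon> where \<epsilon>: "\<epsilon> > 0" "ball x0 \<epsilon> \<subseteq> interior X" by (rule openE[OF open_interior])
  have "cone_at X x0 (\<epsilon>/2) (1/2) (\<epsilon>/4) last_dir"
    unfolding cone_at_def
  proof (intro conjI ballI allI impI)
    fix y v :: 'a and s assume y: "y \<in> X \<inter> ball x0 (\<epsilon>/2)" and v: "v \<in> ball last_dir (1/2)" and s: "0 < s \<and> s \<le> \<epsilon>/4"
    have "norm v \<le> norm (last_dir :: 'a) + norm (v - last_dir)" by (rule norm_triangle_sub)
    then have "norm v \<le> 3/2" using v norm_last_dir[where 'a = 'a] by (simp add: dist_norm norm_minus_commute)
    then have "s * norm v \<le> \<epsilon>/4 * (3/2)" using s by (intro mult_mono) auto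
    then have "dist x0 (y + s *\<^sub>R v) < \<epsilon>"
      using y s \<epsilon>(1) dist_triangle[of x0 "y + s *\<^sub>R v" y] by (simp add: dist_norm)
    then show "y + s *\<^sub>R v \<in> interior X" using \<epsilon>(2) by auto
  qed (use \<epsilon> norm_last_dir in auto)
  then show ?thesis by blast
next
  case False
  have clX: "closure (interior X) = X" using X by (simp add: lipschitz_set_def)
  then have "x0 \<in> frontier (interior X)" using x0 False by (simp add: frontier_def)
  moreover have "uniform_cone_property (interior X)" using X by (simp add: lipschitz_set_def)
  ultimately obtain \<epsilon> r h and A :: "'a \<Rightarrow> 'a" where A: "\<epsilon> > 0" "r > 0" "h > 0" "orthogonal_transformation A"
    "\<forall>y\<in>closure (interior X) \<inter> ball x0 \<epsilon>. (\<lambda>z. y + A z) ` trunc_cone r h \<subseteq> interior X"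
    unfolding uniform_cone_property_def by blast
  obtain c \<tau> where c: "0 < c" "c \<le> 1/2" "\<tau> > 0"
    "\<And>w s. w \<in> ball (last_dir :: 'a) c \<Longrightarrow> 0 < s \<Longrightarrow> s \<le> \<tau> \<Longrightarrow> s *\<^sub>R w \<in> trunc_cone r h"
    using trunc_cone_contains_ball_directions[OF A(2,3), where 'a = 'a] by auto
  have lin: "linear A" using A(4) by (simp add: orthogonal_transformation_def)
  have "cone_at X x0 \<epsilon> c \<tau> (A last_dir)"
    unfolding cone_at_def
  proof (intro conjI ballI allI impI)
    show "norm (A last_dir) = 1" using A(4) norm_last_dir orthogonal_transformation_norm by metis
    fix y v :: 'a and s assume y: "y \<in> X \<inter> ball x0 \<epsilon>" and v: "v \<in> ball (A last_dir) c" and s: "0 < s \<and> s \<le> \<tau>"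
    obtain w where w: "v = A w" using orthogonal_transformation_surj[OF A(4)] by (metis surjD)
    have "dist (last_dir) w = dist (A last_dir) (A w)" using A(4) by (simp add: orthogonal_transformation_isometry)
    then have "w \<in> ball last_dir c" using v w by simp
    then have "s *\<^sub>R w \<in> trunc_cone r h" using c(4) s by blast
    then have "y + A (s *\<^sub>R w) \<in> interior X" using A(5) y clX by blast
    then show "y + s *\<^sub>R v \<in> interior X" using w lin by (simp add: linear_scale)
  qed (use A c in auto)
  then show ?thesis by blast
qed

section \<open>Test curves inside \<open>X\<close>\<close>

lemma arc_class_comp:
  assumes "f \<in> arc_class M X" "c \<in> curve_class M" "range c \<subseteq> X"
  shows "\<exists>H. H 0 = f \<circ> c \<and> jets_on UNIV H \<and> (\<forall>K. compact K \<longrightarrow> (\<exists>C \<rho>. C > 0 \<and> \<rho> > 0 \<and>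
          (\<forall>k. \<forall>t\<in>K. norm (H k t) \<le> C * \<rho> ^ k * fact k * M k)))"
proof -
  have "f \<circ> c \<in> curve_class M" using assms by (simp add: arc_class_def)
  then show ?thesis unfolding curve_class_iff .
qed

text \<open>A whole line may leave \<open>X\<close>, so it is replaced by
  \<open>y + E 0 t *\<^sub>R (\<kappa> *\<^sub>R v)\<close>, where \<open>E 0 t\<close> equals
  \<open>t\<close> near 0 and is bounded by 9/4; with \<open>\<kappa>\<close> small this curve stays
  in a ball inside \<open>X\<close>. Rescaling the parameter by \<open>1 / \<kappa>\<close> recovers
  the line near \<open>y\<close>.\<close>

lemma arc_class_line_jets:
  fixes X :: "'a::euclidean_space set"
  assumes M: "positive_seq M" "log_convex M" "non_quasianalytic M"
    and f: "f \<in> arc_class M X" and y: "y \<in> interior X"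
  shows "\<exists>\<epsilon>>0. \<exists>Q. jets_on {-\<epsilon><..<\<epsilon>} Q \<and> (\<forall>s\<in>{-\<epsilon><..<\<epsilon>}. f (y + s *\<^sub>R v) = Q 0 s)"
proof -
  obtain D where D: "beurling M D" "\<forall>t. 0 \<le> D 0 t \<and> D 0 t \<le> 1"
      "\<forall>t. \<bar>t\<bar> \<le> 3/4 \<longrightarrow> D 0 t = 1" "\<forall>t. \<bar>t\<bar> \<ge> 9/4 \<longrightarrow> D 0 t = 0"
    using beurling_cutoff_exists[OF M(1,3)] by blast
  obtain E where E: "beurling M E" "\<And>t. E 0 t = t * D 0 t"
    using beurling_mult_id[OF M(1,2) D(1), of "9/4"] D(4) by auto
  have Eb: "\<bar>E 0 t\<bar> \<le> 9/4" for t
  proof (cases "\<bar>t\<bar> \<ge> 9/4")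
    case False
    then have "\<bar>t\<bar> * \<bar>D 0 t\<bar> \<le> 9/4 * 1" using D(2) by (intro mult_mono) auto
    then show ?thesis by (simp add: E(2) abs_mult)
  qed (use D(4) E(2) in auto)
  obtain r where r: "r > 0" "ball y r \<subseteq> interior X" using y by (rule openE[OF open_interior])
  define \<kappa> where "\<kappa> = r / (3 * (norm v + 1))"
  have \<kappa>: "\<kappa> > 0" using r by (simp add: \<kappa>_def add_nonneg_pos)
  have \<kappa>r: "9/4 * (\<kappa> * norm v) < r"
  proof -
    have "\<kappa> * norm v \<le> \<kappa> * (norm v + 1)" using \<kappa> by (intro mult_left_mono) auto
    also have "\<dots> = r/3" by (simp add: \<kappa>_def add_nonneg_eq_0_iff field_simps)
    finally show ?thesis using r by simp
  qed
  define c where "c = (\<lambda>t. y + E 0 t *\<^sub>R (\<kappa> *\<^sub>R v))"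
  have cc: "c \<in> curve_class M" unfolding c_def by (rule beurling_curve[OF M(1) E(1)])
  have "c t \<in> X" for t
  proof -
    have "\<bar>E 0 t\<bar> * (\<kappa> * norm v) \<le> 9/4 * (\<kappa> * norm v)" using Eb \<kappa> by (intro mult_right_mono) auto
    moreover have "dist y (c t) = \<bar>E 0 t\<bar> * (\<kappa> * norm v)" using \<kappa> by (simp add: c_def dist_norm abs_mult)
    ultimately have "dist y (c t) < r" using \<kappa>r by linarith
    then have "c t \<in> interior X" using r(2) by (simp add: subset_iff)
    then show ?thesis using interior_subset[of X] by (rule subsetD[rotated])
  qed
  then have "range c \<subseteq> X" by auto
  from arc_class_comp[OF f cc this] obtain H where H: "H 0 = f \<circ> c" "jets_on UNIV H" by blast
  define Q where "Q = (\<lambda>k t. (1/\<kappa>) ^ k *\<^sub>R H k ((1/\<kappa>) * t + 0))"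
  have "jets_on {-(\<kappa>/2)<..<\<kappa>/2} Q" unfolding Q_def by (rule jets_on_affine[OF H(2)]) auto
  moreover have "f (y + s *\<^sub>R v) = Q 0 s" if "s \<in> {-(\<kappa>/2)<..<\<kappa>/2}" for s
  proof -
    have "\<bar>s / \<kappa>\<bar> \<le> 3/4" using that \<kappa> by (auto simp: field_simps abs_le_iff)
    then have "E 0 (s / \<kappa>) = s / \<kappa>" using D(3) by (simp add: E(2))
    then show ?thesis using \<kappa> by (simp add: Q_def H(1) c_def)
  qed
  ultimately show ?thesis using \<kappa> by (intro exI[of _ "\<kappa>/2"] conjI exI[of _ Q]) auto
qed


text \<open>Gluing rescaled bumps that touch \<open>y n + s\<^sup>2 v n\<close> near \<open>s = 0\<close> and return to \<open>x0\<close> inside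
  the cone gives one curve that detects all violations of the estimate at once; the substitution
  \<open>s\<^sup>2\<close> turns a derivative of order \<open>k\<close> into one of order \<open>2k\<close>.\<close>

lemma arc_class_line_deriv_bound:
  fixes X :: "'a::euclidean_space set"
  assumes M: "positive_seq M" "log_convex M" "non_quasianalytic M"
    and f: "f \<in> arc_class M X" and x0: "x0 \<in> X" and cone: "cone_at X x0 \<epsilon> c \<tau> e"
  shows "\<exists>\<delta>>0. \<exists>C>0. \<exists>\<rho>>0. \<forall>y\<in>interior X \<inter> ball x0 \<delta>. \<forall>v\<in>ball e (c/2). \<forall>k.
    \<bar>(deriv ^^ k) (\<lambda>s. f (y + s *\<^sub>R v)) 0\<bar> \<le> C * \<rho> ^ k * fact k * M (2 * k)"
proof (rule ccontr)
  assume neg: "\<not> ?thesis"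
  have Mp: "M i > 0" for i using M(1) by (simp add: positive_seq_def)
  have cn: "\<epsilon> > 0" "0 < c" "c \<le> 1/2" "\<tau> > 0" "norm e = 1"
    and conein: "\<And>y v s. y \<in> X \<Longrightarrow> dist x0 y < \<epsilon> \<Longrightarrow> dist e v < c \<Longrightarrow> 0 < s \<Longrightarrow> s \<le> \<tau> \<Longrightarrow> y + s *\<^sub>R v \<in> interior X"
    using cone by (auto simp: cone_at_def)
  obtain D where D: "beurling M D" "\<forall>t. 0 \<le> D 0 t \<and> D 0 t \<le> 1"
      "\<forall>t. \<bar>t\<bar> \<le> 3/4 \<longrightarrow> D 0 t = 1" "\<forall>t. \<bar>t\<bar> \<ge> 9/4 \<longrightarrow> D 0 t = 0"
    using beurling_cutoff_exists[OF M(1,3)] by blast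
  obtain E where E: "beurling M E" "\<And>t. E 0 t = t * D 0 t"
    using beurling_mult_id[OF M(1,2) D(1), of "9/4"] D(4) by auto
  obtain G where G: "beurling M G" "\<And>t. G 0 t = t * E 0 t"
    using beurling_mult_id[OF M(1,2) E(1), of "9/4"] D(4) E(2) by auto
  have G2: "G 0 t = t\<^sup>2 * D 0 t" for t by (simp add: G(2) E(2) power2_eq_square)
  \<comment> \<open>\<open>F\<close> carries the base point and \<open>G\<close> the motion along
    the direction. The factor 4 makes \<open>F\<close> drop from 1 to 0 for
    \<open>\<bar>s\<bar>\<close> between 3/16 and 9/16, where \<open>D\<close> is still 1 and
    \<open>G 0 s = s\<^sup>2\<close> is bounded below: the base point changes only while the curve
    is well inside the cone.\<close>
  define F where "F = (\<lambda>k t. 4 ^ k * D k (4 * t))"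
  have F: "beurling M F" unfolding F_def by (rule beurling_scale[OF D(1)]) simp
  have F0: "F 0 t = D 0 (4 * t)" for t by (simp add: F_def)
  \<comment> \<open>Piece \<open>n\<close> lives around \<open>(1/2) ^ n\<close> in a window of
    radius \<open>9/4 * r n\<close>, which is 9/64 of the centre; windows for different
    \<open>n\<close> are therefore disjoint.\<close>
  define r :: "nat \<Rightarrow> real" where "r = (\<lambda>n. (1/2) ^ n / 16)"
  have r: "r n > 0" for n by (simp add: r_def)
  have "\<exists>B>0. \<forall>k t. \<bar>F k t\<bar> \<le> B * r n ^ k * fact k * M k \<and> \<bar>G k t\<bar> \<le> B * r n ^ k * fact k * M k" for n
  proof -
    obtain B1 where B1: "B1 > 0" "\<And>k t. \<bar>F k t\<bar> \<le> B1 * r n ^ k * fact k * M k"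
      using F r[of n] unfolding beurling_def by blast
    obtain B2 where B2: "B2 > 0" "\<And>k t. \<bar>G k t\<bar> \<le> B2 * r n ^ k * fact k * M k"
      using G(1) r[of n] unfolding beurling_def by blast
    have le: "B1 * r n ^ k * fact k * M k \<le> (B1 + B2) * r n ^ k * fact k * M k"
      "B2 * r n ^ k * fact k * M k \<le> (B1 + B2) * r n ^ k * fact k * M k" for k
      using B1(1) B2(1) r[of n] Mp[of k] by (auto intro!: mult_right_mono)
    have "B1 + B2 > 0" using B1(1) B2(1) by simp
    then show ?thesis using order_trans[OF B1(2) le(1)] order_trans[OF B2(2) le(2)] by blast
  qed
  then obtain B where B: "\<And>n. B n > 0" "\<And>n k t. \<bar>F k t\<bar> \<le> B n * r n ^ k * fact k * M k"
    "\<And>n k t. \<bar>G k t\<bar> \<le> B n * r n ^ k * fact k * M k" by metis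
  \<comment> \<open>\<open>\<tau> / 6\<close> keeps the step \<open>s\<^sup>2 * D 0 s * l n\<close>,
    where \<open>s\<^sup>2 \<le> 6\<close>, inside the cone. The other bound makes the amplitude
    beat the constant \<open>B n\<close> that squeezing by \<open>r n\<close> has cost, with
    \<open>(1/2) ^ n\<close> left for summation.\<close>
  define l where "l = (\<lambda>n. min (\<tau> / 6) ((1/2) ^ n / (4 * B n)))"
  have l: "l n > 0" "l n \<le> \<tau> / 6" "l n \<le> (1/2) ^ n / (4 * B n)" for n
    using cn B(1)[of n] by (auto simp: l_def)
  \<comment> \<open>9/512 is half of \<open>(3/16)\<^sup>2\<close>: while \<open>F\<close> drops,
    the step along \<open>v n\<close> exceeds \<open>9/256 * l n\<close>, so moving the base point
    by \<open>d n\<close> tilts the direction by less than \<open>c/2\<close>.\<close>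
  define d where "d = (\<lambda>n. min \<epsilon> (l n * (c * (9/512))))"
  have d: "d n > 0" "d n \<le> \<epsilon>" "d n \<le> l n * (c * (9/512))" for n using cn l(1)[of n] by (auto simp: d_def)
  have dl: "d n \<le> l n" for n
  proof -
    have "l n * (c * (9/512)) \<le> l n * 1" using l(1)[of n] cn by (intro mult_left_mono) auto
    then show ?thesis using d(3)[of n] by simp
  qed
  \<comment> \<open>The constants that the violations must exceed are fixed only now:
    \<open>(r n)\<^sup>2 / l n\<close> is what squeezing and amplitude do to each order of the
    derivative, and \<open>real (Suc n)\<close> eventually exceeds any constants of
    \<open>f \<circ> \<gamma>\<close>.\<close>
  define A where "A = (\<lambda>n. real (Suc n) * (1 + (r n)\<^sup>2 / l n))"
  have A: "A n > 0" for n unfolding A_def using l(1)[of n] by (intro mult_pos_pos) (auto intro: add_pos_nonneg)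
  have "\<exists>y v k. y \<in> interior X \<and> dist x0 y < d n \<and> dist e v < c/2 \<and>
      \<bar>(deriv ^^ k) (\<lambda>s. f (y + s *\<^sub>R v)) 0\<bar> > A n * A n ^ k * fact k * M (2 * k)" for n
  proof (rule ccontr)
    assume no: "\<not> ?thesis"
    have no': "\<not> A n * A n ^ k * fact k * M (2 * k) < \<bar>(deriv ^^ k) (\<lambda>s. f (y + s *\<^sub>R v)) 0\<bar>"
      if "y \<in> interior X" "dist x0 y < d n" "dist e v < c/2" for y v k
      using no that by blast
    have "\<forall>y\<in>interior X \<inter> ball x0 (d n). \<forall>v\<in>ball e (c/2). \<forall>k.
      \<bar>(deriv ^^ k) (\<lambda>s. f (y + s *\<^sub>R v)) 0\<bar> \<le> A n * A n ^ k * fact k * M (2 * k)"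
      by (intro ballI allI leI no') auto
    then show False using neg d(1)[of n] A[of n] by blast
  qed
  then obtain y v and k :: "nat \<Rightarrow> nat" where yvk: "\<And>n. y n \<in> interior X" "\<And>n. dist x0 (y n) < d n" "\<And>n. dist e (v n) < c/2"
    "\<And>n. \<bar>(deriv ^^ k n) (\<lambda>s. f (y n + s *\<^sub>R v n)) 0\<bar> > A n * A n ^ k n * fact (k n) * M (2 * k n)" by metis
  have nv: "norm (v n) \<le> 5/4" for n
  proof -
    have "norm (v n) \<le> norm e + norm (v n - e)" by (rule norm_triangle_sub)
    then show ?thesis using yvk(3)[of n] cn by (simp add: dist_norm norm_minus_commute)
  qed
  define t :: "nat \<Rightarrow> real" where "t = (\<lambda>n. (1/2) ^ n)"
  define S where "S = (\<lambda>n u. (1 / r n) * u + (- t n / r n))"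
  have S: "S n u = (u - t n) / r n" for n u using r[of n] by (simp add: S_def diff_divide_distrib)
  have St: "S n (t n + r n * s) = s" for n s using r[of n] by (simp add: S)
  define P where "P = (\<lambda>n k u. ((1 / r n) ^ k * F k (S n u)) *\<^sub>R (y n - x0) + ((1 / r n) ^ k * G k (S n u)) *\<^sub>R (l n *\<^sub>R v n))"
  have jP: "jets_on UNIV (P n)" for n
  proof -
    have "jets_on UNIV (\<lambda>k u. (1 / r n) ^ k *\<^sub>R F k (S n u))" unfolding S_def
      by (rule jets_on_affine[of UNIV]) (use F in \<open>auto simp: beurling_def\<close>)
    moreover have "jets_on UNIV (\<lambda>k u. (1 / r n) ^ k *\<^sub>R G k (S n u))" unfolding S_def
      by (rule jets_on_affine[of UNIV]) (use G in \<open>auto simp: beurling_def\<close>)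
    ultimately show ?thesis unfolding P_def
      by (intro jets_on_add jets_on_scaleR_right) auto
  qed
  have bP: "norm (P n j u) \<le> (1/2) ^ n * (fact j * M j)" for n j u
  proof -
    have sc: "\<bar>(1 / r n) ^ j * q\<bar> \<le> B n * fact j * M j" if "\<bar>q\<bar> \<le> B n * r n ^ j * fact j * M j" for q
    proof -
      have "\<bar>(1 / r n) ^ j * q\<bar> \<le> (1 / r n) ^ j * (B n * r n ^ j * fact j * M j)"
        using that r[of n] by (simp add: abs_mult power_abs)
      also have "\<dots> = B n * fact j * M j" using r[of n] by (simp add: power_one_over)
      finally show ?thesis .
    qed
    have W: "B n * fact j * M j \<ge> 0" using B(1)[of n] Mp[of j] by (simp add: less_imp_le)
    have "norm (P n j u) \<le> (B n * fact j * M j) * norm (y n - x0) + (B n * fact j * M j) * norm (l n *\<^sub>R v n)"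
      unfolding P_def
      by (intro order_trans[OF norm_triangle_ineq] add_mono; unfold norm_scaleR[of "_ * _"]; intro mult_right_mono sc B norm_ge_zero)
    also have "\<dots> \<le> (B n * fact j * M j) * l n + (B n * fact j * M j) * (l n * (5/4))"
      using W yvk(2)[of n] dl[of n] nv[of n] l(1)[of n]
      by (intro add_mono mult_left_mono) (auto simp: dist_norm norm_minus_commute)
    also have "\<dots> = (9/4 * B n * l n) * (fact j * M j)" by (simp add: algebra_simps)
    also have "\<dots> \<le> (1/2) ^ n * (fact j * M j)"
    proof (rule mult_right_mono)
      have "9/4 * B n * l n \<le> 4 * B n * l n" using B(1)[of n] l(1)[of n] by simp
      also have "\<dots> \<le> 4 * B n * ((1/2) ^ n / (4 * B n))" using l(3)[of n] B(1)[of n] by (intro mult_left_mono) auto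
      also have "\<dots> = (1/2) ^ n" using B(1)[of n] by simp
      finally show "9/4 * B n * l n \<le> (1/2) ^ n" .
      show "0 \<le> fact j * M j" using Mp[of j] by simp
    qed
    finally show ?thesis .
  qed
  define \<gamma> where "\<gamma> = (\<lambda>u. x0 + (\<Sum>n. P n 0 u))"
  have \<gamma>c: "\<gamma> \<in> curve_class M" unfolding \<gamma>_def by (rule glued_curve[OF M(1) jP bP])
  have P0: "P n 0 u = D 0 (4 * S n u) *\<^sub>R (y n - x0) + ((S n u)\<^sup>2 * D 0 (S n u)) *\<^sub>R (l n *\<^sub>R v n)" for n u
    by (simp add: P_def F0 G2)
  have P_out: "P n 0 u = 0" if "\<bar>S n u\<bar> \<ge> 9/4" for n u using D(4) that by (simp add: P0 abs_mult)
  have win: "3/4 * t n < u \<and> u < 5/4 * t n" if "\<bar>S n u\<bar> < 9/4" for n u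
  proof -
    have "\<bar>u - t n\<bar> < 9/4 * r n" using that r[of n] by (simp add: S field_simps)
    moreover have "r n = t n / 16" "t n > 0" by (simp_all add: r_def t_def)
    ultimately show ?thesis unfolding abs_less_iff by (intro conjI; linarith)
  qed
  have tm: "t m \<le> t n / 2" if "n < m" for n m
  proof -
    have "(1/2::real) ^ m \<le> (1/2) ^ Suc n" using that by (intro power_decreasing) auto
    then show ?thesis by (simp add: t_def)
  qed
  have disj: "P m 0 u = 0" if "\<bar>S n u\<bar> < 9/4" "m \<noteq> n" for m n u
  proof (rule ccontr)
    assume "P m 0 u \<noteq> 0"
    then have "\<bar>S m u\<bar> < 9/4" using P_out[of m u] by (meson not_le)
    from win[OF this] win[OF that(1)] tm[of m n] tm[of n m] that(2) show False by (cases m n rule: linorder_cases) auto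
  qed
  have \<gamma>eq: "\<gamma> u = x0 + P n 0 u" if "\<bar>S n u\<bar> < 9/4" for n u
  proof -
    have "(\<Sum>m. P m 0 u) = (\<Sum>m\<in>{n}. P m 0 u)" by (rule suminf_finite) (use disj[OF that] in auto)
    then show ?thesis by (simp add: \<gamma>_def)
  qed
  have \<gamma>out: "\<gamma> u = x0" if "\<And>n. \<bar>S n u\<bar> \<ge> 9/4" for u
    using P_out[OF that] by (simp add: \<gamma>_def)
  have inX: "z \<in> X" if "z \<in> interior X" for z using that interior_subset by (rule subsetD[rotated])
  have "\<gamma> u \<in> X" for u
  proof (cases "\<exists>n. \<bar>S n u\<bar> < 9/4")
    case False
    then show ?thesis using \<gamma>out[of u] x0 by (auto simp: not_less)
  next
    case True
    then obtain n where n: "\<bar>S n u\<bar> < 9/4" by blast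
    define s where "s = S n u"
    have g: "\<gamma> u = x0 + (D 0 (4 * s) *\<^sub>R (y n - x0) + (s\<^sup>2 * D 0 s * l n) *\<^sub>R v n)"
      using \<gamma>eq[OF n] by (simp add: P0 s_def)
    define \<sigma> where "\<sigma> = s\<^sup>2 * D 0 s * l n"
    have \<sigma>0: "\<sigma> \<ge> 0" unfolding \<sigma>_def using D(2) l(1)[of n] by (simp add: less_imp_le)
    have "s\<^sup>2 \<le> 6"
    proof -
      have "\<bar>s\<bar>\<^sup>2 \<le> (9/4)\<^sup>2" using n by (intro power_mono) (auto simp: s_def)
      also have "\<dots> \<le> (6::real)" by (simp add: power2_eq_square)
      finally show ?thesis by simp
    qed
    then have "s\<^sup>2 * D 0 s \<le> 6 * 1" using D(2) by (intro mult_mono) auto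
    then have "\<sigma> \<le> (6 * 1) * l n" unfolding \<sigma>_def using l(1)[of n] by (intro mult_right_mono) auto
    then have \<sigma>\<tau>: "\<sigma> \<le> \<tau>" using l(2)[of n] by simp
    have gs: "\<gamma> u = x0 + (D 0 (4 * s) *\<^sub>R (y n - x0) + \<sigma> *\<^sub>R v n)" using g by (simp add: \<sigma>_def)
    have ev: "dist e (v n) < c" using yvk(3)[of n] cn zero_le_dist[of e "v n"] by linarith
    \<comment> \<open>Near the centre the base point is \<open>y n\<close>; in the middle zone the
      point is rewritten as a step \<open>\<sigma>\<close> from \<open>x0\<close> in a tilted
      direction \<open>w\<close>; farther out the base point is already \<open>x0\<close>, to which
      the curve returns as \<open>\<sigma>\<close> goes to 0.\<close>
    consider "\<bar>s\<bar> \<le> 3/16" | "3/16 < \<bar>s\<bar>" "\<bar>s\<bar> < 9/16" | "\<bar>s\<bar> \<ge> 9/16" by linarith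
    then show ?thesis
    proof cases
      case 1
      then have "D 0 (4 * s) = 1" using D(3) by (simp add: abs_mult)
      then have "\<gamma> u = y n + \<sigma> *\<^sub>R v n" using gs by simp
      moreover have "y n + \<sigma> *\<^sub>R v n \<in> X"
      proof (cases "\<sigma> = 0")
        case False
        have "dist x0 (y n) < \<epsilon>" using yvk(2)[of n] d(2)[of n] by simp
        then show ?thesis using conein[OF inX[OF yvk(1)] _ ev _ \<sigma>\<tau>] False \<sigma>0 inX by auto
      qed (use inX[OF yvk(1)] in simp)
      ultimately show ?thesis by simp
    next
      case 2
      have "D 0 s = 1" using D(3) 2 by simp
      have "(3/16)\<^sup>2 < \<bar>s\<bar>\<^sup>2" using 2 by (intro power_strict_mono) auto
      then have s2: "s\<^sup>2 > 9/256" by (simp add: power2_eq_square)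
      have \<sigma>l: "\<sigma> > 9/256 * l n" unfolding \<sigma>_def using \<open>D 0 s = 1\<close> s2 l(1)[of n] by simp
      then have \<sigma>p: "\<sigma> > 0" using l(1)[of n] by linarith
      define w where "w = v n + (D 0 (4 * s) / \<sigma>) *\<^sub>R (y n - x0)"
      have "\<gamma> u = x0 + \<sigma> *\<^sub>R w" using gs \<sigma>p by (simp add: w_def scaleR_add_right)
      moreover have "dist e w < c"
      proof -
        have "dist (v n) w = D 0 (4 * s) / \<sigma> * norm (y n - x0)" using D(2) \<sigma>p by (simp add: w_def dist_norm)
        also have "\<dots> \<le> 1 / \<sigma> * (l n * (c * (9/512)))"
          using D(2) \<sigma>p yvk(2)[of n] d(3)[of n]
          by (intro mult_mono divide_right_mono) (auto simp: dist_norm norm_minus_commute)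
        also have "\<dots> < c / 2" 
        proof -
          have "l n * (c * (9/512)) = (c/2) * (9/256 * l n)" by simp
          also have "\<dots> < (c/2) * \<sigma>" using \<sigma>l cn by (intro mult_strict_left_mono) auto
          finally show ?thesis using \<sigma>p by (simp add: divide_less_eq)
        qed
        finally show ?thesis using yvk(3)[of n] dist_triangle[of e w "v n"] by simp
      qed
      ultimately show ?thesis using conein[OF x0, of w \<sigma>] \<sigma>p \<sigma>\<tau> cn inX by simp
    next
      case 3
      then have "D 0 (4 * s) = 0" using D(4) by (simp add: abs_mult)
      then have "\<gamma> u = x0 + \<sigma> *\<^sub>R v n" using gs by simp
      then show ?thesis using conein[OF x0 _ ev _ \<sigma>\<tau>] \<sigma>0 cn inX x0 by (cases "\<sigma> = 0") auto
    qed
  qed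
  then have "range \<gamma> \<subseteq> X" by auto
  from arc_class_comp[OF f \<gamma>c this] obtain H where H: "H 0 = f \<circ> \<gamma>" "jets_on UNIV H"
    "\<forall>K. compact K \<longrightarrow> (\<exists>C \<rho>. C > 0 \<and> \<rho> > 0 \<and> (\<forall>k. \<forall>t\<in>K. norm (H k t) \<le> C * \<rho> ^ k * fact k * M k))" by blast
  obtain C \<rho> where C: "C > 0" "\<rho> > 0" "\<And>k u. u \<in> {0..1} \<Longrightarrow> norm (H k u) \<le> C * \<rho> ^ k * fact k * M k"
    using H(3) compact_Icc[of 0 "1::real"] by meson
  \<comment> \<open>Any \<open>n\<close> above \<open>C\<close> and \<open>\<rho>\<^sup>2\<close>
    gives the contradiction: the class bound of order \<open>2 * k n\<close> at the centre
    \<open>t n\<close> is then at most the bound that piece \<open>n\<close> violates.\<close>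
  obtain n :: nat where n: "real n \<ge> max C (\<rho>\<^sup>2)" using real_arch_simple by blast
  obtain \<epsilon>' Q where Q: "\<epsilon>' > 0" "jets_on {-\<epsilon>'<..<\<epsilon>'} Q" "\<forall>s\<in>{-\<epsilon>'<..<\<epsilon>'}. f (y n + s *\<^sub>R v n) = Q 0 s"
    using arc_class_line_jets[OF M f yvk(1)[of n], of "v n"] by blast
  define R where "R = (\<lambda>j s. r n ^ j *\<^sub>R H j (r n * s + t n))"
  have jR: "jets_on {-(3/16)<..<3/16} R" unfolding R_def by (rule jets_on_affine[OF H(2)]) simp
  have R0: "R 0 s = Q 0 (l n * s\<^sup>2)" if "\<bar>s\<bar> < 3/16" "l n * s\<^sup>2 < \<epsilon>'" for s
  proof -
    have Ss: "S n (r n * s + t n) = s" using St[of n s] by (simp add: add.commute)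
    have "\<gamma> (r n * s + t n) = x0 + P n 0 (r n * s + t n)" using \<gamma>eq[of n "r n * s + t n"] Ss that by simp
    also have "\<dots> = y n + (l n * s\<^sup>2) *\<^sub>R v n"
    proof -
      have "D 0 s = 1" "D 0 (4 * s) = 1" using D(3) that(1) by (simp_all add: abs_mult)
      then show ?thesis unfolding P0 Ss by (simp add: mult.commute[of "l n"])
    qed
    finally have "R 0 s = f (y n + (l n * s\<^sup>2) *\<^sub>R v n)" by (simp add: R_def H(1))
    moreover have "l n * s\<^sup>2 \<ge> 0" using l(1)[of n] by simp
    then have "l n * s\<^sup>2 \<in> {-\<epsilon>'<..<\<epsilon>'}" using that(2) Q(1) by simp
    ultimately show ?thesis using Q(3) by simp
  qed
  have even: "R (2 * k n) 0 = fact (2 * k n) / fact (k n) * l n ^ k n * Q (k n) 0"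
    by (rule jets_even_substitution[OF Q(2) jR Q(1) _ l(1) R0]) auto
  have "(deriv ^^ k n) (\<lambda>s. f (y n + s *\<^sub>R v n)) 0 = Q (k n) 0"
    using Q by (intro jets_on_deriv[of "{-\<epsilon>'<..<\<epsilon>'}"]) auto
  then have big: "\<bar>Q (k n) 0\<bar> > A n * A n ^ k n * fact (k n) * M (2 * k n)" using yvk(4)[of n] by simp
  let ?k = "k n"
  have t01: "t n \<in> {0..1}" by (simp add: t_def power_le_one)
  have "\<bar>Q ?k 0\<bar> = fact ?k / (fact (2 * ?k) * l n ^ ?k) * \<bar>R (2 * ?k) 0\<bar>"
    using l(1)[of n] unfolding even by (simp add: abs_mult)
  also have "\<dots> \<le> fact ?k / (fact (2 * ?k) * l n ^ ?k) * (r n ^ (2 * ?k) * (C * \<rho> ^ (2 * ?k) * fact (2 * ?k) * M (2 * ?k)))"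
  proof (rule mult_left_mono)
    show "\<bar>R (2 * ?k) 0\<bar> \<le> r n ^ (2 * ?k) * (C * \<rho> ^ (2 * ?k) * fact (2 * ?k) * M (2 * ?k))"
      using C(3)[OF t01, of "2 * ?k"] r[of n] by (simp add: R_def abs_mult)
    show "0 \<le> fact ?k / (fact (2 * ?k) * l n ^ ?k)" using l(1)[of n] by (simp add: less_imp_le)
  qed
  also have "fact ?k / (fact (2 * ?k) * l n ^ ?k) * (r n ^ (2 * ?k) * (C * \<rho> ^ (2 * ?k) * fact (2 * ?k) * M (2 * ?k)))
     = (C * (\<rho>\<^sup>2) ^ ?k) * (((r n)\<^sup>2 / l n) ^ ?k * (fact ?k * M (2 * ?k)))"
    by (simp add: power_mult power_divide)
  also have "\<dots> \<le> (real (Suc n) * real (Suc n) ^ ?k) * ((1 + (r n)\<^sup>2 / l n) ^ Suc ?k * (fact ?k * M (2 * ?k)))"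
  proof (rule mult_mono)
    have "C \<le> real (Suc n)" "\<rho>\<^sup>2 \<le> real (Suc n)" using n by auto
    then show "C * (\<rho>\<^sup>2) ^ ?k \<le> real (Suc n) * real (Suc n) ^ ?k"
      using C(1) by (intro mult_mono power_mono) auto
    have q0: "(r n)\<^sup>2 / l n \<ge> 0" using l(1)[of n] by simp
    have "((r n)\<^sup>2 / l n) ^ ?k \<le> (1 + (r n)\<^sup>2 / l n) ^ ?k" using q0 by (intro power_mono) auto
    also have "\<dots> \<le> (1 + (r n)\<^sup>2 / l n) ^ Suc ?k" using q0 by (intro power_increasing) auto
    finally show "((r n)\<^sup>2 / l n) ^ ?k * (fact ?k * M (2 * ?k)) \<le> (1 + (r n)\<^sup>2 / l n) ^ Suc ?k * (fact ?k * M (2 * ?k))"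
      using Mp[of "2 * ?k"] by (intro mult_right_mono) auto
    show "0 \<le> ((r n)\<^sup>2 / l n) ^ ?k * (fact ?k * M (2 * ?k))" using q0 Mp[of "2 * ?k"] by (intro mult_nonneg_nonneg) auto
  qed auto
  also have "\<dots> = A n * A n ^ ?k * fact ?k * M (2 * ?k)"
    by (simp add: A_def power_mult_distrib mult_ac)
  finally have "\<bar>Q ?k 0\<bar> \<le> A n * A n ^ ?k * fact ?k * M (2 * ?k)" .
  then show False using big by simp
qed

lemma norm_cone_direction:
  assumes "norm e = 1" "dist e v < 1/4"
  shows "norm v \<le> 5/4"
proof -
  have "norm v \<le> norm e + norm (v - e)" by (rule norm_triangle_sub)
  then show ?thesis using assms by (simp add: dist_norm norm_minus_commute)
qed

lemma arc_class_segment_tendsto: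
  fixes X :: "'a::euclidean_space set"
  assumes M: "positive_seq M" "log_convex M" "non_quasianalytic M"
    and f: "f \<in> arc_class M X" and cone: "cone_at X x0 \<epsilon> c \<tau> e"
    and y: "y \<in> X" "dist x0 y < \<epsilon>" and v: "dist e v < c"
  shows "((\<lambda>s. f (y + s *\<^sub>R v)) \<longlongrightarrow> f y) (at_right 0)"
proof -
  have cn: "\<epsilon> > 0" "0 < c" "c \<le> 1/2" "\<tau> > 0" "norm e = 1"
    and conein: "\<And>s. 0 < s \<Longrightarrow> s \<le> \<tau> \<Longrightarrow> y + s *\<^sub>R v \<in> interior X"
    using cone y v by (auto simp: cone_at_def)
  obtain D where D: "beurling M D" "\<forall>t. 0 \<le> D 0 t \<and> D 0 t \<le> 1"
      "\<forall>t. \<bar>t\<bar> \<le> 3/4 \<longrightarrow> D 0 t = 1" "\<forall>t. \<bar>t\<bar> \<ge> 9/4 \<longrightarrow> D 0 t = 0"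
    using beurling_cutoff_exists[OF M(1,3)] by blast
  obtain E where E: "beurling M E" "\<And>t. E 0 t = t * D 0 t"
    using beurling_mult_id[OF M(1,2) D(1), of "9/4"] D(4) by auto
  obtain G where G: "beurling M G" "\<And>t. G 0 t = t * E 0 t"
    using beurling_mult_id[OF M(1,2) E(1), of "9/4"] D(4) E(2) by auto
  have G2: "G 0 t = t\<^sup>2 * D 0 t" for t by (simp add: G(2) E(2) power2_eq_square)
  define \<kappa> where "\<kappa> = \<tau> / 6"
  have \<kappa>: "\<kappa> > 0" using cn by (simp add: \<kappa>_def)
  define \<gamma> where "\<gamma> = (\<lambda>t. y + G 0 t *\<^sub>R (\<kappa> *\<^sub>R v))"
  have \<gamma>c: "\<gamma> \<in> curve_class M" unfolding \<gamma>_def by (rule beurling_curve[OF M(1) G(1)])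
  have "\<gamma> t \<in> X" for t
  proof -
    have G6: "G 0 t \<le> 6"
    proof (cases "\<bar>t\<bar> \<ge> 9/4")
      case False
      have "\<bar>t\<bar>\<^sup>2 \<le> (9/4)\<^sup>2" using False by (intro power_mono) auto
      also have "\<dots> \<le> (6::real)" by (simp add: power2_eq_square)
      finally have "t\<^sup>2 * D 0 t \<le> 6 * 1" using D(2) by (intro mult_mono) auto
      then show ?thesis by (simp add: G2)
    qed (use D(4) G2 in auto)
    have G0: "G 0 t \<ge> 0" using D(2) by (simp add: G2)
    have "G 0 t * \<kappa> \<le> \<tau>" using mult_right_mono[OF G6, of \<kappa>] \<kappa> by (simp add: \<kappa>_def)
    then have "y + (G 0 t * \<kappa>) *\<^sub>R v \<in> X" using conein[of "G 0 t * \<kappa>"] G0 \<kappa> y(1) interior_subset[of X]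
      by (cases "G 0 t = 0") (auto simp: subset_iff)
    then show ?thesis by (simp add: \<gamma>_def)
  qed
  then have "range \<gamma> \<subseteq> X" by auto
  from arc_class_comp[OF f \<gamma>c this] obtain H where H: "H 0 = f \<circ> \<gamma>" "jets_on UNIV H" by blast
  have "isCont (f \<circ> \<gamma>) 0" using jets_onD[OF H(2), of 0 0] H(1) by (simp add: has_vector_derivative_continuous)
  then have "((f \<circ> \<gamma>) \<longlongrightarrow> (f \<circ> \<gamma>) 0) (nhds 0)"
    unfolding isCont_def tendsto_at_iff_tendsto_nhds .
  moreover have "(f \<circ> \<gamma>) 0 = f y" by (simp add: \<gamma>_def G2)
  ultimately have lim0: "((f \<circ> \<gamma>) \<longlongrightarrow> f y) (nhds 0)" by simp
  have "((\<lambda>s. sqrt (s / \<kappa>)) \<longlongrightarrow> sqrt (0 / \<kappa>)) (at_right (0::real))"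
    by (intro tendsto_intros) (use \<kappa> in auto)
  then have "filterlim (\<lambda>s. sqrt (s / \<kappa>)) (nhds 0) (at_right 0)" by simp
  from filterlim_compose[OF lim0 this] have lim: "((\<lambda>s. (f \<circ> \<gamma>) (sqrt (s / \<kappa>))) \<longlongrightarrow> f y) (at_right 0)" .
  have "\<forall>\<^sub>F s in at_right 0. (f \<circ> \<gamma>) (sqrt (s / \<kappa>)) = f (y + s *\<^sub>R v)"
    unfolding eventually_at_right_field
  proof (intro exI[of _ "\<kappa> / 4"] conjI allI impI)
    fix s :: real assume s: "0 < s" "s < \<kappa> / 4"
    then have "s / \<kappa> \<le> 1/4" using \<kappa> by (simp add: field_simps)
    then have "sqrt (s / \<kappa>) \<le> sqrt (1/4)" by (rule real_sqrt_le_mono)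
    also have "sqrt (1/4) = (1/2::real)" by (rule real_sqrt_unique) (auto simp: power2_eq_square)
    finally have "D 0 (sqrt (s / \<kappa>)) = 1" using D(3) s \<kappa> by simp
    then show "(f \<circ> \<gamma>) (sqrt (s / \<kappa>)) = f (y + s *\<^sub>R v)" using s \<kappa> by (simp add: \<gamma>_def G2)
  qed (use \<kappa> in auto)
  from Lim_transform_eventually[OF lim this] show ?thesis .
qed

definition segment_bounds :: "('a::euclidean_space \<Rightarrow> real) \<Rightarrow> 'a set \<Rightarrow> 'a \<Rightarrow> real \<Rightarrow> real \<Rightarrow> real \<Rightarrow> 'a \<Rightarrow> (nat \<Rightarrow> real) \<Rightarrow> real \<Rightarrow> bool" where
  "segment_bounds f X x0 \<delta> c \<tau> e B L \<longleftrightarrow>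
    (\<forall>y\<in>X \<inter> ball x0 \<delta>. \<forall>v\<in>ball e c.
       jets_on {0<..<\<tau>} (\<lambda>k. (deriv ^^ k) (\<lambda>s. f (y + s *\<^sub>R v))) \<and>
       (\<forall>k. \<forall>s\<in>{0<..<\<tau>}. \<bar>(deriv ^^ k) (\<lambda>s. f (y + s *\<^sub>R v)) s\<bar> \<le> B k)) \<and>
    (\<forall>y\<in>X \<inter> ball x0 \<delta>. \<forall>y'\<in>X \<inter> ball x0 \<delta>. \<bar>f y - f y'\<bar> \<le> L * dist y y')"

text \<open>For small \<open>s > 0\<close> the point \<open>y + s *\<^sub>R v\<close> is interior,
  and the bound at parameter 0 for that base point is the bound at parameter \<open>s\<close> for
  the segment from \<open>y\<close>. First-order bounds give the Lipschitz estimate, since two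
  nearby points of \<open>X\<close> are joined by two segments with a common end.\<close>

lemma arc_class_segment_bounds:
  fixes X :: "'a::euclidean_space set"
  assumes M: "positive_seq M" "log_convex M" "non_quasianalytic M"
    and f: "f \<in> arc_class M X" and x0: "x0 \<in> X" and cone: "cone_at X x0 \<epsilon> c \<tau> e"
  shows "\<exists>\<delta>>0. \<exists>\<tau>'>0. \<exists>B L. \<delta> \<le> \<epsilon> \<and> \<tau>' \<le> \<tau> \<and> segment_bounds f X x0 \<delta> (c/2) \<tau>' e B L"
proof -
  have cn: "\<epsilon> > 0" "0 < c" "c \<le> 1/2" "\<tau> > 0" "norm e = 1"
    and conein: "\<And>y v s. y \<in> X \<Longrightarrow> dist x0 y < \<epsilon> \<Longrightarrow> dist e v < c \<Longrightarrow> 0 < s \<Longrightarrow> s \<le> \<tau> \<Longrightarrow> y + s *\<^sub>R v \<in> interior X"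
    using cone by (auto simp: cone_at_def)
  obtain \<delta> C \<rho> where C: "\<delta> > 0" "C > 0" "\<rho> > 0" "\<forall>y\<in>interior X \<inter> ball x0 \<delta>. \<forall>v\<in>ball e (c/2). \<forall>k.
    \<bar>(deriv ^^ k) (\<lambda>s. f (y + s *\<^sub>R v)) 0\<bar> \<le> C * \<rho> ^ k * fact k * M (2 * k)"
    using arc_class_line_deriv_bound[OF M f x0 cone] by blast
  define B where "B = (\<lambda>k. C * \<rho> ^ k * fact k * M (2 * k))"
  define \<delta>1 where "\<delta>1 = min \<epsilon> (\<delta> / 2)"
  define \<tau>' where "\<tau>' = min \<tau> (\<delta> / 4)"
  have \<delta>1: "\<delta>1 > 0" "\<delta>1 \<le> \<epsilon>" "\<delta>1 \<le> \<delta>/2" using cn C by (auto simp: \<delta>1_def)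
  have \<tau>': "\<tau>' > 0" "\<tau>' \<le> \<tau>" "\<tau>' \<le> \<delta>/4" using cn C by (auto simp: \<tau>'_def)
  have pt: "y + s *\<^sub>R v \<in> interior X \<inter> ball x0 \<delta>"
    if "y \<in> X" "dist x0 y < \<delta>1" "dist e v < c/2" "0 < s" "s < \<tau>'" for y v s
  proof -
    have "norm v \<le> 5/4" using norm_cone_direction[OF cn(5), of v] that(3) cn by simp
    then have "s * norm v \<le> \<delta>/4 * (5/4)" using that \<tau>' by (intro mult_mono) auto
    then have "dist x0 (y + s *\<^sub>R v) < \<delta>"
      using that \<delta>1 C(1) dist_triangle[of x0 "y + s *\<^sub>R v" y] by (simp add: dist_norm)
    moreover have "dist e v < c" using that(3) cn by linarith
    ultimately show ?thesis using conein[of y v s] that \<delta>1 \<tau>' by simp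
  qed
  have seg: "jets_on {0<..<\<tau>'} (\<lambda>k. (deriv ^^ k) (\<lambda>s. f (y + s *\<^sub>R v))) \<and>
       (\<forall>k. \<forall>s\<in>{0<..<\<tau>'}. \<bar>(deriv ^^ k) (\<lambda>s. f (y + s *\<^sub>R v)) s\<bar> \<le> B k)"
    if y: "y \<in> X" "dist x0 y < \<delta>1" and v: "dist e v < c/2" for y v
  proof -
    let ?q = "\<lambda>s. f (y + s *\<^sub>R v)"
    have loc: "\<exists>\<epsilon>' Q. \<epsilon>' > 0 \<and> jets_on {s-\<epsilon>'<..<s+\<epsilon>'} (\<lambda>k t. Q k (t - s)) \<and> (\<forall>t\<in>{s-\<epsilon>'<..<s+\<epsilon>'}. ?q t = Q 0 (t - s)) \<and>
        (\<forall>k. (deriv ^^ k) (\<lambda>u. f (y + s *\<^sub>R v + u *\<^sub>R v)) 0 = Q k 0)" if s: "s \<in> {0<..<\<tau>'}" for s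
    proof -
      have z: "y + s *\<^sub>R v \<in> interior X" using pt[OF y v, of s] s by simp
      obtain \<epsilon>' Q where Q: "\<epsilon>' > 0" "jets_on {-\<epsilon>'<..<\<epsilon>'} Q" "\<forall>u\<in>{-\<epsilon>'<..<\<epsilon>'}. f (y + s *\<^sub>R v + u *\<^sub>R v) = Q 0 u"
        using arc_class_line_jets[OF M f z, of v] by blast
      have "jets_on {s-\<epsilon>'<..<s+\<epsilon>'} (\<lambda>k t. 1 ^ k *\<^sub>R Q k (1 * t + (- s)))"
        by (rule jets_on_affine[OF Q(2)]) auto
      moreover have "?q t = Q 0 (t - s)" if "t \<in> {s-\<epsilon>'<..<s+\<epsilon>'}" for t
      proof -
        have "t - s \<in> {-\<epsilon>'<..<\<epsilon>'}" using that by auto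
        then have "f (y + s *\<^sub>R v + (t - s) *\<^sub>R v) = Q 0 (t - s)" using Q(3) by blast
        moreover have "y + s *\<^sub>R v + (t - s) *\<^sub>R v = y + t *\<^sub>R v" by (simp add: algebra_simps)
        ultimately show ?thesis by simp
      qed
      moreover have "(deriv ^^ k) (\<lambda>u. f (y + s *\<^sub>R v + u *\<^sub>R v)) 0 = Q k 0" for k
        using Q by (intro jets_on_deriv[of "{-\<epsilon>'<..<\<epsilon>'}"]) auto
      ultimately show ?thesis using Q(1) by (intro exI[of _ \<epsilon>'] exI[of _ Q]) auto
    qed
    show ?thesis
    proof (intro conjI allI ballI)
      show "jets_on {0<..<\<tau>'} (\<lambda>k. (deriv ^^ k) ?q)"
      proof (rule jets_on_deriv_local)
        fix s assume "s \<in> {0<..<\<tau>'}"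
        from loc[OF this] obtain \<epsilon>' Q where "\<epsilon>' > 0" "jets_on {s-\<epsilon>'<..<s+\<epsilon>'} (\<lambda>k t. Q k (t - s))"
          "\<forall>t\<in>{s-\<epsilon>'<..<s+\<epsilon>'}. ?q t = Q 0 (t - s)" by blast
        then show "\<exists>I Q. open I \<and> s \<in> I \<and> jets_on I Q \<and> (\<forall>t\<in>I. ?q t = Q 0 t)"
          by (intro exI[of _ "{s-\<epsilon>'<..<s+\<epsilon>'}"] exI[of _ "\<lambda>k t. Q k (t - s)"]) auto
      qed
      fix k s assume s: "s \<in> {0<..<\<tau>'}"
      from loc[OF this] obtain \<epsilon>' Q where Q: "\<epsilon>' > 0" "jets_on {s-\<epsilon>'<..<s+\<epsilon>'} (\<lambda>k t. Q k (t - s))"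
          "\<forall>t\<in>{s-\<epsilon>'<..<s+\<epsilon>'}. ?q t = Q 0 (t - s)" 
          "\<forall>k. (deriv ^^ k) (\<lambda>u. f (y + s *\<^sub>R v + u *\<^sub>R v)) 0 = Q k 0" by blast
      have "(deriv ^^ k) ?q s = (\<lambda>k t. Q k (t - s)) k s"
        using Q by (intro jets_on_deriv[of "{s-\<epsilon>'<..<s+\<epsilon>'}"]) auto
      then have "(deriv ^^ k) ?q s = (deriv ^^ k) (\<lambda>u. f (y + s *\<^sub>R v + u *\<^sub>R v)) 0" using Q(4) by simp
      then show "\<bar>(deriv ^^ k) ?q s\<bar> \<le> B k"
        using C(4) pt[OF y v, of s] s v by (simp add: B_def)
    qed
  qed
  have radial: "\<bar>f (y + s *\<^sub>R v) - f y\<bar> \<le> B 1 * s"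
    if y: "y \<in> X" "dist x0 y < \<delta>1" and v: "dist e v < c/2" and s: "0 < s" "s < \<tau>'" for y v s
  proof -
    let ?q = "\<lambda>s. f (y + s *\<^sub>R v)"
    note sg = seg[OF y v]
    have B1: "B 1 \<ge> 0"
    proof -
      have "\<bar>(deriv ^^ 1) ?q s\<bar> \<le> B 1" using sg s by (metis greaterThanLessThan_iff)
      then show ?thesis by linarith
    qed
    have d: "(?q has_real_derivative (deriv ^^ 1) ?q u) (at u)" if "0 < u" "u < \<tau>'" for u
      using jets_onD[OF conjunct1[OF sg], of u 0] that by (simp add: has_real_derivative_iff_has_vector_derivative)
    have "\<bar>?q s - ?q a\<bar> \<le> B 1 * s" if a: "0 < a" "a < s" for a
    proof -
      obtain z where z: "a < z" "z < s" "?q s - ?q a = (s - a) * (deriv ^^ 1) ?q z"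
        using MVT2[of a s ?q "(deriv ^^ 1) ?q"] a s d by auto
      have "\<bar>(deriv ^^ 1) ?q z\<bar> \<le> B 1" using conjunct2[OF sg] z a s by (meson greaterThanLessThan_iff order.strict_trans)
      then have "(s - a) * \<bar>(deriv ^^ 1) ?q z\<bar> \<le> s * B 1" using a s B1 by (intro mult_mono) auto
      then show ?thesis using z(3) a by (simp add: abs_mult mult.commute)
    qed
    then have ev: "\<forall>\<^sub>F a in at_right 0. \<bar>?q s - ?q a\<bar> \<le> B 1 * s"
      unfolding eventually_at_right_field using s by blast
    have "dist e v < c" using v cn by linarith
    then have "(?q \<longlongrightarrow> f y) (at_right 0)" using arc_class_segment_tendsto[OF M f cone y(1) _] y \<delta>1 by simp
    then have "((\<lambda>a. \<bar>?q s - ?q a\<bar>) \<longlongrightarrow> \<bar>?q s - f y\<bar>) (at_right 0)" by (intro tendsto_intros)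
    then show ?thesis by (rule tendsto_upperbound[OF _ ev]) simp
  qed
  define \<delta>2 where "\<delta>2 = min \<delta>1 (c * \<tau>' / 16)"
  have \<delta>2: "\<delta>2 > 0" "\<delta>2 \<le> \<delta>1" "\<delta>2 \<le> c * \<tau>' / 16" using \<delta>1 \<tau>' cn by (auto simp: \<delta>2_def)
  have lip: "\<bar>f y - f y'\<bar> \<le> (8 * B 1 / c) * dist y y'"
    if y: "y \<in> X" "dist x0 y < \<delta>2" "y' \<in> X" "dist x0 y' < \<delta>2" for y y'
  proof (cases "y = y'")
    case False
    \<comment> \<open>With this length the shift between \<open>y\<close> and \<open>y'\<close>
      tilts the direction by exactly \<open>c/4\<close>: stepping from \<open>y\<close> along
      \<open>e\<close> and from \<open>y'\<close> along \<open>w\<close> leads to the same point.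
      The radius \<open>\<delta>2\<close> guarantees \<open>s < \<tau>'\<close>.\<close>
    define s where "s = 4 / c * dist y y'"
    have s0: "s > 0" using False cn by (simp add: s_def)
    have "dist y y' < 2 * \<delta>2" using dist_triangle[of y y' x0] y by (simp add: dist_commute)
    then have "dist y y' < c * \<tau>' / 8" using \<delta>2(3) by linarith
    then have "s < 4 / c * (c * \<tau>' / 8)" unfolding s_def using cn by (intro mult_strict_left_mono) auto
    then have s1: "s < \<tau>'" using cn \<tau>' by simp
    define w where "w = e + (1 / s) *\<^sub>R (y - y')"
    have "dist e w = dist y y' / s" using s0 by (simp add: w_def dist_norm)
    also have "\<dots> = c / 4" using False cn by (simp add: s_def)
    finally have dw: "dist e w < c/2" using cn by simp
    have eq: "y + s *\<^sub>R e = y' + s *\<^sub>R w" using s0 by (simp add: w_def scaleR_add_right)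
    have "\<bar>f (y + s *\<^sub>R e) - f y\<bar> \<le> B 1 * s" using radial[of y e s] y \<delta>2 cn s0 s1 by simp
    moreover have "\<bar>f (y' + s *\<^sub>R w) - f y'\<bar> \<le> B 1 * s" using radial[of y' w s] y \<delta>2 dw s0 s1 by simp
    ultimately have "\<bar>f y - f y'\<bar> \<le> 2 * (B 1 * s)" unfolding eq by linarith
    then show ?thesis by (simp add: s_def)
  qed simp
  have "segment_bounds f X x0 \<delta>2 (c/2) \<tau>' e B (8 * B 1 / c)"
    unfolding segment_bounds_def
  proof (intro conjI ballI)
    fix y v assume "y \<in> X \<inter> ball x0 \<delta>2" "v \<in> ball e (c/2)"
    then have *: "y \<in> X" "dist x0 y < \<delta>1" "dist e v < c/2" using \<delta>2 by auto
    show "jets_on {0<..<\<tau>'} (\<lambda>k. (deriv ^^ k) (\<lambda>s. f (y + s *\<^sub>R v)))" using seg[OF *] by (rule conjunct1)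
    show "\<forall>k. \<forall>s\<in>{0<..<\<tau>'}. \<bar>(deriv ^^ k) (\<lambda>s. f (y + s *\<^sub>R v)) s\<bar> \<le> B k" using seg[OF *] by (rule conjunct2)
  next
    fix y y' assume "y \<in> X \<inter> ball x0 \<delta>2" "y' \<in> X \<inter> ball x0 \<delta>2"
    then show "\<bar>f y - f y'\<bar> \<le> 8 * B 1 / c * dist y y'" using lip by simp
  qed
  then show ?thesis using \<delta>2 \<delta>1 \<tau>' by (intro exI[of _ \<delta>2] exI[of _ \<tau>'] conjI exI[of _ B] exI[of _ "8 * B 1 / c"]) auto
qed

section \<open>Jets and mollification\<close>

lemma smooth_jet_UNIV_iff:
  "smooth_jet UNIV g D \<longleftrightarrow> (\<forall>x. D 0 x [] = g x) \<and>
    (\<forall>vs x. ((\<lambda>y. D (length vs) y vs) has_derivative (\<lambda>v. D (Suc (length vs)) x (v # vs))) (at x))"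
  by (auto simp: smooth_jet_def)

lemma smooth_jet_continuous:
  assumes "smooth_jet UNIV g D"
  shows "continuous_on UNIV (\<lambda>y. D (length vs) y vs)"
  using assms unfolding smooth_jet_UNIV_iff
  by (intro has_derivative_continuous_on) auto

lemma smooth_jet_sum:
  assumes "\<And>i. i \<in> I \<Longrightarrow> smooth_jet UNIV (g i) (D i)"
  shows "smooth_jet UNIV (\<lambda>x. \<Sum>i\<in>I. a i * g i x) (\<lambda>k x vs. \<Sum>i\<in>I. a i * D i k x vs)"
  unfolding smooth_jet_UNIV_iff
proof (intro conjI allI)
  show "(\<Sum>i\<in>I. a i * D i 0 x []) = (\<Sum>i\<in>I. a i * g i x)" for x
    using assms by (intro sum.cong) (auto simp: smooth_jet_UNIV_iff)
  show "((\<lambda>y. \<Sum>i\<in>I. a i * D i (length vs) y vs) has_derivative (\<lambda>v. \<Sum>i\<in>I. a i * D i (Suc (length vs)) x (v # vs))) (at x)" for x vs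
    using assms by (intro has_derivative_sum has_derivative_mult_right) (auto simp: smooth_jet_UNIV_iff)
qed

lemma smooth_jet_diff:
  assumes "smooth_jet UNIV g D" "smooth_jet UNIV h E"
  shows "smooth_jet UNIV (\<lambda>x. g x - h x) (\<lambda>k x vs. D k x vs - E k x vs)"
  using assms unfolding smooth_jet_UNIV_iff by (auto intro: has_derivative_diff)

text \<open>For lists of directions the Leibniz rule is a plain sum over all ways to hand each
  direction to one of the two factors, without binomial coefficients.\<close>

fun splits :: "'a list \<Rightarrow> ('a list \<times> 'a list) list" where
  "splits [] = [([], [])]"
| "splits (v # vs) = map (\<lambda>p. (v # fst p, snd p)) (splits vs) @ map (\<lambda>p. (fst p, v # snd p)) (splits vs)"

definition prod_jet :: "(nat \<Rightarrow> 'a \<Rightarrow> 'a list \<Rightarrow> real) \<Rightarrow> (nat \<Rightarrow> 'a \<Rightarrow> 'a list \<Rightarrow> real) \<Rightarrow> nat \<Rightarrow> 'a \<Rightarrow> 'a list \<Rightarrow> real" where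
  "prod_jet D E k x vs = (\<Sum>p\<leftarrow>splits vs. D (length (fst p)) x (fst p) * E (length (snd p)) x (snd p))"

lemma has_derivative_sum_list:
  assumes "\<And>p. p \<in> set ps \<Longrightarrow> (F p has_derivative F' p) (at x)"
  shows "((\<lambda>y. \<Sum>p\<leftarrow>ps. F p y :: real) has_derivative (\<lambda>v. \<Sum>p\<leftarrow>ps. F' p v)) (at x)"
  using assms by (induction ps) (auto intro: has_derivative_add)

lemma sum_list_map_add:
  "(\<Sum>p\<leftarrow>ps. f p + g p :: real) = (\<Sum>p\<leftarrow>ps. f p) + (\<Sum>p\<leftarrow>ps. g p)"
  by (induction ps) auto

lemma smooth_jet_prod:
  fixes g h :: "'a::euclidean_space \<Rightarrow> real"
  assumes D: "smooth_jet UNIV g D" and E: "smooth_jet UNIV h E"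
  shows "smooth_jet UNIV (\<lambda>x. g x * h x) (prod_jet D E)"
  unfolding smooth_jet_UNIV_iff
proof (intro conjI allI)
  show "prod_jet D E 0 x [] = g x * h x" for x
    using D E by (simp add: prod_jet_def smooth_jet_UNIV_iff)
  fix x :: 'a and vs
  have "((\<lambda>y. \<Sum>p\<leftarrow>splits vs. D (length (fst p)) y (fst p) * E (length (snd p)) y (snd p)) has_derivative
     (\<lambda>v. \<Sum>p\<leftarrow>splits vs. D (length (fst p)) x (fst p) * E (Suc (length (snd p))) x (v # snd p)
        + D (Suc (length (fst p))) x (v # fst p) * E (length (snd p)) x (snd p))) (at x)"
    using D E by (intro has_derivative_sum_list has_derivative_mult) (auto simp: smooth_jet_UNIV_iff)
  then show "((\<lambda>y. prod_jet D E (length vs) y vs) has_derivative (\<lambda>v. prod_jet D E (Suc (length vs)) x (v # vs))) (at x)"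
    by (simp add: prod_jet_def sum_list_map_add o_def add.commute)
qed

definition bsmooth :: "('a::euclidean_space \<Rightarrow> real) \<Rightarrow> (nat \<Rightarrow> 'a \<Rightarrow> 'a list \<Rightarrow> real) \<Rightarrow> bool" where
  "bsmooth g D \<longleftrightarrow> smooth_jet UNIV g D \<and> (\<forall>vs. \<exists>B. \<forall>x. \<bar>D (length vs) x vs\<bar> \<le> B)"

lemma bsmooth_prod:
  assumes "bsmooth g D" "bsmooth h E"
  shows "bsmooth (\<lambda>x. g x * h x) (prod_jet D E)"
  unfolding bsmooth_def
proof (intro conjI allI)
  show "smooth_jet UNIV (\<lambda>x. g x * h x) (prod_jet D E)"
    using assms by (intro smooth_jet_prod) (auto simp: bsmooth_def)
  fix vs
  have "\<exists>B. \<forall>x. \<bar>\<Sum>p\<leftarrow>ps. D (length (fst p)) x (fst p) * E (length (snd p)) x (snd p)\<bar> \<le> B" for ps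
  proof (induction ps)
    case Nil
    show ?case by auto
  next
    case (Cons p ps)
    then obtain B where B: "\<And>x. \<bar>\<Sum>p\<leftarrow>ps. D (length (fst p)) x (fst p) * E (length (snd p)) x (snd p)\<bar> \<le> B" by blast
    obtain B1 where B1: "\<And>x. \<bar>D (length (fst p)) x (fst p)\<bar> \<le> B1" using assms(1) unfolding bsmooth_def by blast
    obtain B2 where B2: "\<And>x. \<bar>E (length (snd p)) x (snd p)\<bar> \<le> B2" using assms(2) unfolding bsmooth_def by blast
    have "\<bar>D (length (fst p)) x (fst p) * E (length (snd p)) x (snd p)\<bar> \<le> B1 * B2" for x
      unfolding abs_mult by (rule mult_mono[OF B1 B2]) (use B1[of x] in linarith, simp)
    then have "\<bar>\<Sum>p\<leftarrow>(p # ps). D (length (fst p)) x (fst p) * E (length (snd p)) x (snd p)\<bar> \<le> B1 * B2 + B" for x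
      using B[of x] by (simp add: abs_triangle_ineq[THEN order_trans] add_mono)
    then show ?case by blast
  qed
  then show "\<exists>B. \<forall>x. \<bar>prod_jet D E (length vs) x vs\<bar> \<le> B" by (simp add: prod_jet_def)
qed

lemma bsmooth_const: "bsmooth (\<lambda>_. a) (\<lambda>k x vs. if k = 0 then a else 0)"
  unfolding bsmooth_def smooth_jet_UNIV_iff
  by (auto intro: exI[of _ "\<bar>a\<bar>"])

lemma bsmooth_ridge:
  fixes \<phi> :: "nat \<Rightarrow> real \<Rightarrow> real" and b :: "'a::euclidean_space"
  assumes \<phi>: "jets_on UNIV \<phi>" and bd: "\<And>k. \<exists>B. \<forall>t. \<bar>\<phi> k t\<bar> \<le> B"
  shows "bsmooth (\<lambda>z. \<phi> 0 (z \<bullet> b)) (\<lambda>k z vs. \<phi> k (z \<bullet> b) * (\<Prod>v\<leftarrow>vs. v \<bullet> b))"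
  unfolding bsmooth_def smooth_jet_UNIV_iff
proof (intro conjI allI)
  show "\<phi> 0 (x \<bullet> b) * (\<Prod>v\<leftarrow>[]. v \<bullet> b) = \<phi> 0 (x \<bullet> b)" for x by simp
  fix vs :: "'a list"
  show "((\<lambda>z. \<phi> (length vs) (z \<bullet> b) * (\<Prod>v\<leftarrow>vs. v \<bullet> b)) has_derivative
      (\<lambda>v. \<phi> (Suc (length vs)) (x \<bullet> b) * (\<Prod>v\<leftarrow>v # vs. v \<bullet> b))) (at x)" for x
  proof -
    have "(\<phi> (length vs) has_derivative (\<lambda>h. h * \<phi> (Suc (length vs)) (x \<bullet> b))) (at (x \<bullet> b))"
      using jets_onD[OF \<phi>, of "x \<bullet> b" "length vs"] by (simp add: has_vector_derivative_def)
    from has_derivative_compose[OF has_derivative_inner_left[OF has_derivative_ident] this]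
    have "((\<lambda>z. \<phi> (length vs) (z \<bullet> b)) has_derivative (\<lambda>v. (v \<bullet> b) * \<phi> (Suc (length vs)) (x \<bullet> b))) (at x)" .
    from has_derivative_mult_left[OF this, of "\<Prod>v\<leftarrow>vs. v \<bullet> b"] show ?thesis by (simp add: mult_ac)
  qed
  obtain B where B: "\<And>t. \<bar>\<phi> (length vs) t\<bar> \<le> B" using bd by blast
  show "\<exists>B. \<forall>x. \<bar>\<phi> (length vs) (x \<bullet> b) * (\<Prod>v\<leftarrow>vs. v \<bullet> b)\<bar> \<le> B"
    by (intro exI[of _ "B * \<bar>\<Prod>v\<leftarrow>vs. v \<bullet> b\<bar>"] allI) (simp add: abs_mult B mult_right_mono)
qed

lemma bsmooth_prod_ridges:
  fixes \<phi> :: "'a::euclidean_space \<Rightarrow> nat \<Rightarrow> real \<Rightarrow> real"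
  assumes "finite S" "\<And>b. jets_on UNIV (\<phi> b)" "\<And>b k. \<exists>B. \<forall>t. \<bar>\<phi> b k t\<bar> \<le> B"
  shows "\<exists>D. bsmooth (\<lambda>z. \<Prod>b\<in>S. \<phi> b 0 (z \<bullet> b)) D"
  using assms(1)
proof (induction S rule: finite_induct)
  case empty
  show ?case using bsmooth_const[of 1] by auto
next
  case (insert b S)
  then obtain D where "bsmooth (\<lambda>z. \<Prod>b\<in>S. \<phi> b 0 (z \<bullet> b)) D" by blast
  from bsmooth_prod[OF bsmooth_ridge[OF assms(2,3)] this] insert(1,2) show ?case by auto
qed

text \<open>The weight for averaging over the directions of a cone, which is why it is centred at
  \<open>e\<close> and not at 0. It is a normalised product of one-dimensional cutoffs in the
  coordinates.\<close>

lemma bump_exists: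
  fixes e :: "'a::euclidean_space"
  assumes D: "jets_on UNIV D" "\<And>k. \<exists>B. \<forall>t. \<bar>D k t\<bar> \<le> B" "\<forall>t. 0 \<le> D 0 t \<and> D 0 t \<le> (1::real)"
      "\<forall>t. \<bar>t\<bar> \<le> 3/4 \<longrightarrow> D 0 t = 1" "\<forall>t. \<bar>t\<bar> \<ge> 9/4 \<longrightarrow> D 0 t = 0" and c: "c > 0"
  shows "\<exists>\<psi> J lo hi. bsmooth \<psi> J \<and> (\<forall>z. \<psi> z \<ge> 0) \<and> cbox lo hi \<subseteq> ball e c \<and> (\<forall>z. z \<notin> cbox lo hi \<longrightarrow> \<psi> z = 0) \<and>
    integral (cbox lo hi) \<psi> = 1"
proof -
  \<comment> \<open>A cube of half-width \<open>r\<close> lies in the ball because the sum norm is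
    at most \<open>DIM('a) * r = c/2\<close>. The scaling by \<open>3 / r\<close> below sends the
    support bound 9/4 to \<open>3/4 * r\<close> and the plateau 3/4 to \<open>r/4\<close>.\<close>
  define r where "r = c / (2 * real DIM('a))"
  have r: "r > 0" using c by (simp add: r_def)
  define \<phi> where "\<phi> = (\<lambda>b k t. (3 / r) ^ k *\<^sub>R D k ((3 / r) * t + (- 3 / r * (e \<bullet> b))))"
  have \<phi>0: "\<phi> b 0 (z \<bullet> b) = D 0 (3 / r * ((z - e) \<bullet> b))" for b z by (simp add: \<phi>_def inner_diff_left algebra_simps)
  have "jets_on UNIV (\<phi> b)" for b unfolding \<phi>_def by (rule jets_on_affine[OF D(1)]) simp
  moreover have "\<exists>B. \<forall>t. \<bar>\<phi> b k t\<bar> \<le> B" for b k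
  proof -
    obtain B where "\<And>t. \<bar>D k t\<bar> \<le> B" using D(2) by blast
    then show ?thesis using r by (intro exI[of _ "(3 / r) ^ k * B"]) (auto simp: \<phi>_def abs_mult)
  qed
  ultimately obtain J where J: "bsmooth (\<lambda>z. \<Prod>b\<in>Basis. \<phi> b 0 (z \<bullet> b)) J"
    using bsmooth_prod_ridges[of Basis \<phi>] by auto
  define \<psi>0 where "\<psi>0 = (\<lambda>z. \<Prod>b\<in>Basis. \<phi> b 0 (z \<bullet> b))"
  define lo where "lo = e - r *\<^sub>R One"
  define hi where "hi = e + r *\<^sub>R One"
  have mem: "z \<in> cbox (e - s *\<^sub>R One) (e + s *\<^sub>R One) \<longleftrightarrow> (\<forall>b\<in>Basis. \<bar>(z - e) \<bullet> b\<bar> \<le> s)" for z s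
    by (auto simp: mem_box inner_diff_left inner_add_left abs_le_iff algebra_simps)
  have nn: "\<psi>0 z \<ge> 0" for z unfolding \<psi>0_def \<phi>0 using D(3) by (intro prod_nonneg) auto
  have supp: "\<psi>0 z = 0" if z: "z \<notin> cbox lo hi" for z
  proof -
    obtain b where b: "b \<in> Basis" "\<bar>(z - e) \<bullet> b\<bar> > r" using z mem[of z r] unfolding lo_def hi_def by (meson not_le)
    have "\<bar>3 / r * ((z - e) \<bullet> b)\<bar> \<ge> 9/4" using b(2) r by (simp add: abs_mult field_simps)
    then have "\<phi> b 0 (z \<bullet> b) = 0" using D(5) by (simp add: \<phi>0)
    then show ?thesis unfolding \<psi>0_def using b(1) by (intro prod_zero) auto
  qed
  have one: "\<psi>0 z = 1" if "z \<in> cbox (e - (r/4) *\<^sub>R One) (e + (r/4) *\<^sub>R One)" for z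
  proof -
    have "\<phi> b 0 (z \<bullet> b) = 1" if "b \<in> Basis" for b
    proof -
      have "\<bar>(z - e) \<bullet> b\<bar> \<le> r/4" using mem \<open>z \<in> cbox _ _\<close> that by blast
      then have "\<bar>3 / r * ((z - e) \<bullet> b)\<bar> \<le> 3/4" using r by (simp add: abs_mult field_simps)
      then show ?thesis using D(4) by (simp add: \<phi>0)
    qed
    then show ?thesis by (simp add: \<psi>0_def)
  qed
  have "smooth_jet UNIV \<psi>0 J" using J by (simp add: bsmooth_def \<psi>0_def)
  then have cont: "continuous_on UNIV \<psi>0"
    using smooth_jet_continuous[of \<psi>0 J "[]"] by (simp add: smooth_jet_UNIV_iff)
  have int: "\<psi>0 integrable_on cbox u v" for u v
    using cont by (intro integrable_continuous) (meson continuous_on_subset subset_UNIV)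
  let ?S = "cbox (e - (r/4) *\<^sub>R One) (e + (r/4) *\<^sub>R One)"
  have "integral ?S \<psi>0 = integral ?S (\<lambda>_. 1)" by (rule integral_cong) (use one in auto)
  also have "\<dots> = measure lborel ?S" by simp
  also have "\<dots> > 0" using r by (subst content_pos_lt_eq) (auto simp: inner_diff_left inner_add_left)
  finally have "integral ?S \<psi>0 > 0" .
  moreover have "integral ?S \<psi>0 \<le> integral (cbox lo hi) \<psi>0"
  proof (rule integral_subset_le[OF _ int int])
    show "?S \<subseteq> cbox lo hi"
    proof
      fix z assume "z \<in> ?S"
      then show "z \<in> cbox lo hi" unfolding lo_def hi_def mem using r by force
    qed
  qed (use nn in auto)
  ultimately have I: "integral (cbox lo hi) \<psi>0 > 0" by linarith
  define a where "a = 1 / integral (cbox lo hi) \<psi>0"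
  have a: "a > 0" using I by (simp add: a_def)
  have "bsmooth (\<lambda>z. a * \<psi>0 z) (prod_jet (\<lambda>k x vs. if k = 0 then a else 0) J)"
    using J by (intro bsmooth_prod bsmooth_const) (simp add: \<psi>0_def)
  moreover have "integral (cbox lo hi) (\<lambda>z. a * \<psi>0 z) = 1" using I by (simp add: a_def)
  moreover have "cbox lo hi \<subseteq> ball e c"
  proof
    fix z assume "z \<in> cbox lo hi"
    then have "\<forall>b\<in>Basis. \<bar>(z - e) \<bullet> b\<bar> \<le> r" using mem[of z r] by (simp add: lo_def hi_def)
    then have "norm (z - e) \<le> (\<Sum>b\<in>(Basis::'a set). r)" by (intro order_trans[OF norm_le_l1] sum_mono) auto
    also have "\<dots> = c/2" by (simp add: r_def)
    finally show "z \<in> ball e c" using c by (simp add: dist_norm norm_minus_commute)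
  qed
  ultimately show ?thesis using nn a supp
    by (intro exI[of _ "\<lambda>z. a * \<psi>0 z"] exI[of _ "prod_jet (\<lambda>k x vs. if k = 0 then a else 0) J"] exI[of _ lo] exI[of _ hi]) auto
qed

text \<open>\<open>u\<close> is merely continuous, so the derivative has to fall on the kernel;
  hence the form \<open>p ((1/s) *\<^sub>R (w - y))\<close> instead of
  \<open>u (y + s *\<^sub>R z)\<close>. The detour over \<open>Blinfun\<close> serves
  \<open>leibniz_rule\<close>, which wants a continuous operator-valued derivative.\<close>

lemma convolution_has_derivative:
  fixes p :: "'a::euclidean_space \<Rightarrow> real"
  assumes p: "\<And>z. (p has_derivative p' z) (at z)" and p': "\<And>v. continuous_on UNIV (\<lambda>z. p' z v)"
    and u: "continuous_on UNIV u"
  shows "((\<lambda>y. integral (cbox A B) (\<lambda>w. u w * p ((1/s) *\<^sub>R (w - y)))) has_derivative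
     (\<lambda>v. integral (cbox A B) (\<lambda>w. (-1/s) * (u w * p' ((1/s) *\<^sub>R (w - y)) v)))) (at y)"
proof -
  define fx where "fx = (\<lambda>y w. Blinfun (\<lambda>v. (-1/s) * (u w * p' ((1/s) *\<^sub>R (w - y)) v)))"
  have lin: "bounded_linear (p' z)" for z using p by (rule has_derivative_bounded_linear)
  have fx: "blinfun_apply (fx y w) v = (-1/s) * (u w * p' ((1/s) *\<^sub>R (w - y)) v)" for y w v
  proof -
    have "bounded_linear (\<lambda>v. (-1/s) * (u w * p' ((1/s) *\<^sub>R (w - y)) v))"
      by (intro bounded_linear_const_mult lin)
    from bounded_linear_Blinfun_apply[OF this] show ?thesis by (simp add: fx_def)
  qed
  have pc: "continuous_on UNIV p" using p by (intro has_derivative_continuous_on) auto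
  have c1: "continuous_on (UNIV \<times> cbox A B) (\<lambda>(x, t). fx x t)"
  proof (rule continuous_on_blinfun_componentwise)
    fix i :: 'a
    have "continuous_on (UNIV \<times> cbox A B) (\<lambda>q. (-1/s) * (u (snd q) * p' ((1/s) *\<^sub>R (snd q - fst q)) i))"
      by (intro continuous_intros continuous_on_compose2[OF u] continuous_on_compose2[OF p']) auto
    then show "continuous_on (UNIV \<times> cbox A B) (\<lambda>q. blinfun_apply (case q of (x, t) \<Rightarrow> fx x t) i)"
      by (simp add: case_prod_beta fx)
  qed
  have "((\<lambda>y. integral (cbox A B) (\<lambda>w. u w * p ((1/s) *\<^sub>R (w - y)))) has_derivative
     blinfun_apply (integral (cbox A B) (fx y))) (at y within UNIV)"
  proof (rule leibniz_rule[OF _ _ c1])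
    fix x t :: 'a
    have "((\<lambda>x. (1/s) *\<^sub>R (t - x)) has_derivative (\<lambda>v. (1/s) *\<^sub>R (0 - v))) (at x)"
      by (intro derivative_intros)
    from has_derivative_mult_right[OF has_derivative_compose[OF this p], of "u t"]
    have "((\<lambda>x. u t * p ((1/s) *\<^sub>R (t - x))) has_derivative (\<lambda>v. u t * p' ((1/s) *\<^sub>R (t - x)) ((1/s) *\<^sub>R (0 - v)))) (at x)" .
    moreover have "(\<lambda>v. u t * p' ((1/s) *\<^sub>R (t - x)) ((1/s) *\<^sub>R (0 - v))) = blinfun_apply (fx x t)"
    proof
      fix v
      have "p' ((1/s) *\<^sub>R (t - x)) ((-1/s) *\<^sub>R v) = (-1/s) * p' ((1/s) *\<^sub>R (t - x)) v"
        using bounded_linear.linear[OF lin] by (subst linear_scale) auto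
      then show "u t * p' ((1/s) *\<^sub>R (t - x)) ((1/s) *\<^sub>R (0 - v)) = blinfun_apply (fx x t) v"
        by (simp add: fx)
    qed
    ultimately show "((\<lambda>x. u t * p ((1/s) *\<^sub>R (t - x))) has_derivative blinfun_apply (fx x t)) (at x within UNIV)" by simp
  next
    fix x :: 'a
    show "(\<lambda>w. u w * p ((1/s) *\<^sub>R (w - x))) integrable_on cbox A B"
      by (intro integrable_continuous continuous_intros continuous_on_compose2[OF u] continuous_on_compose2[OF pc]) auto
  qed auto
  moreover have "blinfun_apply (integral (cbox A B) (fx y)) v = integral (cbox A B) (\<lambda>w. (-1/s) * (u w * p' ((1/s) *\<^sub>R (w - y)) v))" for v
  proof -
    have "continuous_on (cbox A B) (fx y)"
    proof -
      have "continuous_on (cbox A B) (\<lambda>t. (y, t))" by (intro continuous_on_Pair continuous_on_const continuous_on_id)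
      from continuous_on_compose2[OF c1 this] show ?thesis by auto
    qed
    then have "fx y integrable_on cbox A B" by (rule integrable_continuous)
    from blinfun_apply_integral[OF this, of v] show ?thesis by (simp add: fx)
  qed
  then have "blinfun_apply (integral (cbox A B) (fx y)) = (\<lambda>v. integral (cbox A B) (\<lambda>w. (-1/s) * (u w * p' ((1/s) *\<^sub>R (w - y)) v)))"
    by (rule ext)
  ultimately show ?thesis by (simp only:)
qed

text \<open>Jet of the weighted mean of \<open>u (y + s *\<^sub>R z)\<close> over \<open>z\<close>
  after the substitution \<open>w = y + s *\<^sub>R z\<close>: it produces
  \<open>(1/s) ^ DIM('a)\<close>, and each differentiation in \<open>y\<close> a factor
  \<open>-1/s\<close>. The fixed box must contain all \<open>w\<close> with nonzero weight, as
  \<open>moll_jet_value\<close> demands.\<close>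

definition moll_jet :: "(nat \<Rightarrow> 'a::euclidean_space \<Rightarrow> 'a list \<Rightarrow> real) \<Rightarrow> 'a \<Rightarrow> 'a \<Rightarrow> real \<Rightarrow> ('a \<Rightarrow> real) \<Rightarrow>
    nat \<Rightarrow> 'a \<Rightarrow> 'a list \<Rightarrow> real" where
  "moll_jet J A B s u k y vs =
    (1/s) ^ DIM('a) * (-1/s) ^ k * integral (cbox A B) (\<lambda>w. u w * J k ((1/s) *\<^sub>R (w - y)) vs)"

lemma moll_jet_smooth:
  fixes u :: "'a::euclidean_space \<Rightarrow> real"
  assumes J: "smooth_jet UNIV \<psi> J" and u: "continuous_on UNIV u"
  shows "smooth_jet UNIV (\<lambda>y. moll_jet J A B s u 0 y []) (moll_jet J A B s u)"
  unfolding smooth_jet_UNIV_iff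
proof (intro conjI allI refl)
  fix vs :: "'a list" and y :: 'a
  let ?k = "length vs"
  have "((\<lambda>y. integral (cbox A B) (\<lambda>w. u w * J ?k ((1/s) *\<^sub>R (w - y)) vs)) has_derivative
     (\<lambda>v. integral (cbox A B) (\<lambda>w. (-1/s) * (u w * J (Suc ?k) ((1/s) *\<^sub>R (w - y)) (v # vs))))) (at y)"
  proof (rule convolution_has_derivative[OF _ _ u])
    show "((\<lambda>z. J ?k z vs) has_derivative (\<lambda>v. J (Suc ?k) z (v # vs))) (at z)" for z
      using J unfolding smooth_jet_UNIV_iff by blast
    show "continuous_on UNIV (\<lambda>z. J (Suc ?k) z (v # vs))" for v
      using smooth_jet_continuous[OF J, of "v # vs"] by simp
  qed
  from has_derivative_mult_right[OF this, of "(1/s) ^ DIM('a) * (-1/s) ^ ?k"]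
  show "((\<lambda>y. moll_jet J A B s u ?k y vs) has_derivative (\<lambda>v. moll_jet J A B s u (Suc ?k) y (v # vs))) (at y)"
    by (simp add: moll_jet_def mult_ac)
qed

lemma moll_jet_bound:
  fixes J :: "nat \<Rightarrow> 'a::euclidean_space \<Rightarrow> 'a list \<Rightarrow> real"
  assumes J: "bsmooth \<psi> J"
  shows "\<exists>C\<ge>0. \<forall>s u y U. s > 0 \<longrightarrow> continuous_on UNIV u \<longrightarrow> (\<forall>w\<in>cbox A B. \<bar>u w\<bar> \<le> U) \<longrightarrow> U \<ge> 0 \<longrightarrow>
    \<bar>moll_jet J A B s u (length vs) y vs\<bar> \<le> C * U * (1/s) ^ (DIM('a) + length vs)"
proof -
  obtain K where K: "\<And>z. \<bar>J (length vs) z vs\<bar> \<le> K" using J unfolding bsmooth_def by blast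
  have K0: "K \<ge> 0" using K[of 0] by linarith
  let ?C = "K * measure lborel (cbox A B)"
  have "\<bar>moll_jet J A B s u (length vs) y vs\<bar> \<le> ?C * U * (1/s) ^ (DIM('a) + length vs)"
    if s: "s > 0" and u: "continuous_on UNIV u" and U: "\<forall>w\<in>cbox A B. \<bar>u w\<bar> \<le> U" "U \<ge> 0" for s u y U
  proof -
    have "norm (integral (cbox A B) (\<lambda>w. u w * J (length vs) ((1/s) *\<^sub>R (w - y)) vs)) \<le> integral (cbox A B) (\<lambda>w. U * K)"
    proof (rule integral_norm_bound_integral)
      have "continuous_on UNIV (\<lambda>z. J (length vs) z vs)" using J by (intro smooth_jet_continuous[of \<psi>]) (simp add: bsmooth_def)
      then show "(\<lambda>w. u w * J (length vs) ((1/s) *\<^sub>R (w - y)) vs) integrable_on cbox A B"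
        by (intro integrable_continuous continuous_intros continuous_on_compose2[OF u]
          continuous_on_compose2[where f = "\<lambda>w. (1/s) *\<^sub>R (w - y)" and g = "\<lambda>z. J (length vs) z vs"]) auto
      show "norm (u w * J (length vs) ((1/s) *\<^sub>R (w - y)) vs) \<le> U * K" if "w \<in> cbox A B" for w
        unfolding real_norm_def abs_mult using U that K by (intro mult_mono) auto
    qed auto
    also have "\<dots> = ?C * U" by (simp add: mult_ac)
    finally have i: "\<bar>integral (cbox A B) (\<lambda>w. u w * J (length vs) ((1/s) *\<^sub>R (w - y)) vs)\<bar> \<le> ?C * U" by simp
    have "\<bar>moll_jet J A B s u (length vs) y vs\<bar> = (1/s) ^ (DIM('a) + length vs) *
        \<bar>integral (cbox A B) (\<lambda>w. u w * J (length vs) ((1/s) *\<^sub>R (w - y)) vs)\<bar>"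
      using s by (simp add: moll_jet_def abs_mult power_abs power_add)
    also have "\<dots> \<le> (1/s) ^ (DIM('a) + length vs) * (?C * U)" using i s by (intro mult_left_mono) auto
    finally show ?thesis by (simp add: mult_ac)
  qed
  then show ?thesis using K0 by (intro exI[of _ ?C]) auto
qed

lemma moll_jet_value:
  fixes u :: "'a::euclidean_space \<Rightarrow> real"
  assumes J: "smooth_jet UNIV \<psi> J" and u: "continuous_on UNIV u" and s: "s > 0"
    and supp: "\<And>z. z \<notin> cbox lo hi \<Longrightarrow> \<psi> z = 0"
    and sub: "\<And>z. z \<in> cbox lo hi \<Longrightarrow> y + s *\<^sub>R z \<in> cbox A B"
  shows "moll_jet J A B s u 0 y [] = integral (cbox lo hi) (\<lambda>z. u (y + s *\<^sub>R z) * \<psi> z)"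
proof -
  have J0: "J 0 z [] = \<psi> z" for z using J by (simp add: smooth_jet_UNIV_iff)
  have \<psi>c: "continuous_on UNIV \<psi>" using smooth_jet_continuous[OF J, of "[]"] by (simp add: J0)
  let ?f = "\<lambda>w. u w * \<psi> ((1/s) *\<^sub>R (w - y))"
  have "?f integrable_on cbox A B"
    by (intro integrable_continuous continuous_intros continuous_on_compose2[OF u] continuous_on_compose2[OF \<psi>c]) auto
  then have "(?f has_integral integral (cbox A B) ?f) (cbox A B)" by (rule integrable_integral)
  from has_integral_affinity[OF this, of s y] s
  have 1: "((\<lambda>z. u (y + s *\<^sub>R z) * \<psi> z) has_integral (1/s) ^ DIM('a) * integral (cbox A B) ?f)
    ((\<lambda>x. (1 / s) *\<^sub>R x + - ((1 / s) *\<^sub>R y)) ` cbox A B)"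
    by (simp add: add.commute power_one_over)
  have "(\<lambda>z. u (y + s *\<^sub>R z) * \<psi> z) integrable_on cbox lo hi"
    by (intro integrable_continuous continuous_intros continuous_on_compose2[OF u] continuous_on_compose2[OF \<psi>c]) auto
  then have "((\<lambda>z. u (y + s *\<^sub>R z) * \<psi> z) has_integral integral (cbox lo hi) (\<lambda>z. u (y + s *\<^sub>R z) * \<psi> z)) (cbox lo hi)"
    by (rule integrable_integral)
  then have "((\<lambda>z. u (y + s *\<^sub>R z) * \<psi> z) has_integral integral (cbox lo hi) (\<lambda>z. u (y + s *\<^sub>R z) * \<psi> z))
    ((\<lambda>x. (1 / s) *\<^sub>R x + - ((1 / s) *\<^sub>R y)) ` cbox A B)"
  proof (rule has_integral_on_superset)
    show "cbox lo hi \<subseteq> (\<lambda>x. (1 / s) *\<^sub>R x + - ((1 / s) *\<^sub>R y)) ` cbox A B"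
    proof
      fix z assume "z \<in> cbox lo hi"
      then show "z \<in> (\<lambda>x. (1 / s) *\<^sub>R x + - ((1 / s) *\<^sub>R y)) ` cbox A B"
        using s by (intro rev_image_eqI[OF sub]) (auto simp: scaleR_add_right)
    qed
  qed (use supp in auto)
  from has_integral_unique[OF this 1] show ?thesis by (simp add: moll_jet_def J0)
qed

section \<open>Smooth extension\<close>

lemma alternating_binomial_step:
  fixes z :: "nat \<Rightarrow> real"
  shows "(\<Sum>j\<le>Suc n. (-1) ^ j * real (Suc n choose j) * z j)
    = (\<Sum>j\<le>n. (-1) ^ j * real (n choose j) * z j) - (\<Sum>j\<le>n. (-1) ^ j * real (n choose j) * z (Suc j))"
proof -
  have "(\<Sum>j\<le>Suc n. (-1) ^ j * real (Suc n choose j) * z j) = (\<Sum>i\<le>Suc n. real (Suc n choose i) * ((-1) ^ i * z i) * 1)"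
    by (intro sum.cong refl) simp
  also have "\<dots> = (\<Sum>i\<le>n. real (n choose i) * ((-1) ^ Suc i * z (Suc i) * 1 + (-1) ^ i * z i * 1))"
    by (rule pascal_sum[of n "\<lambda>i. (-1) ^ i * z i" "\<lambda>_. 1", symmetric])
  also have "\<dots> = (\<Sum>j\<le>n. (-1) ^ j * real (n choose j) * z j - (-1) ^ j * real (n choose j) * z (Suc j))"
    by (intro sum.cong refl) (simp add: algebra_simps)
  also have "\<dots> = (\<Sum>j\<le>n. (-1) ^ j * real (n choose j) * z j) - (\<Sum>j\<le>n. (-1) ^ j * real (n choose j) * z (Suc j))"
    by (rule sum_subtractf)
  finally show ?thesis .
qed

text \<open>Up to sign a finite difference of order \<open>n\<close> of a power of lower degree. In
  the induction step the difference of order \<open>n\<close> has derivative 0 in \<open>x\<close>,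
  by the induction hypothesis for degree \<open>i - 1\<close>, so it is constant and its own
  difference vanishes.\<close>

lemma alternating_binomial_power:
  fixes x h :: real
  assumes "i < n"
  shows "(\<Sum>j\<le>n. (-1) ^ j * real (n choose j) * (x + real j * h) ^ i) = 0"
  using assms
proof (induction n arbitrary: i x)
  case (Suc n)
  let ?S = "\<lambda>x. \<Sum>j\<le>n. (-1) ^ j * real (n choose j) * (x + real j * h) ^ i"
  have d: "(?S has_real_derivative (\<Sum>j\<le>n. (-1) ^ j * real (n choose j) * (real i * (x + real j * h) ^ (i - 1)))) (at x)" for x
    by (intro DERIV_sum DERIV_cmult) (auto intro!: derivative_eq_intros)
  have zero: "(\<Sum>j\<le>n. (-1) ^ j * real (n choose j) * (real i * (x + real j * h) ^ (i - 1))) = 0" for x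
  proof (cases "i = 0")
    case False
    then have "(\<Sum>j\<le>n. (-1) ^ j * real (n choose j) * (x + real j * h) ^ (i - 1)) = 0"
      using Suc by simp
    then have "real i * (\<Sum>j\<le>n. (-1) ^ j * real (n choose j) * (x + real j * h) ^ (i - 1)) = 0" by simp
    then show ?thesis by (simp add: sum_distrib_left mult_ac)
  qed simp
  have "(?S has_real_derivative 0) (at x)" for x using d[of x] unfolding zero .
  then have "?S x = ?S (x + h)" by (intro DERIV_isconst_all allI)
  moreover have "x + real (Suc j) * h = x + h + real j * h" for j by (simp add: algebra_simps)
  ultimately show ?case unfolding alternating_binomial_step[of n "\<lambda>j. (x + real j * h) ^ i"] by (simp only:)
qed simp

text \<open>The value at 0 of the polynomial of degree below \<open>m\<close> through the values of
  \<open>q\<close> at \<open>h\<close>, ..., \<open>m * h\<close>, read off from the vanishing of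
  its \<open>m\<close>-th finite difference. It evaluates \<open>q\<close> at positive arguments,
  where segments into the cone are in \<open>X\<close>.\<close>

definition extrap :: "nat \<Rightarrow> real \<Rightarrow> (real \<Rightarrow> real) \<Rightarrow> real" where
  "extrap m h q = (\<Sum>j\<in>{1..m}. (-1) ^ Suc j * real (m choose j) * q (real j * h))"

lemma extrap_polynomial:
  assumes "1 \<le> m'" "m \<le> m'"
  shows "extrap m' h (\<lambda>s. \<Sum>i<m. a i * (s - t) ^ i) = (\<Sum>i<m. a i * (0 - t) ^ i)"
proof -
  let ?T = "\<lambda>s. \<Sum>i<m. a i * (s - t) ^ i"
  have "(\<Sum>j\<le>m'. (-1) ^ j * real (m' choose j) * ?T (real j * h))
     = (\<Sum>j\<le>m'. \<Sum>i<m. a i * ((-1) ^ j * real (m' choose j) * (- t + real j * h) ^ i))"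
    by (simp add: sum_distrib_left mult_ac)
  also have "\<dots> = (\<Sum>i<m. \<Sum>j\<le>m'. a i * ((-1) ^ j * real (m' choose j) * (- t + real j * h) ^ i))"
    by (rule sum.swap)
  also have "\<dots> = (\<Sum>i<m. a i * (\<Sum>j\<le>m'. (-1) ^ j * real (m' choose j) * (- t + real j * h) ^ i))"
    by (simp add: sum_distrib_left)
  also have "\<dots> = 0" using assms alternating_binomial_power[of _ m' "-t" h] by (intro sum.neutral) auto
  finally have z: "(\<Sum>j\<le>m'. (-1) ^ j * real (m' choose j) * ?T (real j * h)) = 0" .
  have "(\<Sum>j\<le>m'. (-1) ^ j * real (m' choose j) * ?T (real j * h)) = ?T 0 - extrap m' h ?T"
    unfolding extrap_def
    by (subst atMost_atLeast0, subst sum.atLeast_Suc_atMost) (auto simp: sum_negf)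
  then show ?thesis using z by simp
qed

lemma extrap_weights_le:
  assumes "\<And>j. j \<in> {1..m} \<Longrightarrow> \<bar>q j\<bar> \<le> K" "K \<ge> 0"
  shows "\<bar>\<Sum>j\<in>{1..m}. (-1) ^ Suc j * real (m choose j) * q j\<bar> \<le> 2 ^ m * K"
proof -
  have "\<bar>\<Sum>j\<in>{1..m}. (-1) ^ Suc j * real (m choose j) * q j\<bar> \<le> (\<Sum>j\<in>{1..m}. real (m choose j) * K)"
    by (intro order_trans[OF sum_abs] sum_mono) (use assms(1) in \<open>auto simp: abs_mult power_abs intro!: mult_left_mono\<close>)
  also have "\<dots> \<le> (\<Sum>j\<le>m. real (m choose j) * K)" using assms(2) by (intro sum_mono2) auto
  also have "\<dots> = real (\<Sum>j\<le>m. m choose j) * K" by (simp add: sum_distrib_right)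
  also have "\<dots> = 2 ^ m * K" by (simp add: choose_row_sum)
  finally show ?thesis .
qed

text \<open>\<open>T\<close> is the value at 0 of the Taylor polynomial of degree below
  \<open>m\<close> at \<open>a\<close>, which every extrapolation of order at least \<open>m\<close>
  reproduces; what remains is the Taylor error at the nodes times \<open>2 ^ m'\<close>, a bound for
  the sum of the weights. The same \<open>T\<close> serves all \<open>m'\<close> and
  \<open>h\<close>, so two extrapolations can be compared although \<open>Q\<close> need not reach
  0.\<close>

lemma extrap_error:
  fixes Q :: "nat \<Rightarrow> real \<Rightarrow> real"
  assumes Q: "jets_on {a'<..<b'} Q" and ab: "a' < a" "b < b'" "0 \<le> a" "a \<le> b" and m: "1 \<le> m"
    and bd: "\<And>s. s \<in> {a'<..<b'} \<Longrightarrow> \<bar>Q m s\<bar> \<le> B"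
  shows "\<exists>T. \<forall>m' h. m \<le> m' \<and> a \<le> h \<and> real m' * h \<le> b \<longrightarrow> \<bar>extrap m' h (Q 0) - T\<bar> \<le> 2 ^ m' * (B * (real m' * h) ^ m)"
proof -
  define P where "P = (\<lambda>s. \<Sum>i<m. (Q i a / fact i) * (s - a) ^ i)"
  have B0: "B \<ge> 0" using bd[of a] ab by force
  have err: "\<bar>Q 0 s - P s\<bar> \<le> B * s ^ m" if s: "a \<le> s" "s \<le> b" for s
  proof (cases "s = a")
    case True
    have "P a = Q 0 a"
      unfolding P_def using m by (subst sum.remove[of _ 0]) (auto intro!: sum.neutral)
    then show ?thesis using True B0 ab by simp
  next
    case False
    have "\<exists>t. (if s < a then s < t \<and> t < a else a < t \<and> t < s) \<and>
      Q 0 s = (\<Sum>i<m. (Q i a / fact i) * (s - a) ^ i) + (Q m t / fact m) * (s - a) ^ m"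
    proof (rule Taylor[of m Q "Q 0" a b a s])
      show "\<forall>i t. i < m \<and> a \<le> t \<and> t \<le> b \<longrightarrow> DERIV (Q i) t :> Q (Suc i) t"
        using jets_onD[OF Q] ab by (auto simp: has_real_derivative_iff_has_vector_derivative)
    qed (use m s False ab in auto)
    then obtain t where t: "a < t" "t < s" "Q 0 s = P s + (Q m t / fact m) * (s - a) ^ m"
      using s by (auto simp: P_def)
    have "\<bar>Q m t\<bar> / fact m \<le> B / 1" using bd[of t] t s ab by (intro frac_le) auto
    then have "\<bar>Q m t\<bar> / fact m * (s - a) ^ m \<le> B * s ^ m"
      using s ab B0 by (intro mult_mono power_mono) auto
    then show ?thesis using t(3) s by (simp add: abs_mult)
  qed
  have "\<bar>extrap m' h (Q 0) - P 0\<bar> \<le> 2 ^ m' * (B * (real m' * h) ^ m)"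
    if h: "m \<le> m'" "a \<le> h" "real m' * h \<le> b" for m' h
  proof -
    have "extrap m' h (Q 0) - P 0 = extrap m' h (Q 0) - extrap m' h P"
      using extrap_polynomial[of m' m h "\<lambda>i. Q i a / fact i" a] m h by (simp add: P_def)
    also have "\<dots> = (\<Sum>j\<in>{1..m'}. (-1) ^ Suc j * real (m' choose j) * (Q 0 (real j * h) - P (real j * h)))"
      by (simp only: extrap_def sum_subtractf right_diff_distrib)
    finally have e: "extrap m' h (Q 0) - P 0 = (\<Sum>j\<in>{1..m'}. (-1) ^ Suc j * real (m' choose j) * (Q 0 (real j * h) - P (real j * h)))" .
    have h0: "h \<ge> 0" using h ab by simp
    show ?thesis unfolding e
    proof (rule extrap_weights_le)
      fix j assume j: "j \<in> {1..m'}"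
      have "a \<le> real j * h" using j h h0 mult_right_mono[of 1 "real j" h] by simp
      moreover have jm: "real j * h \<le> real m' * h" using j h0 by (intro mult_right_mono) auto
      ultimately have "\<bar>Q 0 (real j * h) - P (real j * h)\<bar> \<le> B * (real j * h) ^ m" using err h by simp
      also have "\<dots> \<le> B * (real m' * h) ^ m" using jm B0 h0 by (intro mult_left_mono power_mono) auto
      finally show "\<bar>Q 0 (real j * h) - P (real j * h)\<bar> \<le> B * (real m' * h) ^ m" .
    qed (use B0 h0 in simp)
  qed
  then show ?thesis by blast
qed

section \<open>Asymptotic scales in powers of two\<close>

lemma eventually_le_power2: "\<forall>\<^sub>F k in sequentially. (C::real) \<le> 2 ^ k"
proof -
  obtain n where n: "C < 2 ^ n" using real_arch_pow[of 2 C] by auto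
  have "C \<le> 2 ^ k" if "k \<ge> n" for k
  proof -
    have "(2::real) ^ n \<le> 2 ^ k" using that by (intro power_increasing) auto
    then show ?thesis using n by linarith
  qed
  then show ?thesis unfolding eventually_sequentially by blast
qed

lemma slow_sequence_exists:
  fixes b :: "nat \<Rightarrow> real"
  shows "\<exists>\<mu>::nat \<Rightarrow> nat. (\<forall>k l. k \<le> l \<longrightarrow> \<mu> k \<le> \<mu> l) \<and> filterlim \<mu> at_top sequentially \<and>
    (\<forall>k. \<mu> k \<ge> 1 \<longrightarrow> b (\<mu> k) \<le> 2 ^ k)"
proof -
  define S where "S = (\<lambda>k. {m. m \<le> k \<and> (m = 0 \<or> b m \<le> 2 ^ k)})"
  define \<mu> where "\<mu> = (\<lambda>k. Max (S k))"
  have fin: "finite (S k)" and ne: "0 \<in> S k" for k by (auto simp: S_def)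
  have in': "\<mu> k \<in> S k" for k unfolding \<mu>_def using fin ne by (intro Max_in) auto
  have "\<mu> k \<le> \<mu> l" if "k \<le> l" for k l
  proof -
    have "S k \<subseteq> S l"
    proof
      fix m assume "m \<in> S k"
      moreover have "(2::real) ^ k \<le> 2 ^ l" using that by simp
      ultimately show "m \<in> S l" using that by (auto simp: S_def intro: order_trans)
    qed
    then show ?thesis unfolding \<mu>_def using fin ne by (intro Max_mono) auto
  qed
  moreover have "filterlim \<mu> at_top sequentially"
    unfolding filterlim_at_top
  proof
    fix m
    show "\<forall>\<^sub>F k in sequentially. m \<le> \<mu> k"
      using eventually_le_power2[of "b m"] eventually_ge_at_top[of m]
    proof eventually_elim
      case (elim k)
      then have "m \<in> S k" by (simp add: S_def)
      then show ?case unfolding \<mu>_def using fin by (intro Max_ge)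
    qed
  qed
  moreover have "b (\<mu> k) \<le> 2 ^ k" if "\<mu> k \<ge> 1" for k using in'[of k] that by (auto simp: S_def)
  ultimately show ?thesis by blast
qed

text \<open>With \<open>(1/2) ^ k\<close> in the role of a small parameter \<eta>,
  \<open>rapid\<close> means smaller than every power of \<eta> on the sets \<open>N k\<close>, and
  \<open>moderate\<close> means at most some negative power of \<eta> everywhere. Constant factors
  are absorbed by changing \<open>p\<close>.\<close>

definition rapid :: "(nat \<Rightarrow> 'a set) \<Rightarrow> (nat \<Rightarrow> 'a \<Rightarrow> real) \<Rightarrow> bool" where
  "rapid N u \<longleftrightarrow> (\<forall>p. \<forall>\<^sub>F k in sequentially. \<forall>y\<in>N k. \<bar>u k y\<bar> \<le> (1/2) ^ (k * p))"

definition moderate :: "(nat \<Rightarrow> 'a \<Rightarrow> real) \<Rightarrow> bool" where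
  "moderate u \<longleftrightarrow> (\<exists>p. \<forall>\<^sub>F k in sequentially. \<forall>y. \<bar>u k y\<bar> \<le> 2 ^ (k * p))"

lemma moderateI:
  assumes "\<And>k y. \<bar>u k y\<bar> \<le> C * 2 ^ (k * p)"
  shows "moderate u"
  unfolding moderate_def
proof (intro exI[of _ "Suc p"])
  show "\<forall>\<^sub>F k in sequentially. \<forall>y. \<bar>u k y\<bar> \<le> 2 ^ (k * Suc p)"
    using eventually_le_power2[of C]
  proof eventually_elim
    case (elim k)
    then have "C * 2 ^ (k * p) \<le> 2 ^ k * 2 ^ (k * p)" by (intro mult_right_mono) auto
    then have "C * 2 ^ (k * p) \<le> 2 ^ (k * Suc p)" by (simp add: power_add)
    then show ?case using order_trans[OF assms[of k]] by blast
  qed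
qed

lemma moderate_diff:
  assumes "moderate u" "moderate v"
  shows "moderate (\<lambda>k y. u k y - v k y)"
proof -
  obtain p where p: "\<forall>\<^sub>F k in sequentially. \<forall>y. \<bar>u k y\<bar> \<le> 2 ^ (k * p)" using assms(1) by (auto simp: moderate_def)
  obtain q where q: "\<forall>\<^sub>F k in sequentially. \<forall>y. \<bar>v k y\<bar> \<le> 2 ^ (k * q)" using assms(2) by (auto simp: moderate_def)
  have "\<forall>\<^sub>F k in sequentially. \<forall>y. \<bar>u k y - v k y\<bar> \<le> 2 ^ (k * (p + q + 1))"
    using p q eventually_ge_at_top[of 1]
  proof eventually_elim
    case (elim k)
    have "(2::real) ^ (k * p) \<le> 2 ^ (k * (p + q))" "(2::real) ^ (k * q) \<le> 2 ^ (k * (p + q))"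
      by (auto intro!: power_increasing)
    moreover have "(2::real) * 2 ^ (k * (p + q)) \<le> 2 ^ k * 2 ^ (k * (p + q))"
      using power_increasing[of 1 k "2::real"] elim(3) by (intro mult_right_mono) auto
    moreover have "(2::real) ^ (k * (p + q + 1)) = 2 ^ k * 2 ^ (k * (p + q))" by (simp add: power_add[symmetric] algebra_simps)
    ultimately have b: "2 ^ (k * p) + 2 ^ (k * q) \<le> (2::real) ^ (k * (p + q + 1))" by linarith
    show ?case
    proof
      fix y
      have "\<bar>u k y - v k y\<bar> \<le> \<bar>u k y\<bar> + \<bar>v k y\<bar>" by (rule abs_triangle_ineq4)
      then show "\<bar>u k y - v k y\<bar> \<le> 2 ^ (k * (p + q + 1))" using elim(1,2) b by (meson add_mono order_trans)
    qed
  qed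
  then show ?thesis unfolding moderate_def by blast
qed

lemma moderate_Suc:
  assumes "moderate u"
  shows "moderate (\<lambda>k. u (Suc k))"
proof -
  obtain p where "\<forall>\<^sub>F k in sequentially. \<forall>y. \<bar>u k y\<bar> \<le> 2 ^ (k * p)" using assms by (auto simp: moderate_def)
  then have "\<forall>\<^sub>F k in sequentially. \<forall>y. \<bar>u (Suc k) y\<bar> \<le> 2 ^ (Suc k * p)"
    by (subst eventually_sequentially_Suc)
  then have "\<forall>\<^sub>F k in sequentially. \<forall>y. \<bar>u (Suc k) y\<bar> \<le> 2 ^ (k * (2 * p))"
    using eventually_ge_at_top[of 1]
  proof eventually_elim
    case (elim k)
    have "Suc k * p \<le> k * (2 * p)" using elim(2) by (cases k) auto
    then have "(2::real) ^ (Suc k * p) \<le> 2 ^ (k * (2 * p))" by (intro power_increasing) auto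
    then show ?case using elim(1) by (auto intro: order_trans)
  qed
  then show ?thesis unfolding moderate_def by blast
qed

lemma rapid_zero: "rapid N (\<lambda>k y. 0)"
  by (simp add: rapid_def)

lemma rapid_add:
  assumes "rapid N u" "rapid N v"
  shows "rapid N (\<lambda>k y. u k y + v k y)"
  unfolding rapid_def
proof
  fix p
  have "\<forall>\<^sub>F k in sequentially. \<forall>y\<in>N k. \<bar>u k y\<bar> \<le> (1/2) ^ (k * (p + 1))" using assms(1) unfolding rapid_def by blast
  moreover have "\<forall>\<^sub>F k in sequentially. \<forall>y\<in>N k. \<bar>v k y\<bar> \<le> (1/2) ^ (k * (p + 1))" using assms(2) unfolding rapid_def by blast
  ultimately show "\<forall>\<^sub>F k in sequentially. \<forall>y\<in>N k. \<bar>u k y + v k y\<bar> \<le> (1/2) ^ (k * p)"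
    using eventually_ge_at_top[of 1]
  proof eventually_elim
    case (elim k)
    have "(1/2::real) ^ k \<le> (1/2) ^ 1" using elim(3) by (intro power_decreasing) auto
    then have "(1/2::real) ^ k * (1/2) ^ (k * p) \<le> 1/2 * (1/2) ^ (k * p)" by (intro mult_right_mono) auto
    then have b: "(1/2::real) ^ (k * (p + 1)) \<le> 1/2 * (1/2) ^ (k * p)" by (simp add: power_add[symmetric] algebra_simps)
    show ?case
    proof
      fix y assume "y \<in> N k"
      then have "\<bar>u k y\<bar> \<le> 1/2 * (1/2) ^ (k * p)" "\<bar>v k y\<bar> \<le> 1/2 * (1/2) ^ (k * p)"
        using elim(1,2) b by (auto intro: order_trans)
      then show "\<bar>u k y + v k y\<bar> \<le> (1/2) ^ (k * p)" by linarith
    qed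
  qed
qed

lemma rapid_mult_moderate:
  assumes "moderate u" "rapid N v"
  shows "rapid N (\<lambda>k y. u k y * v k y)"
  unfolding rapid_def
proof
  fix p
  obtain q where "\<forall>\<^sub>F k in sequentially. \<forall>y. \<bar>u k y\<bar> \<le> 2 ^ (k * q)" using assms(1) unfolding moderate_def by blast
  moreover have "\<forall>\<^sub>F k in sequentially. \<forall>y\<in>N k. \<bar>v k y\<bar> \<le> (1/2) ^ (k * (p + q))" using assms(2) unfolding rapid_def by blast
  ultimately show "\<forall>\<^sub>F k in sequentially. \<forall>y\<in>N k. \<bar>u k y * v k y\<bar> \<le> (1/2) ^ (k * p)"
  proof eventually_elim
    case (elim k)
    show ?case
    proof
      fix y assume "y \<in> N k"
      then have "\<bar>u k y\<bar> * \<bar>v k y\<bar> \<le> 2 ^ (k * q) * (1/2) ^ (k * (p + q))" using elim by (intro mult_mono) auto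
      also have "\<dots> = (1/2) ^ (k * p)" by (simp add: distrib_left power_add power_one_over)
      finally show "\<bar>u k y * v k y\<bar> \<le> (1/2) ^ (k * p)" by (simp add: abs_mult)
    qed
  qed
qed

lemma rapid_sum_list:
  assumes "\<And>p. p \<in> set ps \<Longrightarrow> rapid N (u p)"
  shows "rapid N (\<lambda>k y. \<Sum>p\<leftarrow>ps. u p k y)"
  using assms by (induction ps) (auto intro: rapid_zero rapid_add)

lemma smooth_jet_taylor2:
  assumes D: "smooth_jet UNIV g D" and s: "s > 0"
  shows "\<exists>\<xi>. s * D (Suc (length vs)) y (v # vs) = D (length vs) (y + s *\<^sub>R v) vs - D (length vs) y vs
      - s\<^sup>2 / 2 * D (Suc (Suc (length vs))) (y + \<xi> *\<^sub>R v) (v # v # vs)"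
proof -
  let ?k = "length vs"
  define Q where "Q = (\<lambda>i t. case i of 0 \<Rightarrow> D ?k (y + t *\<^sub>R v) vs | Suc 0 \<Rightarrow> D (Suc ?k) (y + t *\<^sub>R v) (v # vs)
     | _ \<Rightarrow> D (Suc (Suc ?k)) (y + t *\<^sub>R v) (v # v # vs))"
  have "\<exists>\<xi>. (if s < 0 then s < \<xi> \<and> \<xi> < 0 else 0 < \<xi> \<and> \<xi> < s) \<and>
    Q 0 s = (\<Sum>i<2. (Q i 0 / fact i) * (s - 0) ^ i) + (Q 2 \<xi> / fact 2) * (s - 0) ^ 2"
  proof (rule Taylor[of 2 Q "Q 0" 0 s 0 s])
    show "\<forall>i t. i < 2 \<and> 0 \<le> t \<and> t \<le> s \<longrightarrow> DERIV (Q i) t :> Q (Suc i) t"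
    proof (intro allI impI)
      fix i :: nat and t assume "i < 2 \<and> 0 \<le> t \<and> t \<le> s"
      then consider "i = 0" | "i = 1" by linarith
      then show "DERIV (Q i) t :> Q (Suc i) t"
        using smooth_jet_line_derivative[OF D, of y t v vs] smooth_jet_line_derivative[OF D, of y t v "v # vs"] by cases (auto simp: Q_def)
    qed
  qed (use s in auto)
  then obtain \<xi> where "Q 0 s = (\<Sum>i<2. (Q i 0 / fact i) * s ^ i) + (Q 2 \<xi> / fact 2) * s\<^sup>2" by auto
  then have "Q 0 s = Q 0 0 + s * Q 1 0 + s\<^sup>2 / 2 * Q 2 \<xi>" by (simp add: numeral_2_eq_2)
  then have "s * Q 1 0 = Q 0 s - Q 0 0 - s\<^sup>2 / 2 * Q 2 \<xi>" by simp
  then show ?thesis by (intro exI[of _ \<xi>]) (simp add: Q_def numeral_2_eq_2)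
qed

text \<open>Landau's interpolation inequality \<open>s \<bar>g'\<bar> \<le> 2 sup \<bar>g\<bar> + s\<^sup>2 sup \<bar>g''\<bar>\<close> with
  \<open>s = 2 powr (-k q)\<close> transfers rapid smallness from a function to its derivatives.\<close>

lemma rapid_derivatives:
  fixes D :: "nat \<Rightarrow> nat \<Rightarrow> 'a::euclidean_space \<Rightarrow> 'a list \<Rightarrow> real" and N :: "real \<Rightarrow> nat \<Rightarrow> 'a set"
  assumes D: "\<And>k. smooth_jet UNIV (g k) (D k)"
    and N: "\<And>\<theta> \<theta>'. 0 < \<theta> \<Longrightarrow> \<theta> < \<theta>' \<Longrightarrow> \<theta>' < 1 \<Longrightarrow> \<exists>a>0. \<forall>k. \<forall>y\<in>N \<theta> k. ball y (a * (1/2) ^ k) \<subseteq> N \<theta>' k"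
    and r0: "\<And>\<theta>. 0 < \<theta> \<Longrightarrow> \<theta> < 1 \<Longrightarrow> rapid (N \<theta>) (\<lambda>k y. D k 0 y [])"
    and md: "\<And>vs. moderate (\<lambda>k y. D k (length vs) y vs)"
    and \<theta>: "0 < \<theta>" "\<theta> < 1"
  shows "rapid (N \<theta>) (\<lambda>k y. D k (length vs) y vs)"
  using \<theta>
proof (induction vs arbitrary: \<theta>)
  case Nil
  then show ?case using r0 by simp
next
  case (Cons v vs)
  define \<theta>' where "\<theta>' = (\<theta> + 1) / 2"
  have \<theta>': "\<theta> < \<theta>'" "\<theta>' < 1" "0 < \<theta>'" using Cons.prems by (auto simp: \<theta>'_def)
  obtain a where a: "a > 0" "\<And>k y. y \<in> N \<theta> k \<Longrightarrow> ball y (a * (1/2) ^ k) \<subseteq> N \<theta>' k"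
    using N[OF Cons.prems(1) \<theta>'(1,2)] by blast
  obtain pm where pm: "\<forall>\<^sub>F k in sequentially. \<forall>y. \<bar>D k (length (v # v # vs)) y (v # v # vs)\<bar> \<le> 2 ^ (k * pm)"
    using md[of "v # v # vs"] unfolding moderate_def by blast
  show ?case unfolding rapid_def
  proof
    fix p
    \<comment> \<open>After division by \<open>s = (1/2) ^ (k * q)\<close> the second-order term is
      at most \<open>s * 2 ^ (k * pm) = (1/2) ^ (k * (p + 2))\<close>, and the two values of the
      lower derivative, small of order \<open>q + p + 2\<close>, contribute the same each. The spare
      2 absorbs the resulting factor 3.\<close>
    define q where "q = p + pm + 2"
    have "\<forall>\<^sub>F k in sequentially. \<forall>y\<in>N \<theta>' k. \<bar>D k (length vs) y vs\<bar> \<le> (1/2) ^ (k * (q + p + 2))"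
      using Cons.IH[OF \<theta>'(3,2)] unfolding rapid_def by blast
    then show "\<forall>\<^sub>F k in sequentially. \<forall>y\<in>N \<theta> k. \<bar>D k (length (v # vs)) y (v # vs)\<bar> \<le> (1/2) ^ (k * p)"
      using pm eventually_le_power2[of "(norm v + 1) / a"] eventually_ge_at_top[of 1]
    proof eventually_elim
      case (elim k)
      define s :: real where "s = (1/2) ^ (k * q)"
      have s: "s > 0" by (simp add: s_def)
      have s1: "s \<le> (1/2) ^ k * (1/2) ^ k"
      proof -
        have "k * 2 \<le> k * q" by (simp add: q_def)
        then have "(1/2::real) ^ (k * q) \<le> (1/2) ^ (k * 2)" by (intro power_decreasing) auto
        then show ?thesis by (simp add: s_def power_mult power2_eq_square power_mult_distrib)
      qed
      show ?case
      proof
        fix y assume y: "y \<in> N \<theta> k"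
        have "s * norm v < a * (1/2) ^ k"
        proof -
          have "norm v + 1 \<le> a * 2 ^ k" using elim(3) a(1) by (simp add: field_simps)
          then have "(1/2) ^ k * norm v < a" by (simp add: field_simps power_one_over)
          then have l: "(1/2) ^ k * ((1/2) ^ k * norm v) < (1/2) ^ k * a" by (intro mult_strict_left_mono) auto
          have "s * norm v \<le> (1/2) ^ k * (1/2) ^ k * norm v" using s1 by (intro mult_right_mono) auto
          also have "\<dots> = (1/2) ^ k * ((1/2) ^ k * norm v)" by (rule mult.assoc)
          also note l
          finally show ?thesis by (simp only: mult.commute)
        qed
        then have "y + s *\<^sub>R v \<in> N \<theta>' k" using a(2)[OF y] s by (auto simp: dist_norm subset_iff)
        moreover have "y \<in> N \<theta>' k" using a(2)[OF y] a(1) by auto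
        ultimately have u: "\<bar>D k (length vs) (y + s *\<^sub>R v) vs\<bar> \<le> (1/2) ^ (k * (q + p + 2))"
          "\<bar>D k (length vs) y vs\<bar> \<le> (1/2) ^ (k * (q + p + 2))" using elim(1) by auto
        obtain \<xi> where \<xi>: "s * D k (Suc (length vs)) y (v # vs) = D k (length vs) (y + s *\<^sub>R v) vs - D k (length vs) y vs
          - s\<^sup>2 / 2 * D k (Suc (Suc (length vs))) (y + \<xi> *\<^sub>R v) (v # v # vs)"
          using smooth_jet_taylor2[OF D s] by blast
        have w: "\<bar>s\<^sup>2 / 2 * D k (Suc (Suc (length vs))) (y + \<xi> *\<^sub>R v) (v # v # vs)\<bar> \<le> s\<^sup>2 * 2 ^ (k * pm)"
        proof -
          have "\<bar>D k (Suc (Suc (length vs))) (y + \<xi> *\<^sub>R v) (v # v # vs)\<bar> \<le> 2 ^ (k * pm)" using elim(2) by simp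
          then have "s\<^sup>2 / 2 * \<bar>D k (Suc (Suc (length vs))) (y + \<xi> *\<^sub>R v) (v # v # vs)\<bar> \<le> s\<^sup>2 * 2 ^ (k * pm)"
            by (intro mult_mono) auto
          then show ?thesis by (simp add: abs_mult)
        qed
        have e1: "(1/2::real) ^ (k * (q + p + 2)) = s * ((1/2) ^ (k * p) * (1/2) ^ (k * 2))"
        proof -
          have "k * (q + p + 2) = k * q + (k * p + k * 2)" by (simp add: distrib_left)
          then show ?thesis by (simp only: s_def power_add)
        qed
        have e2: "s * 2 ^ (k * pm) = (1/2) ^ (k * p) * (1/2) ^ (k * 2)"
        proof -
          have "k * q = k * pm + (k * p + k * 2)" by (simp add: q_def distrib_left)
          then have "s * 2 ^ (k * pm) = ((1/2) ^ (k * pm) * 2 ^ (k * pm)) * ((1/2) ^ (k * p) * (1/2) ^ (k * 2))"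
            by (simp only: s_def power_add mult_ac)
          also have "(1/2::real) ^ (k * pm) * 2 ^ (k * pm) = 1" by (simp add: power_one_over)
          finally show ?thesis by simp
        qed
        have "s * \<bar>D k (Suc (length vs)) y (v # vs)\<bar> = \<bar>s * D k (Suc (length vs)) y (v # vs)\<bar>" using s by (simp add: abs_mult)
        also have "\<dots> \<le> 2 * (1/2) ^ (k * (q + p + 2)) + s\<^sup>2 * 2 ^ (k * pm)"
          unfolding \<xi> using u w by linarith
        also have "\<dots> = s * (3 * ((1/2) ^ (k * p) * (1/2) ^ (k * 2)))"
          unfolding e1 using e2 by (simp add: power2_eq_square algebra_simps)
        finally have "\<bar>D k (Suc (length vs)) y (v # vs)\<bar> \<le> (1/2) ^ (k * p) * (3 * (1/2) ^ (k * 2))"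
          using s by (simp add: mult_ac)
        also have "\<dots> \<le> (1/2) ^ (k * p) * 1"
        proof (rule mult_left_mono)
          have "(1/2::real) ^ (k * 2) \<le> (1/2) ^ 2" using elim(4) by (intro power_decreasing) auto
          then show "3 * (1/2::real) ^ (k * 2) \<le> 1" by (simp add: power2_eq_square)
        qed simp
        finally show "\<bar>D k (length (v # vs)) y (v # vs)\<bar> \<le> (1/2) ^ (k * p)" by simp
      qed
    qed
  qed
qed

text \<open>\<open>bd\<close> controls one direction list at a time. Expanding the newest direction
  in \<open>Basis\<close> makes the convergence of the differentials uniform over all directions, as
  term-by-term differentiation requires.\<close>

lemma smooth_jet_suminf:
  fixes D :: "nat \<Rightarrow> nat \<Rightarrow> 'a::euclidean_space \<Rightarrow> 'a list \<Rightarrow> real"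
  assumes D: "\<And>k. smooth_jet UNIV (g k) (D k)" and U: "open U" "convex U"
    and bd: "\<And>vs. \<forall>\<^sub>F k in sequentially. \<forall>y\<in>U. \<bar>D k (length vs) y vs\<bar> \<le> (1/2) ^ k"
  shows "smooth_jet U (\<lambda>x. \<Sum>k. g k x) (\<lambda>j x vs. \<Sum>k. D k j x vs)"
  unfolding smooth_jet_def
proof (intro conjI allI ballI impI)
  show "(\<Sum>k. D k 0 x []) = (\<Sum>k. g k x)" for x using D by (simp add: smooth_jet_UNIV_iff)
  fix j x and vs :: "'a list" assume x: "x \<in> U" and len: "length vs = j"
  have geo: "summable (\<lambda>k. (1/2::real) ^ k)" by (simp add: summable_geometric)
  have sm: "summable (\<lambda>k. D k (length us) y us)" if "y \<in> U" for us y
  proof (rule summable_comparison_test_ev[OF _ geo])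
    show "\<forall>\<^sub>F k in sequentially. norm (D k (length us) y us) \<le> (1/2) ^ k"
      using bd[of us] by (rule eventually_mono) (use that in simp)
  qed
  have expand: "D k (Suc (length vs)) y (h # vs) = (\<Sum>b\<in>Basis. (h \<bullet> b) * D k (Suc (length vs)) y (b # vs))" for k y h
    by (rule has_derivative_euclidean_expand[OF smooth_jetD[OF D]]) simp
  have sexpand: "(\<Sum>k. D k (Suc (length vs)) y (h # vs)) = (\<Sum>b\<in>Basis. (h \<bullet> b) * (\<Sum>k. D k (Suc (length vs)) y (b # vs)))" if "y \<in> U" for y h
  proof -
    have s1: "summable (\<lambda>k. D k (Suc (length vs)) y (b # vs))" for b using sm[OF that, of "b # vs"] by simp
    have "(\<Sum>k. D k (Suc (length vs)) y (h # vs)) = (\<Sum>k. \<Sum>b\<in>Basis. (h \<bullet> b) * D k (Suc (length vs)) y (b # vs))"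
      by (rule arg_cong[where f = suminf], rule ext, rule expand)
    also have "\<dots> = (\<Sum>b\<in>Basis. \<Sum>k. (h \<bullet> b) * D k (Suc (length vs)) y (b # vs))"
      by (rule suminf_sum) (intro summable_mult s1)
    also have "\<dots> = (\<Sum>b\<in>Basis. (h \<bullet> b) * (\<Sum>k. D k (Suc (length vs)) y (b # vs)))"
      by (intro sum.cong refl suminf_mult s1)
    finally show ?thesis .
  qed
  have "\<exists>G. \<forall>y\<in>U. (\<lambda>k. D k (length vs) y vs) sums (G y) \<and>
      (G has_derivative (\<lambda>v. \<Sum>k. D k (Suc (length vs)) y (v # vs))) (at y within U)"
  proof (rule has_derivative_series[where f' = "\<lambda>k y v. D k (Suc (length vs)) y (v # vs)" and x = x and l = "\<Sum>k. D k (length vs) x vs"])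
    show "((\<lambda>y. D n (length vs) y vs) has_derivative (\<lambda>v. D n (Suc (length vs)) y (v # vs))) (at y within U)" if "y \<in> U" for n y
      using smooth_jetD[OF D, of y n vs] by (simp add: has_derivative_at_withinI)
    show "(\<lambda>k. D k (length vs) x vs) sums (\<Sum>k. D k (length vs) x vs)" using sm[OF x] by (rule summable_sums)
    fix e :: real assume e: "e > 0"
    define e' where "e' = e / real DIM('a)"
    have e': "e' > 0" using e by (simp add: e'_def)
    have "\<forall>\<^sub>F n in sequentially. \<forall>b\<in>Basis. \<forall>y\<in>U. dist (\<Sum>i<n. D i (Suc (length vs)) y (b # vs)) (\<Sum>i. D i (Suc (length vs)) y (b # vs)) < e'"
    proof (rule eventually_ball_finite, simp, rule ballI)
      fix b :: 'a
      have "uniform_limit U (\<lambda>n y. \<Sum>i<n. D i (Suc (length vs)) y (b # vs)) (\<lambda>y. \<Sum>i. D i (Suc (length vs)) y (b # vs)) sequentially"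
        by (rule Weierstrass_m_test_ev[OF _ geo]) (use bd[of "b # vs"] in simp)
      from uniform_limitD[OF this e']
      show "\<forall>\<^sub>F n in sequentially. \<forall>y\<in>U. dist (\<Sum>i<n. D i (Suc (length vs)) y (b # vs)) (\<Sum>i. D i (Suc (length vs)) y (b # vs)) < e'" .
    qed
    then show "\<forall>\<^sub>F n in sequentially. \<forall>y\<in>U. \<forall>h. norm ((\<Sum>i<n. D i (Suc (length vs)) y (h # vs)) - (\<Sum>k. D k (Suc (length vs)) y (h # vs))) \<le> e * norm h"
    proof eventually_elim
      case (elim n)
      show ?case
      proof (intro ballI allI)
        fix y h assume y: "y \<in> U"
        let ?d = "\<lambda>b. (\<Sum>i<n. D i (Suc (length vs)) y (b # vs)) - (\<Sum>i. D i (Suc (length vs)) y (b # vs))"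
        have "(\<Sum>i<n. D i (Suc (length vs)) y (h # vs)) = (\<Sum>i<n. \<Sum>b\<in>Basis. (h \<bullet> b) * D i (Suc (length vs)) y (b # vs))"
          by (rule sum.cong[OF refl expand])
        also have "\<dots> = (\<Sum>b\<in>Basis. (h \<bullet> b) * (\<Sum>i<n. D i (Suc (length vs)) y (b # vs)))"
          by (subst sum.swap) (simp add: sum_distrib_left)
        finally have "(\<Sum>i<n. D i (Suc (length vs)) y (h # vs)) - (\<Sum>k. D k (Suc (length vs)) y (h # vs)) = (\<Sum>b\<in>Basis. (h \<bullet> b) * ?d b)"
          using sexpand[OF y, of h] by (simp add: right_diff_distrib sum_subtractf)
        also have "\<bar>\<dots>\<bar> \<le> (\<Sum>b\<in>(Basis::'a set). norm h * e')"
        proof (intro order_trans[OF sum_abs] sum_mono)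
          fix b :: 'a assume b: "b \<in> Basis"
          have "\<bar>?d b\<bar> \<le> e'" using elim b y by (fastforce simp: dist_real_def)
          then show "\<bar>(h \<bullet> b) * ?d b\<bar> \<le> norm h * e'"
            unfolding abs_mult using Basis_le_norm[OF b, of h] by (intro mult_mono) auto
        qed
        also have "\<dots> = e * norm h" by (simp add: e'_def)
        finally show "norm ((\<Sum>i<n. D i (Suc (length vs)) y (h # vs)) - (\<Sum>k. D k (Suc (length vs)) y (h # vs))) \<le> e * norm h" by simp
      qed
    qed
  qed (use U x in auto)
  then obtain G where G: "\<And>y. y \<in> U \<Longrightarrow> (\<lambda>k. D k (length vs) y vs) sums (G y)"
    "\<And>y. y \<in> U \<Longrightarrow> (G has_derivative (\<lambda>v. \<Sum>k. D k (Suc (length vs)) y (v # vs))) (at y within U)" by blast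
  have "(G has_derivative (\<lambda>v. \<Sum>k. D k (Suc (length vs)) x (v # vs))) (at x)"
    using G(2)[OF x] at_within_open[OF x U(1)] by simp
  then have "((\<lambda>y. \<Sum>k. D k (length vs) y vs) has_derivative (\<lambda>v. \<Sum>k. D k (Suc (length vs)) x (v # vs))) (at x)"
    by (rule has_derivative_transform_within_open[OF _ U(1) x]) (rule sums_unique[OF G(1)])
  then show "((\<lambda>y. \<Sum>k. D k j y vs) has_derivative (\<lambda>v. \<Sum>k. D k (Suc j) x (v # vs))) (at x)"
    unfolding len[symmetric] .
qed

lemma smooth_jet_zero_on_open:
  assumes D: "smooth_jet UNIV g D" and S: "open S" and g: "\<And>y. y \<in> S \<Longrightarrow> g y = 0" and y: "y \<in> S"
  shows "D (length vs) y vs = 0"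
  using y
proof (induction vs arbitrary: y)
  case Nil
  then show ?case using D g by (simp add: smooth_jet_UNIV_iff)
next
  case (Cons v vs)
  have "((\<lambda>y. D (length vs) y vs) has_derivative (\<lambda>v. D (Suc (length vs)) y (v # vs))) (at y)"
    using smooth_jetD[OF D] by simp
  moreover have "((\<lambda>y. D (length vs) y vs) has_derivative (\<lambda>v. 0)) (at y)"
    by (rule has_derivative_transform_within_open[OF has_derivative_const S Cons.prems]) (simp add: Cons.IH)
  ultimately have "(\<lambda>v. D (Suc (length vs)) y (v # vs)) = (\<lambda>v. 0)" by (rule has_derivative_unique)
  then show ?case by (metis length_Cons)
qed

text \<open>\<open>u\<close> is a continuous extension of \<open>f\<close> to the whole space; it
  makes the averages meaningful near \<open>X\<close>, but the smallness estimates see only its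
  values on \<open>X\<close>. Kernel directions lie within \<open>c/4\<close> of \<open>e\<close>,
  the bounds \<open>B\<close> hold within \<open>c/2\<close> and the cone within \<open>c\<close>,
  which leaves room for tilting.\<close>

locale extension_setup =
  fixes X :: "'a::euclidean_space set" and f :: "'a \<Rightarrow> real" and x0 e :: 'a
    and c \<delta> \<tau> L \<kappa> :: real and B :: "nat \<Rightarrow> real" and u \<psi> :: "'a \<Rightarrow> real"
    and J :: "nat \<Rightarrow> 'a \<Rightarrow> 'a list \<Rightarrow> real" and lo hi :: 'a and \<mu> :: "nat \<Rightarrow> nat"
  assumes X: "closed X" and x0: "x0 \<in> X"
    and cn: "0 < c" "c \<le> 1/2" "0 < \<delta>" "0 < \<tau>" "norm e = 1" "L \<ge> 0"
    and conein: "\<And>y v s. y \<in> X \<Longrightarrow> dist x0 y < \<delta> \<Longrightarrow> dist e v < c \<Longrightarrow> 0 < s \<Longrightarrow> s \<le> \<tau> \<Longrightarrow> y + s *\<^sub>R v \<in> X"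
    and segJ: "\<And>y v. y \<in> X \<Longrightarrow> dist x0 y < \<delta> \<Longrightarrow> dist e v < c/2 \<Longrightarrow>
        jets_on {0<..<\<tau>} (\<lambda>k. (deriv ^^ k) (\<lambda>s. f (y + s *\<^sub>R v)))"
    and segB: "\<And>y v k s. y \<in> X \<Longrightarrow> dist x0 y < \<delta> \<Longrightarrow> dist e v < c/2 \<Longrightarrow> s \<in> {0<..<\<tau>} \<Longrightarrow>
        \<bar>(deriv ^^ k) (\<lambda>s. f (y + s *\<^sub>R v)) s\<bar> \<le> B k"
    and lip: "\<And>y y'. y \<in> X \<Longrightarrow> dist x0 y < \<delta> \<Longrightarrow> y' \<in> X \<Longrightarrow> dist x0 y' < \<delta> \<Longrightarrow> \<bar>f y - f y'\<bar> \<le> L * dist y y'"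
    and uc: "continuous_on UNIV u" and uf: "\<And>y. y \<in> X \<Longrightarrow> dist x0 y \<le> \<delta>/2 \<Longrightarrow> u y = f y"
    and \<psi>J: "bsmooth \<psi> J" and \<psi>0: "\<And>z. \<psi> z \<ge> 0" and lohi: "cbox lo hi \<subseteq> ball e (c/4)"
    and supp: "\<And>z. z \<notin> cbox lo hi \<Longrightarrow> \<psi> z = 0" and int1: "integral (cbox lo hi) \<psi> = 1"
    and \<kappa>: "0 < \<kappa>" "\<kappa> \<le> 1" "\<kappa> \<le> \<delta>/16" "\<kappa> \<le> \<tau>/2"
    and \<mu>mono: "\<And>k l. k \<le> l \<Longrightarrow> \<mu> k \<le> \<mu> l" and \<mu>lim: "filterlim \<mu> at_top sequentially"
    and \<mu>b: "\<And>k. \<mu> k \<ge> 1 \<Longrightarrow> (2 ^ \<mu> k * real (\<mu> k))\<^sup>2 + 2 ^ \<mu> k * real (\<mu> k) ^ \<mu> k * (1 + \<bar>B (\<mu> k)\<bar>) \<le> 2 ^ k"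
begin

text \<open>\<open>Fj k\<close> is the jet of the averaged extrapolation of order \<open>\<mu> k\<close> with step \<open>h k\<close>; the order tends
  to infinity so slowly that \<open>2 ^ k\<close> dominates the derivative bounds \<open>B (\<mu> k)\<close>.\<close>

definition "h k = \<kappa> * (1/2) ^ k"
definition "A1 = x0 - \<delta> *\<^sub>R One"
definition "A2 = x0 + \<delta> *\<^sub>R One"
definition "Fj k j y vs = (\<Sum>i\<in>{1..\<mu> k}. ((-1) ^ Suc i * real (\<mu> k choose i)) * moll_jet J A1 A2 (real i * h k) u j y vs)"
definition "Gj k j y vs = Fj (Suc k) j y vs - Fj k j y vs"
text \<open>The width is a small fraction of the step \<open>h k\<close>, so that segments from
  points outside \<open>X\<close> are in \<open>X\<close> well before the first node. The factor
  \<open>\<theta>\<close> provides the nested neighbourhoods that \<open>rapid_derivatives\<close>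
  consumes.\<close>

definition "N \<theta> k = {y. dist x0 y < \<theta> * (\<delta>/4) \<and> infdist y X < \<theta> * (c/16 * h k)}"

lemma h_pos: "h k > 0" using \<kappa> by (simp add: h_def)

lemma h_le: "h k \<le> \<kappa>" 
  using \<kappa> by (simp add: h_def power_le_one mult_left_le)

lemma smooth_\<psi>: "smooth_jet UNIV \<psi> J" using \<psi>J by (simp add: bsmooth_def)

lemma \<psi>_continuous: "continuous_on UNIV \<psi>"
  using smooth_jet_continuous[OF smooth_\<psi>, of "[]"] smooth_\<psi> by (simp add: smooth_jet_UNIV_iff)

lemma support_direction: "z \<in> cbox lo hi \<Longrightarrow> dist e z < c/4" using lohi by auto

lemma support_norm: "z \<in> cbox lo hi \<Longrightarrow> norm z \<le> 5/4"
  using norm_cone_direction[OF cn(5), of z] support_direction[of z] cn by simp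

lemma \<mu>_bounds:
  assumes "\<mu> k \<ge> 1"
  shows "(2 ^ \<mu> k * real (\<mu> k))\<^sup>2 \<le> 2 ^ k" "2 ^ \<mu> k * real (\<mu> k) ^ \<mu> k * (1 + \<bar>B (\<mu> k)\<bar>) \<le> 2 ^ k"
    "2 ^ \<mu> k * real (\<mu> k) ^ \<mu> k \<le> 2 ^ k" "\<bar>B (\<mu> k)\<bar> \<le> 2 ^ k" "(2::real) ^ \<mu> k \<le> 2 ^ k" "real (\<mu> k) \<le> 2 ^ k"
proof -
  let ?m = "\<mu> k"
  have m1: "real ?m ^ ?m \<ge> 1" using assms by simp
  have p: "2 ^ ?m * real ?m ^ ?m * (1 + \<bar>B ?m\<bar>) \<ge> 0" by (intro mult_nonneg_nonneg) auto
  show 1: "(2 ^ ?m * real ?m)\<^sup>2 \<le> 2 ^ k" using \<mu>b[OF assms] p by linarith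
  show 2: "2 ^ ?m * real ?m ^ ?m * (1 + \<bar>B ?m\<bar>) \<le> 2 ^ k" using \<mu>b[OF assms] zero_le_power2[of "2 ^ ?m * real ?m"] by linarith
  have q: "2 ^ ?m * real ?m ^ ?m \<ge> 1" using m1 by (metis mult_mono' mult_1 one_le_power zero_le_one one_le_numeral)
  have "2 ^ ?m * real ?m ^ ?m * 1 \<le> 2 ^ ?m * real ?m ^ ?m * (1 + \<bar>B ?m\<bar>)" using q by (intro mult_left_mono) auto
  then show 3: "2 ^ ?m * real ?m ^ ?m \<le> 2 ^ k" using 2 by linarith
  have "1 * \<bar>B ?m\<bar> \<le> 2 ^ ?m * real ?m ^ ?m * (1 + \<bar>B ?m\<bar>)" using q by (intro mult_mono) auto
  then show "\<bar>B ?m\<bar> \<le> 2 ^ k" using 2 by simp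
  have "(2::real) ^ ?m * 1 \<le> 2 ^ ?m * real ?m ^ ?m" using m1 by (intro mult_left_mono) auto
  then show "(2::real) ^ ?m \<le> 2 ^ k" using 3 by linarith
  have "1 * real ?m \<le> real ?m ^ (?m - 1) * real ?m" using assms by (intro mult_right_mono) auto
  also have "\<dots> = real ?m ^ ?m" using assms by (cases ?m) auto
  finally have "1 * real ?m \<le> 2 ^ ?m * real ?m ^ ?m" by (intro mult_mono) auto
  then show "real ?m \<le> 2 ^ k" using 3 by linarith
qed

lemma power2_\<mu>: "(2::real) ^ \<mu> k \<le> 2 ^ k"
  using \<mu>_bounds(5)[of k] by (cases "\<mu> k \<ge> 1") auto

lemma \<mu>_h_le: "real (\<mu> k) * h k \<le> \<kappa>"
proof -
  have "real (\<mu> k) \<le> 2 ^ k" using \<mu>_bounds(6)[of k] by (cases "\<mu> k \<ge> 1") auto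
  then have "real (\<mu> k) * h k \<le> 2 ^ k * h k" using h_pos[of k] by (intro mult_right_mono) auto
  also have "\<dots> = \<kappa>" by (simp add: h_def power_one_over)
  finally show ?thesis .
qed

lemma shifted_point:
  assumes "dist x0 y < \<delta>/4" "z \<in> cbox lo hi" "0 \<le> s" "s \<le> \<kappa>"
  shows "dist x0 (y + s *\<^sub>R z) \<le> \<delta>/2" "y + s *\<^sub>R z \<in> cbox A1 A2"
proof -
  have "s * norm z \<le> \<delta>/16 * (5/4)" using assms \<kappa> support_norm[of z] by (intro mult_mono) auto
  then have "dist x0 (y + s *\<^sub>R z) < \<delta>/2"
    using assms cn dist_triangle[of x0 "y + s *\<^sub>R z" y] by (simp add: dist_norm)
  then show "dist x0 (y + s *\<^sub>R z) \<le> \<delta>/2" by simp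
  have "\<bar>(y + s *\<^sub>R z - x0) \<bullet> b\<bar> \<le> \<delta>" if "b \<in> Basis" for b
    using Basis_le_norm[OF that, of "y + s *\<^sub>R z - x0"] \<open>dist x0 (y + s *\<^sub>R z) < \<delta>/2\<close> cn
    by (simp add: dist_norm norm_minus_commute)
  then show "y + s *\<^sub>R z \<in> cbox A1 A2"
    by (force simp: mem_box A1_def A2_def inner_diff_left inner_add_left abs_le_iff)
qed

lemma step_range:
  assumes "i \<in> {1..\<mu> k}"
  shows "0 < real i * h k" "real i * h k \<le> \<kappa>" "h k \<le> real i * h k"
proof -
  show "0 < real i * h k" using assms h_pos[of k] by simp
  have "real i * h k \<le> real (\<mu> k) * h k" using assms h_pos[of k] by (intro mult_right_mono) auto
  then show "real i * h k \<le> \<kappa>" using \<mu>_h_le[of k] by linarith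
  show "h k \<le> real i * h k" using assms h_pos[of k] mult_right_mono[of 1 "real i" "h k"] by simp
qed

lemma Fj_smooth: "smooth_jet UNIV (\<lambda>y. Fj k 0 y []) (Fj k)"
  unfolding Fj_def by (rule smooth_jet_sum, rule moll_jet_smooth[OF smooth_\<psi> uc])

lemma Gj_smooth: "smooth_jet UNIV (\<lambda>y. Gj k 0 y []) (Gj k)"
  unfolding Gj_def by (rule smooth_jet_diff[OF Fj_smooth Fj_smooth])

lemma integrand_integrable:
  "(\<lambda>z. u (y + s *\<^sub>R z) * \<psi> z) integrable_on cbox lo hi"
  by (intro integrable_continuous continuous_intros continuous_on_compose2[OF uc] continuous_on_compose2[OF \<psi>_continuous]) auto

lemma extrap_integrable:
  "(\<lambda>z. extrap m g (\<lambda>s. u (y + s *\<^sub>R z)) * \<psi> z) integrable_on cbox lo hi"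
  unfolding extrap_def sum_distrib_right mult.assoc
  by (intro integrable_sum finite_atLeastAtMost integrable_on_mult_right integrand_integrable)

lemma Fj_value:
  assumes y: "dist x0 y < \<delta>/4"
  shows "Fj k 0 y [] = integral (cbox lo hi) (\<lambda>z. extrap (\<mu> k) (h k) (\<lambda>s. u (y + s *\<^sub>R z)) * \<psi> z)"
proof -
  have "integral (cbox lo hi) (\<lambda>z. extrap (\<mu> k) (h k) (\<lambda>s. u (y + s *\<^sub>R z)) * \<psi> z)
    = integral (cbox lo hi) (\<lambda>z. \<Sum>i\<in>{1..\<mu> k}. ((-1) ^ Suc i * real (\<mu> k choose i)) * (u (y + (real i * h k) *\<^sub>R z) * \<psi> z))"
    by (simp only: extrap_def sum_distrib_right mult.assoc)
  also have "\<dots> = (\<Sum>i\<in>{1..\<mu> k}. integral (cbox lo hi) (\<lambda>z. ((-1) ^ Suc i * real (\<mu> k choose i)) * (u (y + (real i * h k) *\<^sub>R z) * \<psi> z)))"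
    by (rule integral_sum) (auto intro!: integrable_on_mult_right integrand_integrable simp del: power_Suc)
  also have "\<dots> = Fj k 0 y []"
    unfolding Fj_def
  proof (rule sum.cong[OF refl])
    fix i assume i: "i \<in> {1..\<mu> k}"
    have "moll_jet J A1 A2 (real i * h k) u 0 y [] = integral (cbox lo hi) (\<lambda>z. u (y + (real i * h k) *\<^sub>R z) * \<psi> z)"
      using step_range[OF i] shifted_point(2)[OF y] by (intro moll_jet_value[OF smooth_\<psi> uc _ supp]) auto
    then show "integral (cbox lo hi) (\<lambda>z. ((-1) ^ Suc i * real (\<mu> k choose i)) * (u (y + (real i * h k) *\<^sub>R z) * \<psi> z))
       = (-1) ^ Suc i * real (\<mu> k choose i) * moll_jet J A1 A2 (real i * h k) u 0 y []"
      by (simp only: integral_mult_right)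
  qed
  finally show ?thesis ..
qed

text \<open>If \<open>y'\<close> is a nearest point of \<open>X\<close>, then
  \<open>y + s *\<^sub>R z = y' + s *\<^sub>R w\<close> with
  \<open>w = z + (1/s) *\<^sub>R (y - y')\<close>, and the tilt is below
  \<open>(c/16 * h k) / (h k / 4) = c/4\<close>.\<close>

lemma near_point:
  assumes y: "y \<in> N 1 k" and z: "z \<in> cbox lo hi" and s: "h k / 4 \<le> s" "s \<le> \<kappa>"
  shows "y + s *\<^sub>R z \<in> X"
proof -
  have s0: "s > 0" using s h_pos[of k] by simp
  have "X \<noteq> {}" using x0 by auto
  then obtain y' where y': "y' \<in> X" "infdist y X = dist y y'" using infdist_attains_inf[OF X] by blast
  have d: "dist y y' < c/16 * h k" using y y' by (simp add: N_def)
  have "c/16 * h k \<le> 1 * (\<delta>/16)" using cn h_pos[of k] h_le[of k] \<kappa> by (intro mult_mono) auto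
  then have "dist x0 y' < \<delta>" using y d dist_triangle[of x0 y' y] cn by (simp add: N_def)
  define w where "w = z + (1/s) *\<^sub>R (y - y')"
  have "dist z w = dist y y' / s" using s0 by (simp add: w_def dist_norm)
  also have "\<dots> < (c/16 * h k) / (h k / 4)" using d s h_pos[of k] by (intro frac_less) auto
  also have "\<dots> = c/4" using h_pos[of k] by simp
  finally have "dist e w < c" using support_direction[OF z] dist_triangle[of e w z] cn by simp
  then have "y' + s *\<^sub>R w \<in> X" using conein[OF y'(1) \<open>dist x0 y' < \<delta>\<close>] s0 s \<kappa> cn by simp
  moreover have "y' + s *\<^sub>R w = y + s *\<^sub>R z" using s0 by (simp add: w_def scaleR_add_right)
  ultimately show ?thesis by simp
qed

text \<open>Both extrapolations have order at least \<open>\<mu> k\<close> and nodes from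
  \<open>h k / 2\<close> on, so both are close to the same Taylor value \<open>T\<close> of
  \<open>extrap_error\<close>. By the choice of \<open>\<mu>\<close> all constants are bounded by
  powers of \<open>2 ^ k\<close>, while \<open>h k ^ \<mu> k\<close> gives the decisive
  \<open>(1/2) ^ (k * \<mu> k)\<close>.\<close>

lemma extrap_difference:
  assumes y: "y \<in> N 1 k" and z: "z \<in> cbox lo hi" and m: "\<mu> k \<ge> 1"
  shows "\<bar>extrap (\<mu> (Suc k)) (h (Suc k)) (\<lambda>s. u (y + s *\<^sub>R z)) - extrap (\<mu> k) (h k) (\<lambda>s. u (y + s *\<^sub>R z))\<bar>
    \<le> 4 * (2 ^ k * 2 ^ k) * (1/2) ^ (k * \<mu> k)"
proof -
  let ?m = "\<mu> k" and ?m' = "\<mu> (Suc k)" and ?q = "\<lambda>s. u (y + s *\<^sub>R z)"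
  have yd: "dist x0 y < \<delta>/4" using y by (simp add: N_def)
  have h2: "h (Suc k) = h k / 2" by (simp add: h_def)
  have mm: "?m \<le> ?m'" using \<mu>mono by simp
  \<comment> \<open>The segment is started at \<open>y1\<close> in \<open>X\<close>, because
    \<open>y\<close> itself may lie outside. In the parameter \<open>s\<close> it begins at
    \<open>h k / 4\<close>, to the left of the expansion point \<open>h k / 2\<close>.\<close>
  define y1 where "y1 = y + (h k / 4) *\<^sub>R z"
  have h4: "h k / 4 \<le> \<kappa>" using h_le[of k] h_pos[of k] by simp
  have y1X: "y1 \<in> X" unfolding y1_def using near_point[OF y z] h4 by simp
  have y1d: "dist x0 y1 < \<delta>" using shifted_point(1)[OF yd z, of "h k / 4"] h4 h_pos[of k] cn by (simp add: y1_def)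
  have zd: "dist e z < c/2" using support_direction[OF z] cn by simp
  define Q where "Q = (\<lambda>i s. (1::real) ^ i *\<^sub>R (deriv ^^ i) (\<lambda>s. f (y1 + s *\<^sub>R z)) (1 * s + (- h k / 4)))"
  have jQ: "jets_on {h k / 4<..<h k / 4 + \<tau>} Q"
    unfolding Q_def by (rule jets_on_affine[OF segJ[OF y1X y1d zd]]) auto
  have bQ: "\<bar>Q ?m s\<bar> \<le> \<bar>B ?m\<bar>" if "s \<in> {h k / 4<..<h k / 4 + \<tau>}" for s
  proof -
    have "\<bar>Q ?m s\<bar> \<le> B ?m" using segB[OF y1X y1d zd, of "s - h k / 4" ?m] that by (simp add: Q_def)
    then show ?thesis by linarith
  qed
  have "\<exists>T. \<forall>m' g. ?m \<le> m' \<and> h k / 2 \<le> g \<and> real m' * g \<le> \<kappa> \<longrightarrow> \<bar>extrap m' g (Q 0) - T\<bar> \<le> 2 ^ m' * (\<bar>B ?m\<bar> * (real m' * g) ^ ?m)"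
    by (rule extrap_error[OF jQ _ _ _ _ m bQ]) (use h_pos[of k] h_le[of k] \<kappa> cn in auto)
  then obtain T where T: "\<And>m' g. ?m \<le> m' \<Longrightarrow> h k / 2 \<le> g \<Longrightarrow> real m' * g \<le> \<kappa> \<Longrightarrow>
     \<bar>extrap m' g (Q 0) - T\<bar> \<le> 2 ^ m' * (\<bar>B ?m\<bar> * (real m' * g) ^ ?m)" by blast
  have Qq: "Q 0 s = ?q s" if "h k / 2 \<le> s" "s \<le> \<kappa>" for s
  proof -
    have "y + s *\<^sub>R z \<in> X" using near_point[OF y z, of s] that h_pos[of k] by simp
    moreover have "dist x0 (y + s *\<^sub>R z) \<le> \<delta>/2" using shifted_point(1)[OF yd z, of s] that h_pos[of k] by simp
    moreover have "y1 + (s - h k / 4) *\<^sub>R z = y + s *\<^sub>R z" by (simp add: y1_def algebra_simps)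
    ultimately show ?thesis using uf by (simp add: Q_def)
  qed
  have eq: "extrap m' g (Q 0) = extrap m' g ?q" if "h k / 2 \<le> g" "real m' * g \<le> \<kappa>" for m' g
    unfolding extrap_def
  proof (rule sum.cong[OF refl])
    fix j assume j: "j \<in> {1..m'}"
    have g0: "g > 0" using that h_pos[of k] by simp
    have "g \<le> real j * g" using j g0 mult_right_mono[of 1 "real j" g] by simp
    moreover have "real j * g \<le> real m' * g" using j g0 by (intro mult_right_mono) auto
    ultimately have "Q 0 (real j * g) = ?q (real j * g)" using Qq that by simp
    then show "(-1) ^ Suc j * real (m' choose j) * Q 0 (real j * g) = (-1) ^ Suc j * real (m' choose j) * ?q (real j * g)" by simp
  qed
  have hm: "h k ^ ?m \<le> (1/2) ^ (k * ?m)"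
  proof -
    have "h k \<le> (1/2) ^ k" unfolding h_def using \<kappa> by (simp add: mult_left_le_one_le)
    then have "h k ^ ?m \<le> ((1/2) ^ k) ^ ?m" using h_pos[of k] by (intro power_mono) auto
    then show ?thesis by (simp add: power_mult)
  qed
  have t1: "\<bar>extrap ?m (h k) ?q - T\<bar> \<le> 2 ^ k * (1/2) ^ (k * ?m)"
  proof -
    have "\<bar>extrap ?m (h k) ?q - T\<bar> \<le> 2 ^ ?m * (\<bar>B ?m\<bar> * (real ?m * h k) ^ ?m)"
      using T[of ?m "h k"] eq[of "h k" ?m] h_pos[of k] \<mu>_h_le[of k] by simp
    also have "\<dots> = (2 ^ ?m * real ?m ^ ?m * \<bar>B ?m\<bar>) * h k ^ ?m" by (simp add: power_mult_distrib)
    also have "\<dots> \<le> (2 ^ ?m * real ?m ^ ?m * (1 + \<bar>B ?m\<bar>)) * h k ^ ?m"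
      using h_pos[of k] by (intro mult_right_mono mult_left_mono) auto
    also have "\<dots> \<le> 2 ^ k * (1/2) ^ (k * ?m)"
      using \<mu>_bounds(2)[OF m] hm h_pos[of k] by (intro mult_mono) auto
    finally show ?thesis .
  qed
  have t2: "\<bar>extrap ?m' (h (Suc k)) ?q - T\<bar> \<le> 2 * (2 ^ k * 2 ^ k) * (1/2) ^ (k * ?m)"
  proof -
    have m': "?m' \<ge> 1" using m mm by simp
    have "\<bar>extrap ?m' (h (Suc k)) ?q - T\<bar> \<le> 2 ^ ?m' * (\<bar>B ?m\<bar> * (real ?m' * h (Suc k)) ^ ?m)"
      using T[of ?m' "h (Suc k)"] eq[of "h (Suc k)" ?m'] mm \<mu>_h_le[of "Suc k"] by (simp add: h2)
    also have "\<dots> = (2 ^ ?m' * real ?m' ^ ?m) * (\<bar>B ?m\<bar> * h (Suc k) ^ ?m)" by (simp add: power_mult_distrib)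
    also have "\<dots> \<le> 2 ^ Suc k * (2 ^ k * (1/2) ^ (k * ?m))"
    proof (rule mult_mono)
      have "real ?m' ^ ?m \<le> real ?m' ^ ?m'" using m' mm by (intro power_increasing) auto
      then have "2 ^ ?m' * real ?m' ^ ?m \<le> 2 ^ ?m' * real ?m' ^ ?m'" by (intro mult_left_mono) auto
      also have "\<dots> \<le> 2 ^ Suc k" using \<mu>_bounds(3)[OF m'] .
      finally show "2 ^ ?m' * real ?m' ^ ?m \<le> 2 ^ Suc k" .
      have "h (Suc k) ^ ?m \<le> h k ^ ?m" using h_pos[of k] by (intro power_mono) (auto simp: h2)
      then show "\<bar>B ?m\<bar> * h (Suc k) ^ ?m \<le> 2 ^ k * (1/2) ^ (k * ?m)"
        using hm \<mu>_bounds(4)[OF m] h_pos[of "Suc k"] by (intro mult_mono) auto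
    qed (use h_pos[of "Suc k"] in auto)
    finally show ?thesis by (simp add: mult_ac)
  qed
  have "(2::real) ^ k * (1/2) ^ (k * ?m) \<le> 2 ^ k * 2 ^ k * (1/2) ^ (k * ?m)"
    by (intro mult_right_mono) auto
  then show ?thesis using t1 t2 zero_le_power[of "2::real" k]
    by (simp only: distrib_right mult.assoc)
qed

lemma Gj_bound:
  assumes y: "y \<in> N 1 k" and m: "\<mu> k \<ge> 1"
  shows "\<bar>Gj k 0 y []\<bar> \<le> 4 * (2 ^ k * 2 ^ k) * (1/2) ^ (k * \<mu> k)"
proof -
  let ?E = "4 * (2 ^ k * 2 ^ k) * (1/2::real) ^ (k * \<mu> k)"
  let ?d = "\<lambda>z. extrap (\<mu> (Suc k)) (h (Suc k)) (\<lambda>s. u (y + s *\<^sub>R z)) - extrap (\<mu> k) (h k) (\<lambda>s. u (y + s *\<^sub>R z))"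
  have yd: "dist x0 y < \<delta>/4" using y by (simp add: N_def)
  have "Gj k 0 y [] = integral (cbox lo hi) (\<lambda>z. extrap (\<mu> (Suc k)) (h (Suc k)) (\<lambda>s. u (y + s *\<^sub>R z)) * \<psi> z
      - extrap (\<mu> k) (h k) (\<lambda>s. u (y + s *\<^sub>R z)) * \<psi> z)"
    unfolding Gj_def Fj_value[OF yd] by (rule integral_diff[symmetric, OF extrap_integrable extrap_integrable])
  then have e: "Gj k 0 y [] = integral (cbox lo hi) (\<lambda>z. ?d z * \<psi> z)" by (simp only: left_diff_distrib)
  have "norm (integral (cbox lo hi) (\<lambda>z. ?d z * \<psi> z)) \<le> integral (cbox lo hi) (\<lambda>z. ?E * \<psi> z)"
  proof (rule integral_norm_bound_integral)
    show "(\<lambda>z. ?d z * \<psi> z) integrable_on cbox lo hi"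
      unfolding left_diff_distrib by (intro integrable_diff extrap_integrable)
    show "(\<lambda>z. ?E * \<psi> z) integrable_on cbox lo hi"
      by (intro integrable_continuous continuous_intros continuous_on_subset[OF \<psi>_continuous]) auto
    show "norm (?d z * \<psi> z) \<le> ?E * \<psi> z" if "z \<in> cbox lo hi" for z
      using extrap_difference[OF y that m] \<psi>0[of z] by (simp add: abs_mult mult_right_mono)
  qed
  also have "\<dots> = ?E" using int1 by (simp only: integral_mult_right mult_1_right)
  finally show ?thesis unfolding e by simp
qed

lemma N_mono: "\<theta> \<le> \<theta>' \<Longrightarrow> N \<theta> k \<subseteq> N \<theta>' k"
  using cn h_pos[of k]
  by (auto simp: N_def intro: order.strict_trans2 mult_right_mono)

lemma N_nested:
  assumes "0 < \<theta>" "\<theta> < \<theta>'"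
  shows "\<exists>a>0. \<forall>k. \<forall>y\<in>N \<theta> k. ball y (a * (1/2) ^ k) \<subseteq> N \<theta>' k"
proof -
  define a where "a = (\<theta>' - \<theta>) * min (\<delta>/4) (c/16 * \<kappa>)"
  have a: "a > 0" unfolding a_def using assms cn \<kappa> by simp
  have a1: "a \<le> (\<theta>' - \<theta>) * (\<delta>/4)" "a \<le> (\<theta>' - \<theta>) * (c/16 * \<kappa>)"
    unfolding a_def using assms by (auto intro!: mult_left_mono)
  have split: "\<theta> * t + (\<theta>' - \<theta>) * t = \<theta>' * t" for t by (simp add: algebra_simps)
  have "ball y (a * (1/2) ^ k) \<subseteq> N \<theta>' k" if y: "y \<in> N \<theta> k" for y k
  proof
    fix w assume "w \<in> ball y (a * (1/2) ^ k)"
    then have d: "dist y w < a * (1/2) ^ k" by simp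
    have "a * (1/2) ^ k \<le> a" using a by (simp add: power_le_one mult_left_le)
    then have "dist x0 w < \<theta> * (\<delta>/4) + (\<theta>' - \<theta>) * (\<delta>/4)"
      using d y dist_triangle[of x0 w y] a1(1) by (simp add: N_def)
    then have 1: "dist x0 w < \<theta>' * (\<delta>/4)" unfolding split .
    have "a * (1/2) ^ k \<le> (\<theta>' - \<theta>) * (c/16 * \<kappa>) * (1/2) ^ k" using a1(2) by (intro mult_right_mono) auto
    also have "\<dots> = (\<theta>' - \<theta>) * (c/16 * h k)" by (simp add: h_def)
    finally have "infdist w X < \<theta> * (c/16 * h k) + (\<theta>' - \<theta>) * (c/16 * h k)"
      using d y infdist_triangle[of w X y] by (simp add: N_def dist_commute)
    then have "infdist w X < \<theta>' * (c/16 * h k)" unfolding split .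
    then show "w \<in> N \<theta>' k" using 1 by (simp add: N_def)
  qed
  then show ?thesis using a by blast
qed

lemma Gj_rapid0:
  assumes "\<theta> < 1"
  shows "rapid (N \<theta>) (\<lambda>k y. Gj k 0 y [])"
  unfolding rapid_def
proof
  fix p
  have "\<forall>\<^sub>F k in sequentially. \<mu> k \<ge> p + 4" using \<mu>lim by (simp add: filterlim_at_top)
  then show "\<forall>\<^sub>F k in sequentially. \<forall>y\<in>N \<theta> k. \<bar>Gj k 0 y []\<bar> \<le> (1/2) ^ (k * p)"
    using eventually_ge_at_top[of 1]
  proof eventually_elim
    case (elim k)
    have "(1/2::real) ^ (k * \<mu> k) \<le> (1/2) ^ (k * (p + 4))" using elim(1) by (intro power_decreasing) auto
    also have "\<dots> = (1/2) ^ (k * p) * ((1/2) ^ k) ^ 4" by (simp add: distrib_left power_add power_mult)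
    finally have "4 * (2 ^ k * 2 ^ k) * (1/2::real) ^ (k * \<mu> k) \<le> 4 * (2 ^ k * 2 ^ k) * ((1/2) ^ (k * p) * ((1/2) ^ k) ^ 4)"
      by (intro mult_left_mono) auto
    also have "\<dots> = (1/2) ^ (k * p) * (4 * ((1/2) ^ k * (1/2) ^ k))"
      by (simp add: power_one_over eval_nat_numeral)
    also have "\<dots> \<le> (1/2) ^ (k * p) * 1"
    proof (rule mult_left_mono)
      have "(1/2::real) ^ k \<le> (1/2) ^ 1" using elim(2) by (intro power_decreasing) auto
      then have "(1/2::real) ^ k * (1/2) ^ k \<le> 1/2 * (1/2)" by (intro mult_mono) auto
      then show "4 * ((1/2::real) ^ k * (1/2) ^ k) \<le> 1" by simp
    qed simp
    finally have *: "4 * (2 ^ k * 2 ^ k) * (1/2::real) ^ (k * \<mu> k) \<le> (1/2) ^ (k * p)" by simp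
    show ?case
    proof
      fix y assume "y \<in> N \<theta> k"
      then have "y \<in> N 1 k" using N_mono[of \<theta> 1 k] assms by auto
      from Gj_bound[OF this] elim(1) * show "\<bar>Gj k 0 y []\<bar> \<le> (1/2) ^ (k * p)" by linarith
    qed
  qed
qed

lemma inverse_h_power: "(1 / h k) ^ n = (1/\<kappa>) ^ n * 2 ^ (k * n)"
  by (simp add: h_def power_divide power_mult_distrib power_mult field_simps)

lemma Fj_moderate: "moderate (\<lambda>k y. Fj k (length vs) y vs)"
proof -
  obtain C where C: "C \<ge> 0" "\<And>s u y U. s > 0 \<Longrightarrow> continuous_on UNIV u \<Longrightarrow> (\<forall>w\<in>cbox A1 A2. \<bar>u w\<bar> \<le> U) \<Longrightarrow> U \<ge> 0 \<Longrightarrow>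
      \<bar>moll_jet J A1 A2 s u (length vs) y vs\<bar> \<le> C * U * (1/s) ^ (DIM('a) + length vs)"
    using moll_jet_bound[OF \<psi>J, of A1 A2 vs] by blast
  have "compact (u ` cbox A1 A2)" using uc by (intro compact_continuous_image) (auto intro: continuous_on_subset)
  then have "bounded (u ` cbox A1 A2)" by (rule compact_imp_bounded)
  then obtain U where U: "U > 0" "\<forall>w\<in>cbox A1 A2. \<bar>u w\<bar> \<le> U" unfolding bounded_pos by auto
  let ?n = "DIM('a) + length vs"
  show ?thesis
  proof (rule moderateI[where C = "C * U * (1/\<kappa>) ^ ?n" and p = "Suc ?n"])
    fix k y
    have "\<bar>Fj k (length vs) y vs\<bar> \<le> 2 ^ \<mu> k * (C * U * (1 / h k) ^ ?n)"
      unfolding Fj_def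
    proof (rule extrap_weights_le)
      fix i assume i: "i \<in> {1..\<mu> k}"
      have "\<bar>moll_jet J A1 A2 (real i * h k) u (length vs) y vs\<bar> \<le> C * U * (1 / (real i * h k)) ^ ?n"
        using C(2)[OF _ uc U(2)] step_range[OF i] U(1) by simp
      also have "\<dots> \<le> C * U * (1 / h k) ^ ?n"
        using step_range[OF i] h_pos[of k] C(1) U(1) by (intro mult_left_mono power_mono frac_le) auto
      finally show "\<bar>moll_jet J A1 A2 (real i * h k) u (length vs) y vs\<bar> \<le> C * U * (1 / h k) ^ ?n" .
    qed (use C(1) U(1) h_pos[of k] in simp)
    also have "\<dots> \<le> 2 ^ k * (C * U * (1 / h k) ^ ?n)"
      using power2_\<mu>[of k] C(1) U(1) h_pos[of k] by (intro mult_right_mono) auto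
    also have "\<dots> = C * U * (1/\<kappa>) ^ ?n * 2 ^ (k * Suc ?n)"
      unfolding inverse_h_power by (simp add: power_add mult_ac)
    finally show "\<bar>Fj k (length vs) y vs\<bar> \<le> C * U * (1/\<kappa>) ^ ?n * 2 ^ (k * Suc ?n)" .
  qed
qed

lemma Gj_moderate: "moderate (\<lambda>k y. Gj k (length vs) y vs)"
  unfolding Gj_def by (rule moderate_diff[OF moderate_Suc[OF Fj_moderate] Fj_moderate])

lemma Gj_rapid:
  assumes "0 < \<theta>" "\<theta> < 1"
  shows "rapid (N \<theta>) (\<lambda>k y. Gj k (length vs) y vs)"
  by (rule rapid_derivatives[OF Gj_smooth _ Gj_rapid0 Gj_moderate assms]) (auto intro: N_nested)

text \<open>A profile in the distance to \<open>X\<close> that is 1 up to a quarter and 0 from a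
  half of the width \<open>c/16 * h k\<close>. Mollifying at 1/32 of the width moves points by at
  most 5/128 of it, so \<open>\<chi>j\<close> is still 1 on \<open>X\<close> and vanishes beyond 5/8
  of the width.\<close>

definition "near k y = max 0 (min 1 (2 - 4 * infdist y X / (c/16 * h k)))"
definition "\<chi>j k = moll_jet J A1 A2 (c/16 * h k / 32) (near k)"

lemma near_continuous: "continuous_on UNIV (near k)"
  unfolding near_def using cn h_pos[of k] by (intro continuous_intros) auto

lemma near_range: "0 \<le> near k y" "near k y \<le> 1" by (auto simp: near_def)

lemma \<chi>j_smooth: "smooth_jet UNIV (\<lambda>y. \<chi>j k 0 y []) (\<chi>j k)"
  unfolding \<chi>j_def by (rule moll_jet_smooth[OF smooth_\<psi> near_continuous])

lemma \<chi>j_moderate: "moderate (\<lambda>k y. \<chi>j k (length vs) y vs)"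
proof -
  obtain C where C: "C \<ge> 0" "\<And>s u y U. s > 0 \<Longrightarrow> continuous_on UNIV u \<Longrightarrow> (\<forall>w\<in>cbox A1 A2. \<bar>u w\<bar> \<le> U) \<Longrightarrow> U \<ge> 0 \<Longrightarrow>
      \<bar>moll_jet J A1 A2 s u (length vs) y vs\<bar> \<le> C * U * (1/s) ^ (DIM('a) + length vs)"
    using moll_jet_bound[OF \<psi>J, of A1 A2 vs] by blast
  let ?n = "DIM('a) + length vs"
  show ?thesis
  proof (rule moderateI[where C = "C * (512/c) ^ ?n * (1/\<kappa>) ^ ?n" and p = ?n])
    fix k y
    have "\<bar>\<chi>j k (length vs) y vs\<bar> \<le> C * 1 * (1 / (c/16 * h k / 32)) ^ ?n"
      unfolding \<chi>j_def using near_range cn h_pos[of k] by (intro C(2) near_continuous) auto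
    also have "1 / (c/16 * h k / 32) = (512/c) * (1 / h k)" by simp
    also have "((512/c) * (1 / h k)) ^ ?n = (512/c) ^ ?n * ((1/\<kappa>) ^ ?n * 2 ^ (k * ?n))"
      unfolding power_mult_distrib inverse_h_power ..
    finally show "\<bar>\<chi>j k (length vs) y vs\<bar> \<le> C * (512/c) ^ ?n * (1/\<kappa>) ^ ?n * 2 ^ (k * ?n)" by (simp only: mult_ac mult_1)
  qed
qed

lemma \<chi>j_value:
  assumes y: "dist x0 y < \<delta>/4" and a: "\<And>z. z \<in> cbox lo hi \<Longrightarrow> near k (y + (c/16 * h k / 32) *\<^sub>R z) = a"
  shows "\<chi>j k 0 y [] = a"
proof -
  let ?s = "c/16 * h k / 32"
  have s: "?s > 0" using cn h_pos[of k] by simp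
  have "c/16 * h k \<le> 1 * \<kappa>" using cn h_pos[of k] h_le[of k] by (intro mult_mono) auto
  then have s2: "?s \<le> \<kappa>" using \<kappa> by simp
  have "\<chi>j k 0 y [] = integral (cbox lo hi) (\<lambda>z. near k (y + ?s *\<^sub>R z) * \<psi> z)"
    unfolding \<chi>j_def by (rule moll_jet_value[OF smooth_\<psi> near_continuous s supp]) (use shifted_point(2)[OF y _ _ s2] s in auto)
  also have "\<dots> = integral (cbox lo hi) (\<lambda>z. a * \<psi> z)" by (rule integral_cong) (simp only: a)
  also have "\<dots> = a" using int1 by (simp only: integral_mult_right mult_1_right)
  finally show ?thesis .
qed

lemma cutoff_shift:
  assumes "z \<in> cbox lo hi"
  shows "dist (y + (c/16 * h k / 32) *\<^sub>R z) y \<le> (c/16 * h k) * (5/128)"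
proof -
  have "(c/16 * h k / 32) * norm z \<le> (c/16 * h k / 32) * (5/4)"
    using support_norm[OF assms] cn h_pos[of k] by (intro mult_left_mono) auto
  then show ?thesis using cn h_pos[of k] by (simp add: dist_norm)
qed

lemma \<chi>j_one:
  assumes "y \<in> X" "dist x0 y < \<delta>/4"
  shows "\<chi>j k 0 y [] = 1"
proof (rule \<chi>j_value[OF assms(2)])
  fix z assume z: "z \<in> cbox lo hi"
  let ?w = "y + (c/16 * h k / 32) *\<^sub>R z"
  have p: "c/16 * h k > 0" using cn h_pos[of k] by simp
  have "infdist ?w X \<le> dist ?w y" using assms(1) by (rule infdist_le)
  also note cutoff_shift[OF z, of y k]
  finally have "4 * infdist ?w X / (c/16 * h k) \<le> 4 * ((c/16 * h k) * (5/128)) / (c/16 * h k)"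
    using p by (intro divide_right_mono) auto
  also have "\<dots> \<le> 1" using p by simp
  finally show "near k ?w = 1" by (simp add: near_def)
qed

lemma \<chi>j_zero:
  assumes "dist x0 y < \<delta>/4" "infdist y X > 5/8 * (c/16 * h k)"
  shows "\<chi>j k 0 y [] = 0"
proof (rule \<chi>j_value[OF assms(1)])
  fix z assume z: "z \<in> cbox lo hi"
  let ?w = "y + (c/16 * h k / 32) *\<^sub>R z"
  have p: "c/16 * h k > 0" using cn h_pos[of k] by simp
  have "infdist y X \<le> infdist ?w X + dist y ?w" by (rule infdist_triangle)
  then have "infdist ?w X \<ge> 1/2 * (c/16 * h k)" using cutoff_shift[OF z, of y k] assms(2) p by (simp only: dist_commute)
  then have "4 * infdist ?w X / (c/16 * h k) \<ge> 4 * (1/2 * (c/16 * h k)) / (c/16 * h k)"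
    using p by (intro divide_right_mono) auto
  moreover have "4 * (1/2 * (c/16 * h k)) / (c/16 * h k) = 2" using cn h_pos[of k] by simp
  ultimately show "near k ?w = 0" by (simp add: near_def)
qed

lemma \<chi>j_jets_zero:
  assumes "dist x0 y < \<delta>/4" "infdist y X > 5/8 * (c/16 * h k)"
  shows "\<chi>j k (length vs) y vs = 0"
proof (rule smooth_jet_zero_on_open[OF \<chi>j_smooth])
  let ?S = "ball x0 (\<delta>/4) \<inter> {y. infdist y X > 5/8 * (c/16 * h k)}"
  show "open ?S" by (intro open_Int open_ball open_Collect_less continuous_intros)
  show "y \<in> ?S" using assms by simp
  show "\<chi>j k 0 w [] = 0" if "w \<in> ?S" for w using \<chi>j_zero that by simp
qed

definition "Pj k = prod_jet (\<chi>j k) (Gj k)"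

lemma Pj_smooth: "smooth_jet UNIV (\<lambda>y. \<chi>j k 0 y [] * Gj k 0 y []) (Pj k)"
  unfolding Pj_def by (rule smooth_jet_prod[OF \<chi>j_smooth Gj_smooth])

text \<open>Two overlapping regions: below 3/4 of the width \<open>Gj k\<close> is rapid and the
  jets of \<open>\<chi>j k\<close> are moderate, beyond 5/8 of it all jets of
  \<open>\<chi>j k\<close> vanish. The bound thus holds on a fixed ball although the neighbourhoods
  shrink.\<close>

lemma Pj_bound:
  "\<forall>\<^sub>F k in sequentially. \<forall>y\<in>ball x0 (\<delta>/8). \<bar>Pj k (length vs) y vs\<bar> \<le> (1/2) ^ k"
proof -
  have "rapid (N (3/4)) (\<lambda>k y. Pj k (length vs) y vs)"
    unfolding Pj_def prod_jet_def
    by (intro rapid_sum_list rapid_mult_moderate \<chi>j_moderate Gj_rapid) auto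
  then have "\<forall>\<^sub>F k in sequentially. \<forall>y\<in>N (3/4) k. \<bar>Pj k (length vs) y vs\<bar> \<le> (1/2) ^ (k * 1)"
    unfolding rapid_def by blast
  then show ?thesis
  proof eventually_elim
    case (elim k)
    show ?case
    proof
      fix y assume y: "y \<in> ball x0 (\<delta>/8)"
      show "\<bar>Pj k (length vs) y vs\<bar> \<le> (1/2) ^ k"
      proof (cases "infdist y X < 3/4 * (c/16 * h k)")
        case True
        then have "y \<in> N (3/4) k" using y cn by (simp add: N_def)
        then show ?thesis using elim by simp
      next
        case False
        have "c/16 * h k > 0" using cn h_pos[of k] by simp
        then have i: "infdist y X > 5/8 * (c/16 * h k)" using False by linarith
        have yd: "dist x0 y < \<delta>/4" using y cn by simp
        have "(\<lambda>p. \<chi>j k (length (fst p)) y (fst p) * Gj k (length (snd p)) y (snd p)) = (\<lambda>p. 0)"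
          using \<chi>j_jets_zero[OF yd i] by simp
        then have "Pj k (length vs) y vs = 0" by (simp add: Pj_def prod_jet_def)
        then show ?thesis by simp
      qed
    qed
  qed
qed

text \<open>The weights of an extrapolation sum to 1, so on \<open>X\<close> the error is at most
  \<open>2 ^ \<mu> k\<close> times the oscillation \<open>L * (5/4 * (real (\<mu> k) * h k))\<close>
  of \<open>f\<close> along the segments. The square in \<open>\<mu>b\<close> bounds
  \<open>2 ^ \<mu> k * real (\<mu> k)\<close> by the root of \<open>2 ^ k\<close>, which
  \<open>h k\<close> overcomes.\<close>

lemma Fj_limit:
  assumes y: "y \<in> X" "dist x0 y < \<delta>/4"
  shows "(\<lambda>k. Fj k 0 y []) \<longlonglongrightarrow> f y"
proof -
  have bd: "\<bar>Fj k 0 y [] - f y\<bar> \<le> L * 2 * \<kappa> * sqrt ((1/2) ^ k)" if m: "\<mu> k \<ge> 1" for k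
  proof -
    let ?m = "\<mu> k"
    have w1: "extrap ?m (h k) (\<lambda>_. f y) = f y"
      using extrap_polynomial[of ?m 1 "h k" "\<lambda>_. f y" 0] m by simp
    have pt: "\<bar>extrap ?m (h k) (\<lambda>s. u (y + s *\<^sub>R z)) - f y\<bar> \<le> 2 ^ ?m * (L * (5/4 * (real ?m * h k)))"
      if z: "z \<in> cbox lo hi" for z
    proof -
      have "extrap ?m (h k) (\<lambda>s. u (y + s *\<^sub>R z)) - f y = extrap ?m (h k) (\<lambda>s. u (y + s *\<^sub>R z)) - extrap ?m (h k) (\<lambda>_. f y)"
        using w1 by simp
      also have "\<dots> = (\<Sum>j\<in>{1..?m}. (-1) ^ Suc j * real (?m choose j) * (u (y + (real j * h k) *\<^sub>R z) - f y))"
        by (simp only: extrap_def sum_subtractf right_diff_distrib)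
      finally have e: "extrap ?m (h k) (\<lambda>s. u (y + s *\<^sub>R z)) - f y =
        (\<Sum>j\<in>{1..?m}. (-1) ^ Suc j * real (?m choose j) * (u (y + (real j * h k) *\<^sub>R z) - f y))" .
      show ?thesis unfolding e
      proof (rule extrap_weights_le)
        fix j assume j: "j \<in> {1..?m}"
        let ?w = "y + (real j * h k) *\<^sub>R z"
        have zc: "dist e z < c" using support_direction[OF z] cn by simp
        have sj: "0 < real j * h k" "real j * h k \<le> \<kappa>" using step_range[OF j] by auto
        have w: "?w \<in> X" using conein[OF y(1) _ zc sj(1)] y cn sj \<kappa> by simp
        have wd: "dist x0 ?w \<le> \<delta>/2" using shifted_point(1)[OF y(2) z] sj by simp
        have "\<bar>u ?w - f y\<bar> \<le> L * dist ?w y" using uf[OF w wd] lip[OF w _ y(1)] wd y cn by simp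
        also have "dist ?w y = (real j * h k) * norm z" using sj by (simp add: dist_norm)
        also have "L * ((real j * h k) * norm z) \<le> L * ((real ?m * h k) * (5/4))"
          using j h_pos[of k] support_norm[OF z] cn by (intro mult_left_mono mult_mono) auto
        finally show "\<bar>u ?w - f y\<bar> \<le> L * (5/4 * (real ?m * h k))" by (simp only: mult.commute)
      qed (use cn h_pos[of k] in simp)
    qed
    let ?E = "2 ^ ?m * (L * (5/4 * (real ?m * h k)))"
    have "Fj k 0 y [] - f y = integral (cbox lo hi) (\<lambda>z. extrap ?m (h k) (\<lambda>s. u (y + s *\<^sub>R z)) * \<psi> z) - integral (cbox lo hi) (\<lambda>z. f y * \<psi> z)"
      using Fj_value[OF y(2)] int1 by (simp only: integral_mult_right mult_1_right)
    also have "\<dots> = integral (cbox lo hi) (\<lambda>z. extrap ?m (h k) (\<lambda>s. u (y + s *\<^sub>R z)) * \<psi> z - f y * \<psi> z)"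
      by (rule integral_diff[symmetric, OF extrap_integrable])
         (intro integrable_continuous continuous_intros continuous_on_subset[OF \<psi>_continuous], auto)
    also have "norm \<dots> \<le> integral (cbox lo hi) (\<lambda>z. ?E * \<psi> z)"
    proof (rule integral_norm_bound_integral)
      show "(\<lambda>z. extrap ?m (h k) (\<lambda>s. u (y + s *\<^sub>R z)) * \<psi> z - f y * \<psi> z) integrable_on cbox lo hi"
        by (intro integrable_diff extrap_integrable integrable_continuous continuous_intros continuous_on_subset[OF \<psi>_continuous]) auto
      show "(\<lambda>z. ?E * \<psi> z) integrable_on cbox lo hi"
        by (intro integrable_continuous continuous_intros continuous_on_subset[OF \<psi>_continuous]) auto
      show "norm (extrap ?m (h k) (\<lambda>s. u (y + s *\<^sub>R z)) * \<psi> z - f y * \<psi> z) \<le> ?E * \<psi> z" if "z \<in> cbox lo hi" for z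
        unfolding left_diff_distrib[symmetric] real_norm_def abs_mult
        using mult_right_mono[OF pt[OF that] \<psi>0[of z]] \<psi>0[of z] by simp
    qed
    also have "\<dots> = ?E" using int1 by (simp only: integral_mult_right mult_1_right)
    also have "\<dots> = L * (5/4) * \<kappa> * ((2 ^ ?m * real ?m) * (1/2) ^ k)" by (simp add: h_def)
    also have "\<dots> \<le> L * 2 * \<kappa> * sqrt ((1/2) ^ k)"
    proof (rule mult_mono)
      have "((2 ^ ?m * real ?m) * (1/2) ^ k)\<^sup>2 = (2 ^ ?m * real ?m)\<^sup>2 * ((1/2) ^ k)\<^sup>2" by (rule power_mult_distrib)
      also have "\<dots> \<le> 2 ^ k * ((1/2) ^ k)\<^sup>2" using \<mu>_bounds(1)[OF m] by (intro mult_right_mono) auto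
      also have "\<dots> = (1/2) ^ k" by (simp add: power2_eq_square power_one_over)
      finally show "(2 ^ ?m * real ?m) * (1/2) ^ k \<le> sqrt ((1/2) ^ k)" by (rule real_le_rsqrt)
      show "L * (5/4) * \<kappa> \<le> L * 2 * \<kappa>" using cn \<kappa> by (intro mult_right_mono mult_left_mono) auto
    qed (use cn \<kappa> in auto)
    finally show ?thesis by simp
  qed
  have "((\<lambda>k. L * 2 * \<kappa> * sqrt ((1/2) ^ k)) \<longlongrightarrow> L * 2 * \<kappa> * sqrt 0) sequentially"
    by (intro tendsto_intros LIMSEQ_realpow_zero) auto
  then have "(\<lambda>k. L * 2 * \<kappa> * sqrt ((1/2) ^ k)) \<longlonglongrightarrow> 0" by simp
  moreover have "\<forall>\<^sub>F k in sequentially. \<mu> k \<ge> 1" using \<mu>lim by (simp add: filterlim_at_top)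
  then have "\<forall>\<^sub>F k in sequentially. norm (Fj k 0 y [] - f y) \<le> L * 2 * \<kappa> * sqrt ((1/2) ^ k)"
    by (rule eventually_mono) (use bd in simp)
  ultimately have "(\<lambda>k. Fj k 0 y [] - f y) \<longlonglongrightarrow> 0" by (rule Lim_null_comparison[rotated])
  then show ?thesis by (simp add: LIM_zero_iff)
qed

text \<open>\<open>Fj 0\<close> plus the series of the differences \<open>Gj k\<close> telescopes to
  the limit of \<open>Fj k\<close>. The cutoffs do not change it on \<open>X\<close>, where they are
  1 and the limit is \<open>f\<close>, and off \<open>X\<close> they remove the terms for which no
  estimate is available.\<close>

lemma local_extension: "\<exists>U g D. local_ext X f x0 U g D"
proof -
  let ?U = "ball x0 (\<delta>/8)"
  define g where "g = (\<lambda>y. Fj 0 0 y [] + (\<Sum>k. \<chi>j k 0 y [] * Gj k 0 y []))"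
  define D where "D = (\<lambda>j y vs. Fj 0 j y vs + (\<Sum>k. Pj k j y vs))"
  have s1: "smooth_jet ?U (\<lambda>y. \<Sum>k. \<chi>j k 0 y [] * Gj k 0 y []) (\<lambda>j y vs. \<Sum>k. Pj k j y vs)"
    by (rule smooth_jet_suminf[OF Pj_smooth]) (auto intro: Pj_bound)
  have "smooth_jet ?U g D"
    unfolding smooth_jet_def
  proof (intro conjI ballI allI impI)
    fix y assume "y \<in> ?U"
    then show "D 0 y [] = g y" using s1 by (simp add: smooth_jet_def D_def g_def)
  next
    fix j y and vs :: "'a list" assume y: "y \<in> ?U" and len: "length vs = j"
    have "((\<lambda>w. Fj 0 j w vs) has_derivative (\<lambda>v. Fj 0 (Suc j) y (v # vs))) (at y)"
      using smooth_jetD[OF Fj_smooth, of y 0 vs] len by simp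
    moreover have "((\<lambda>w. \<Sum>k. Pj k j w vs) has_derivative (\<lambda>v. \<Sum>k. Pj k (Suc j) y (v # vs))) (at y)"
      using smooth_jetD[OF s1 y, of vs] len by simp
    ultimately show "((\<lambda>w. D j w vs) has_derivative (\<lambda>v. D (Suc j) y (v # vs))) (at y)"
      unfolding D_def by (rule has_derivative_add)
  qed
  moreover have "g y = f y" if "y \<in> X \<inter> ?U" for y
  proof -
    have y: "y \<in> X" "dist x0 y < \<delta>/4" using that cn by auto
    have "(\<lambda>k. Fj (Suc k) 0 y [] - Fj k 0 y []) sums (f y - Fj 0 0 y [])"
      by (rule telescope_sums[OF Fj_limit[OF y]])
    then have "(\<lambda>k. \<chi>j k 0 y [] * Gj k 0 y []) sums (f y - Fj 0 0 y [])"
      using \<chi>j_one[OF y] by (simp add: Gj_def)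
    then have "(\<Sum>k. \<chi>j k 0 y [] * Gj k 0 y []) = f y - Fj 0 0 y []" by (rule sums_unique[symmetric])
    then show ?thesis by (simp add: g_def)
  qed
  ultimately have "local_ext X f x0 ?U g D" using cn by (simp add: local_ext_def)
  then show ?thesis by blast
qed

end

lemma arc_class_smooth_on_set:
  fixes X :: "'a::euclidean_space set"
  assumes M: "positive_seq M" "log_convex M" "non_quasianalytic M" and X: "lipschitz_set X"
    and f: "f \<in> arc_class M X"
  shows "f \<in> smooth_on_set X"
  unfolding smooth_on_set_def mem_Collect_eq
proof
  fix x0 assume x0: "x0 \<in> X"
  have cl: "closed X" using X by (simp add: lipschitz_set_def)
  obtain \<epsilon> c \<tau> e where cone: "cone_at X x0 \<epsilon> c \<tau> e" using lipschitz_set_cone_at[OF X x0] by blast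
  have cn: "\<epsilon> > 0" "0 < c" "c \<le> 1/2" "\<tau> > 0" "norm e = 1"
    and conein: "\<And>y v s. y \<in> X \<Longrightarrow> dist x0 y < \<epsilon> \<Longrightarrow> dist e v < c \<Longrightarrow> 0 < s \<Longrightarrow> s \<le> \<tau> \<Longrightarrow> y + s *\<^sub>R v \<in> interior X"
    using cone by (auto simp: cone_at_def)
  obtain \<delta> \<tau>' B L where sb: "\<delta> > 0" "\<tau>' > 0" "\<delta> \<le> \<epsilon>" "\<tau>' \<le> \<tau>" "segment_bounds f X x0 \<delta> (c/2) \<tau>' e B L"
    using arc_class_segment_bounds[OF M f x0 cone] by blast
  have segJ: "jets_on {0<..<\<tau>'} (\<lambda>k. (deriv ^^ k) (\<lambda>s. f (y + s *\<^sub>R v)))"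
    and segB: "s \<in> {0<..<\<tau>'} \<Longrightarrow> \<bar>(deriv ^^ k) (\<lambda>s. f (y + s *\<^sub>R v)) s\<bar> \<le> B k"
    if "y \<in> X" "dist x0 y < \<delta>" "dist e v < c/2" for y v k s
    using sb(5) that unfolding segment_bounds_def by auto
  have lip: "\<bar>f y - f y'\<bar> \<le> \<bar>L\<bar> * dist y y'" if "y \<in> X" "dist x0 y < \<delta>" "y' \<in> X" "dist x0 y' < \<delta>" for y y'
  proof -
    have "\<bar>f y - f y'\<bar> \<le> L * dist y y'" using sb(5) that unfolding segment_bounds_def by auto
    also have "\<dots> \<le> \<bar>L\<bar> * dist y y'" by (intro mult_right_mono) auto
    finally show ?thesis .
  qed
  have "continuous_on (X \<inter> cball x0 (\<delta>/2)) f"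
  proof (rule lipschitz_on_continuous_on)
    show "\<bar>L\<bar>-lipschitz_on (X \<inter> cball x0 (\<delta>/2)) f"
      by (rule lipschitz_onI) (use lip sb(1) in \<open>auto simp: dist_real_def\<close>)
  qed
  moreover have "closedin (top_of_set UNIV) (X \<inter> cball x0 (\<delta>/2))" using cl by (simp add: closed_Int)
  ultimately obtain u where u: "continuous_on UNIV u" "\<And>y. y \<in> X \<inter> cball x0 (\<delta>/2) \<Longrightarrow> u y = f y"
    using Tietze_unbounded[of "X \<inter> cball x0 (\<delta>/2)" f UNIV] by metis
  obtain D where D: "beurling M D" "\<forall>t. 0 \<le> D 0 t \<and> D 0 t \<le> 1"
      "\<forall>t. \<bar>t\<bar> \<le> 3/4 \<longrightarrow> D 0 t = 1" "\<forall>t. \<bar>t\<bar> \<ge> 9/4 \<longrightarrow> D 0 t = 0"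
    using beurling_cutoff_exists[OF M(1,3)] by blast
  have Dj: "jets_on UNIV D" using D(1) by (simp add: beurling_def)
  have Db: "\<exists>B. \<forall>t. \<bar>D k t\<bar> \<le> B" for k using D(1) zero_less_one unfolding beurling_def by meson
  obtain \<psi> J lo hi where \<psi>: "bsmooth \<psi> J" "\<forall>z. \<psi> z \<ge> 0" "cbox lo hi \<subseteq> ball e (c/4)" "\<forall>z. z \<notin> cbox lo hi \<longrightarrow> \<psi> z = 0"
      "integral (cbox lo hi) \<psi> = 1"
    using bump_exists[OF Dj Db D(2-4), of "c/4" e] cn by auto
  define \<kappa> where "\<kappa> = min (min 1 (\<delta>/16)) (\<tau>'/2)"
  have \<kappa>: "0 < \<kappa>" "\<kappa> \<le> 1" "\<kappa> \<le> \<delta>/16" "\<kappa> \<le> \<tau>'/2" unfolding \<kappa>_def using sb(1,2) by auto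
  \<comment> \<open>The squared term serves \<open>Fj_limit\<close>, the other one
    \<open>extrap_difference\<close>; as both terms are nonnegative, bounding their sum bounds
    each.\<close>
  obtain \<mu> :: "nat \<Rightarrow> nat" where \<mu>: "\<forall>k l. k \<le> l \<longrightarrow> \<mu> k \<le> \<mu> l" "filterlim \<mu> at_top sequentially"
    "\<forall>k. \<mu> k \<ge> 1 \<longrightarrow> (2 ^ \<mu> k * real (\<mu> k))\<^sup>2 + 2 ^ \<mu> k * real (\<mu> k) ^ \<mu> k * (1 + \<bar>B (\<mu> k)\<bar>) \<le> 2 ^ k"
    using slow_sequence_exists[of "\<lambda>m. (2 ^ m * real m)\<^sup>2 + 2 ^ m * real m ^ m * (1 + \<bar>B m\<bar>)"] by blast
  interpret extension_setup X f x0 e c \<delta> \<tau>' "\<bar>L\<bar>" \<kappa> B u \<psi> J lo hi \<mu>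
  proof
    show "y + s *\<^sub>R v \<in> X" if "y \<in> X" "dist x0 y < \<delta>" "dist e v < c" "0 < s" "s \<le> \<tau>'" for y v s
      using conein[of y v s] that sb interior_subset[of X] by auto
  qed (use cl x0 cn sb segJ segB lip u \<psi> \<kappa> \<mu> in auto)
  show "\<exists>U g D. local_ext X f x0 U g D" by (rule local_extension)
qed

section \<open>Polarization\<close>

lemma smooth_jet_mixed_mvt:
  assumes D: "smooth_jet U g D" and s: "s > 0"
    and U: "\<And>a b. 0 \<le> a \<Longrightarrow> a \<le> s \<Longrightarrow> 0 \<le> b \<Longrightarrow> b \<le> s \<Longrightarrow> x + a *\<^sub>R v + b *\<^sub>R w \<in> U"
  shows "\<exists>a b. 0 < a \<and> a < s \<and> 0 < b \<and> b < s \<and>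
    D (length vs) (x + s *\<^sub>R v + s *\<^sub>R w) vs - D (length vs) (x + s *\<^sub>R v) vs - D (length vs) (x + s *\<^sub>R w) vs + D (length vs) x vs
    = s * (s * D (Suc (Suc (length vs))) (x + a *\<^sub>R v + b *\<^sub>R w) (w # v # vs))"
proof -
  let ?k = "length vs"
  define \<phi> where "\<phi> = (\<lambda>t. D ?k (x + s *\<^sub>R w + t *\<^sub>R v) vs - D ?k (x + t *\<^sub>R v) vs)"
  define \<phi>' where "\<phi>' = (\<lambda>t. D (Suc ?k) (x + s *\<^sub>R w + t *\<^sub>R v) (v # vs) - D (Suc ?k) (x + t *\<^sub>R v) (v # vs))"
  have "(\<phi> has_real_derivative \<phi>' t) (at t)" if "0 \<le> t" "t \<le> s" for t
    unfolding \<phi>_def \<phi>'_def using U[of t s] U[of t 0] that s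
    by (intro DERIV_diff smooth_jet_line_derivative[OF D]) (auto simp: add_ac)
  then obtain a where a: "0 < a" "a < s" "\<phi> s - \<phi> 0 = (s - 0) * \<phi>' a" using MVT2[of 0 s \<phi> \<phi>'] s by auto
  define \<eta> where "\<eta> = (\<lambda>t. D (Suc ?k) (x + a *\<^sub>R v + t *\<^sub>R w) (v # vs))"
  define \<eta>' where "\<eta>' = (\<lambda>t. D (Suc (Suc ?k)) (x + a *\<^sub>R v + t *\<^sub>R w) (w # v # vs))"
  have "(\<eta> has_real_derivative \<eta>' t) (at t)" if "0 \<le> t" "t \<le> s" for t
    using smooth_jet_line_derivative[OF D, of "x + a *\<^sub>R v" t w "v # vs"] U[of a t] a that by (simp add: \<eta>_def \<eta>'_def)
  then obtain b where b: "0 < b" "b < s" "\<eta> s - \<eta> 0 = (s - 0) * \<eta>' b" using MVT2[of 0 s \<eta> \<eta>'] s by auto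
  have "\<phi>' a = \<eta> s - \<eta> 0" by (simp add: \<phi>'_def \<eta>_def add_ac)
  then have "\<phi> s - \<phi> 0 = s * (s * \<eta>' b)" using a b by simp
  moreover have "\<phi> s - \<phi> 0 = D ?k (x + s *\<^sub>R v + s *\<^sub>R w) vs - D ?k (x + s *\<^sub>R v) vs - D ?k (x + s *\<^sub>R w) vs + D ?k x vs"
    by (simp add: \<phi>_def add_ac)
  ultimately show ?thesis using a b by (intro exI[of _ a] exI[of _ b]) (auto simp: \<eta>'_def)
qed

lemma smooth_jet_isCont:
  assumes "smooth_jet U g D" "x \<in> U"
  shows "isCont (\<lambda>y. D (length vs) y vs) x"
  using has_derivative_continuous[OF smooth_jetD[OF assms]] .

text \<open>Schwarz's theorem: the second difference in the directions \<open>v\<close> and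
  \<open>w\<close> is symmetric, and by \<open>smooth_jet_mixed_mvt\<close> it equals
  \<open>s * s\<close> times either mixed derivative at some nearby point. Continuity makes both
  values close to those at \<open>x\<close>.\<close>

lemma smooth_jet_swap:
  assumes D: "smooth_jet U g D" and U: "open U" and x: "x \<in> U"
  shows "D (Suc (Suc (length vs))) x (w # v # vs) = D (Suc (Suc (length vs))) x (v # w # vs)"
proof (rule ccontr)
  let ?A = "\<lambda>y. D (Suc (Suc (length vs))) y (w # v # vs)" and ?B = "\<lambda>y. D (Suc (Suc (length vs))) y (v # w # vs)"
  assume "?A x \<noteq> ?B x"
  define e where "e = \<bar>?A x - ?B x\<bar> / 2"
  have e: "e > 0" using \<open>?A x \<noteq> ?B x\<close> by (simp add: e_def)
  have cA: "isCont ?A x" using smooth_jet_isCont[OF D x, of "w # v # vs"] by simp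
  have cB: "isCont ?B x" using smooth_jet_isCont[OF D x, of "v # w # vs"] by simp
  obtain r1 where r1: "r1 > 0" "\<And>y. dist y x < r1 \<Longrightarrow> dist (?A y) (?A x) < e" using cA e unfolding continuous_at_eps_delta by metis
  obtain r2 where r2: "r2 > 0" "\<And>y. dist y x < r2 \<Longrightarrow> dist (?B y) (?B x) < e" using cB e unfolding continuous_at_eps_delta by metis
  obtain r3 where r3: "r3 > 0" "ball x r3 \<subseteq> U" using x by (rule openE[OF U])
  define r where "r = min r1 (min r2 r3)"
  have r: "r > 0" "r \<le> r1" "r \<le> r2" "r \<le> r3" using r1 r2 r3 by (auto simp: r_def)
  define n where "n = norm v + norm w + 1"
  define s where "s = r / (2 * n)"
  have nn: "n > 0" by (simp add: n_def add_nonneg_pos)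
  have s: "s > 0" using r nn by (simp add: s_def)
  have near: "dist (x + a *\<^sub>R v + b *\<^sub>R w) x < r" if "0 \<le> a" "a \<le> s" "0 \<le> b" "b \<le> s" for a b
  proof -
    have "dist (x + a *\<^sub>R v + b *\<^sub>R w) x \<le> norm (a *\<^sub>R v) + norm (b *\<^sub>R w)"
      using norm_triangle_ineq[of "a *\<^sub>R v" "b *\<^sub>R w"] by (simp add: dist_norm add.assoc)
    also have "\<dots> \<le> s * norm v + s * norm w" using that by (intro add_mono) (auto intro: mult_right_mono)
    also have "\<dots> \<le> s * n" using s by (simp add: n_def algebra_simps)
    also have "\<dots> = r / 2" using nn by (simp add: s_def)
    finally show ?thesis using r by simp
  qed
  have inU: "x + a *\<^sub>R v + b *\<^sub>R w \<in> U" if "0 \<le> a" "a \<le> s" "0 \<le> b" "b \<le> s" for a b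
    using near[OF that] r r3(2) by (auto simp: dist_commute)
  obtain a b where ab: "0 < a" "a < s" "0 < b" "b < s"
    "D (length vs) (x + s *\<^sub>R v + s *\<^sub>R w) vs - D (length vs) (x + s *\<^sub>R v) vs - D (length vs) (x + s *\<^sub>R w) vs + D (length vs) x vs
     = s * (s * ?A (x + a *\<^sub>R v + b *\<^sub>R w))"
    using smooth_jet_mixed_mvt[OF D s inU, of vs] by blast
  have inU': "x + a *\<^sub>R w + b *\<^sub>R v \<in> U" if "0 \<le> a" "a \<le> s" "0 \<le> b" "b \<le> s" for a b
    using inU[OF that(3,4,1,2)] by (simp add: add_ac)
  obtain a' b' where ab': "0 < a'" "a' < s" "0 < b'" "b' < s"
    "D (length vs) (x + s *\<^sub>R w + s *\<^sub>R v) vs - D (length vs) (x + s *\<^sub>R w) vs - D (length vs) (x + s *\<^sub>R v) vs + D (length vs) x vs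
     = s * (s * ?B (x + a' *\<^sub>R w + b' *\<^sub>R v))"
    using smooth_jet_mixed_mvt[OF D s inU', of vs] by blast
  have comm: "x + s *\<^sub>R w + s *\<^sub>R v = x + s *\<^sub>R v + s *\<^sub>R w" by (simp add: add_ac)
  have "s * (s * ?A (x + a *\<^sub>R v + b *\<^sub>R w)) = s * (s * ?B (x + a' *\<^sub>R w + b' *\<^sub>R v))"
    using ab(5) ab'(5) unfolding comm by linarith
  then have "?A (x + a *\<^sub>R v + b *\<^sub>R w) = ?B (x + b' *\<^sub>R v + a' *\<^sub>R w)" using s by (simp add: add_ac)
  moreover have "dist (?A (x + a *\<^sub>R v + b *\<^sub>R w)) (?A x) < e" using r1(2) near[of a b] ab r by simp
  moreover have "dist (?B (x + b' *\<^sub>R v + a' *\<^sub>R w)) (?B x) < e" using r2(2) near[of b' a'] ab' r by simp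
  ultimately have "\<bar>?A x - ?B x\<bar> < 2 * e" unfolding dist_real_def by linarith
  then show False by (simp add: e_def)
qed

lemma smooth_jet_append_cong:
  assumes D: "smooth_jet U g D" and U: "open U" and len: "length as = length bs"
    and eq: "\<And>y. y \<in> U \<Longrightarrow> D (length as) y as = D (length bs) y bs" and y: "y \<in> U"
  shows "D (length (us @ as)) y (us @ as) = D (length (us @ bs)) y (us @ bs)"
  using y
proof (induction us arbitrary: y)
  case Nil
  then show ?case using eq by simp
next
  case (Cons v us)
  have "((\<lambda>y. D (length (us @ as)) y (us @ as)) has_derivative (\<lambda>v. D (Suc (length (us @ bs))) y (v # us @ bs))) (at y)"
    by (rule has_derivative_transform_within_open[OF smooth_jetD[OF D Cons.prems] U Cons.prems]) (rule Cons.IH[symmetric])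
  from has_derivative_unique[OF smooth_jetD[OF D Cons.prems] this]
  show ?case by (metis append_Cons length_Cons)
qed

lemma smooth_jet_move_front:
  assumes D: "smooth_jet U g D" and U: "open U" and y: "y \<in> U"
  shows "D (length (us @ v # ws)) y (us @ v # ws) = D (length (v # us @ ws)) y (v # us @ ws)"
  using y
proof (induction us arbitrary: y)
  case Nil
  show ?case by simp
next
  case (Cons a us)
  have "D (length ([a] @ (us @ v # ws))) y ([a] @ (us @ v # ws)) = D (length ([a] @ (v # us @ ws))) y ([a] @ (v # us @ ws))"
    by (rule smooth_jet_append_cong[OF D U _ Cons.IH Cons.prems]) simp_all
  also have "\<dots> = D (length (v # a # us @ ws)) y (v # a # us @ ws)"
    using smooth_jet_swap[OF D U Cons.prems, of "us @ ws" a v] by simp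
  finally show ?case by simp
qed

fun iter_diff :: "('a::real_normed_vector \<Rightarrow> real) \<Rightarrow> 'a list \<Rightarrow> 'a \<Rightarrow> real" where
  "iter_diff P [] a = P a"
| "iter_diff P (v # vs) a = iter_diff P vs (a + v) - iter_diff P vs a"

lemma iter_diff_bound:
  assumes "\<And>b. norm (b - a) \<le> (\<Sum>v\<leftarrow>vs. norm v) \<Longrightarrow> \<bar>P b\<bar> \<le> K"
  shows "\<bar>iter_diff P vs a\<bar> \<le> 2 ^ length vs * K"
  using assms
proof (induction vs arbitrary: a)
  case Nil
  then show ?case by simp
next
  case (Cons v vs)
  have "\<bar>iter_diff P vs (a + v)\<bar> \<le> 2 ^ length vs * K"
  proof (rule Cons.IH)
    fix b assume b: "norm (b - (a + v)) \<le> (\<Sum>v\<leftarrow>vs. norm v)"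
    have "norm (b - a) \<le> norm (b - (a + v)) + norm v" using norm_triangle_ineq[of "b - (a + v)" v] by simp
    then show "\<bar>P b\<bar> \<le> K" using b by (intro Cons.prems) simp
  qed
  moreover have "\<bar>iter_diff P vs a\<bar> \<le> 2 ^ length vs * K"
  proof (rule Cons.IH)
    fix b assume b: "norm (b - a) \<le> (\<Sum>v\<leftarrow>vs. norm v)"
    then show "\<bar>P b\<bar> \<le> K" using norm_ge_zero[of v] by (intro Cons.prems) (simp add: add_increasing)
  qed
  ultimately show ?case by simp
qed

lemma iter_diff_sum: "iter_diff (\<lambda>a. \<Sum>i\<in>I. c i * P i a) vs a = (\<Sum>i\<in>I. c i * iter_diff (P i) vs a)"
  by (induction vs arbitrary: a) (simp_all add: sum_subtractf right_diff_distrib)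

lemma iter_diff_Cons: "iter_diff P (v # vs) a = iter_diff (\<lambda>a. P (a + v) - P a) vs a"
proof (induction vs arbitrary: a)
  case Nil
  show ?case by simp
next
  case (Cons w vs)
  have "iter_diff P (v # w # vs) a = iter_diff P (v # vs) (a + w) - iter_diff P (v # vs) a" by (simp add: add_ac)
  then show ?case by (simp add: Cons.IH del: iter_diff.simps(2)) (simp)
qed

text \<open>\<open>L\<close> takes lists of every length, so that arguments split off in an
  expansion can be kept as a tail \<open>us\<close>. Moving one entry to the front generates all
  permutations, so linearity is stated for the first entry only.\<close>

locale sym_multilinear =
  fixes L :: "'a::real_normed_vector list \<Rightarrow> real"
  assumes sym: "L (us @ v # ws) = L (v # us @ ws)"
    and add: "L ((a + b) # us) = L (a # us) + L (b # us)"
    and scale: "L ((r *\<^sub>R a) # us) = r * L (a # us)"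
begin

lemma binomial:
  "L (replicate k (a + v) @ us) = (\<Sum>i\<le>k. real (k choose i) * L (replicate (k - i) a @ replicate i v @ us))"
proof (induction k arbitrary: us)
  case (Suc k)
  let ?x = "\<lambda>i. L (replicate (Suc k - i) a @ replicate i v @ us)"
  have "L (replicate (Suc k) (a + v) @ us) = L ((a + v) # replicate k (a + v) @ us)" by simp
  also have "\<dots> = L (a # replicate k (a + v) @ us) + L (v # replicate k (a + v) @ us)" by (rule add)
  also have "\<dots> = L (replicate k (a + v) @ a # us) + L (replicate k (a + v) @ v # us)" by (simp only: sym)
  also have "\<dots> = (\<Sum>i\<le>k. real (k choose i) * L (replicate (k - i) a @ replicate i v @ a # us))
      + (\<Sum>i\<le>k. real (k choose i) * L (replicate (k - i) a @ replicate i v @ v # us))"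
    by (simp only: Suc.IH)
  also have "(\<Sum>i\<le>k. real (k choose i) * L (replicate (k - i) a @ replicate i v @ a # us)) = (\<Sum>i\<le>k. real (k choose i) * ?x i)"
  proof (rule sum.cong[OF refl])
    fix i assume i: "i \<in> {..k}"
    have "L (replicate (k - i) a @ replicate i v @ a # us) = L ((replicate (k - i) a @ replicate i v) @ a # us)" by simp
    also have "\<dots> = L (a # (replicate (k - i) a @ replicate i v) @ us)" by (rule sym)
    also have "\<dots> = ?x i" using i by (simp add: Suc_diff_le)
    finally show "real (k choose i) * L (replicate (k - i) a @ replicate i v @ a # us) = real (k choose i) * ?x i" by simp
  qed
  also have "(\<Sum>i\<le>k. real (k choose i) * L (replicate (k - i) a @ replicate i v @ v # us)) = (\<Sum>i\<le>k. real (k choose i) * ?x (Suc i))"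
    by (simp add: replicate_app_Cons_same)
  also have "(\<Sum>i\<le>k. real (k choose i) * ?x i) + (\<Sum>i\<le>k. real (k choose i) * ?x (Suc i))
      = (\<Sum>i\<le>k. real (k choose i) * (?x (Suc i) * 1 + ?x i * 1))"
    by (simp add: sum.distrib[symmetric] distrib_left add.commute)
  also have "\<dots> = (\<Sum>i\<le>Suc k. real (Suc k choose i) * ?x i * 1)"
    by (rule pascal_sum[of k ?x "\<lambda>_. 1"])
  finally show ?case by simp
qed simp

text \<open>One difference in direction \<open>v\<close> turns the homogeneous polynomial of degree
  \<open>k\<close> into terms of degree \<open>k - i\<close> with \<open>i \<ge> 1\<close> copies of
  \<open>v\<close> split off. The remaining differences kill all but \<open>i = 1\<close>, which
  contributes the factor \<open>k\<close>.\<close>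

lemma iter_diff_power:
  assumes "k \<le> length vs"
  shows "iter_diff (\<lambda>a. L (replicate k a @ us)) vs a = (if length vs = k then fact k * L (vs @ us) else 0)"
  using assms
proof (induction k arbitrary: us vs a rule: less_induct)
  case (less k)
  show ?case
  proof (cases vs)
    case Nil
    then show ?thesis using less.prems by simp
  next
    case (Cons v ws)
    have inc: "L (replicate k (b + v) @ us) - L (replicate k b @ us)
       = (\<Sum>i\<in>{1..k}. real (k choose i) * L (replicate (k - i) b @ replicate i v @ us))" for b
    proof -
      have "(\<Sum>i\<le>k. real (k choose i) * L (replicate (k - i) b @ replicate i v @ us))
        = L (replicate k b @ us) + (\<Sum>i\<in>{1..k}. real (k choose i) * L (replicate (k - i) b @ replicate i v @ us))"
        by (subst atMost_atLeast0, subst sum.atLeast_Suc_atMost) auto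
      then show ?thesis using binomial[of k b v us] by simp
    qed
    have "iter_diff (\<lambda>a. L (replicate k a @ us)) vs a
       = iter_diff (\<lambda>b. \<Sum>i\<in>{1..k}. real (k choose i) * L (replicate (k - i) b @ replicate i v @ us)) ws a"
      unfolding Cons iter_diff_Cons inc ..
    also have "\<dots> = (\<Sum>i\<in>{1..k}. real (k choose i) * iter_diff (\<lambda>b. L (replicate (k - i) b @ replicate i v @ us)) ws a)"
      by (rule iter_diff_sum)
    also have "\<dots> = (\<Sum>i\<in>{1..k}. if i = 1 then (if length vs = k then fact k * L (vs @ us) else 0) else 0)"
    proof (rule sum.cong[OF refl])
      fix i assume i: "i \<in> {1..k}"
      have ih: "iter_diff (\<lambda>b. L (replicate (k - i) b @ replicate i v @ us)) ws a
        = (if length ws = k - i then fact (k - i) * L (ws @ replicate i v @ us) else 0)"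
      proof (rule less.IH)
        show "k - i < k" using i by auto
        show "k - i \<le> length ws" using i less.prems Cons by auto
      qed
      show "real (k choose i) * iter_diff (\<lambda>b. L (replicate (k - i) b @ replicate i v @ us)) ws a
         = (if i = 1 then (if length vs = k then fact k * L (vs @ us) else 0) else 0)"
      proof (cases "i = 1")
        case True
        obtain j where j: "k = Suc j" using i by (cases k) auto
        have "L (ws @ v # us) = L (vs @ us)" using sym[of ws v us] Cons by simp
        then show ?thesis using True ih Cons j by simp
      next
        case False
        then show ?thesis using ih i less.prems Cons by auto
      qed
    qed
    also have "\<dots> = (if length vs = k then fact k * L (vs @ us) else 0)"
      using less.prems Cons by (cases "k = 0") (auto simp: sum.delta)
    finally show ?thesis .
  qed
qed

lemma scale_all: "L (map (\<lambda>v. r *\<^sub>R v) vs @ us) = r ^ length vs * L (vs @ us)"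
proof (induction vs arbitrary: us)
  case (Cons v vs)
  have "L (map (\<lambda>v. r *\<^sub>R v) (v # vs) @ us) = r * L (v # map (\<lambda>v. r *\<^sub>R v) vs @ us)" by (simp add: scale)
  also have "L (v # map (\<lambda>v. r *\<^sub>R v) vs @ us) = L (map (\<lambda>v. r *\<^sub>R v) vs @ v # us)" by (rule sym[symmetric])
  also have "\<dots> = r ^ length vs * L (vs @ v # us)" by (rule Cons.IH)
  also have "L (vs @ v # us) = L ((v # vs) @ us)" using sym[of vs v us] by simp
  finally show ?case by simp
qed simp

text \<open>The difference of order \<open>k\<close> with steps \<open>c *\<^sub>R v\<close> uses
  values within \<open>k * c = r/2\<close> of \<open>a\<close>, so a ball around any centre
  suffices. The factor \<open>(2 / c) ^ k / fact k\<close> equals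
  \<open>(4 / r) ^ k * (k ^ k / fact k)\<close>, and
  \<open>k ^ k / fact k \<le> exp k \<le> 3 ^ k\<close>; no factorial is lost.\<close>

lemma polarization_bound:
  assumes K: "\<And>b. norm (b - a) < r \<Longrightarrow> \<bar>L (replicate (length vs) b)\<bar> \<le> K" and r: "r > 0"
    and vs: "\<And>v. v \<in> set vs \<Longrightarrow> norm v \<le> 1"
  shows "\<bar>L vs\<bar> \<le> K * (12 / r) ^ length vs"
proof (cases "vs = []")
  case True
  then show ?thesis using K[of a] r by simp
next
  case False
  let ?k = "length vs"
  have k: "real ?k > 0" using False by simp
  define c where "c = r / (2 * real ?k)"
  have c: "c > 0" using r k by (simp add: c_def)
  let ?ws = "map (\<lambda>v. c *\<^sub>R v) vs"
  have K0: "K \<ge> 0" using K[of a] r by force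
  have "(\<Sum>v\<leftarrow>us. norm v) \<le> real (length us) * c" if "\<And>v. v \<in> set us \<Longrightarrow> norm v \<le> c" for us :: "'a list"
    using that by (induction us) (auto simp: algebra_simps add_mono)
  moreover have "norm v \<le> c" if "v \<in> set ?ws" for v using that vs c by auto
  ultimately have "(\<Sum>v\<leftarrow>?ws. norm v) \<le> real ?k * c" by (metis length_map)
  also have "\<dots> = r / 2" using k by (simp add: c_def)
  finally have "(\<Sum>v\<leftarrow>?ws. norm v) < r" using r by simp
  then have "\<bar>iter_diff (\<lambda>b. L (replicate ?k b @ [])) ?ws a\<bar> \<le> 2 ^ length ?ws * K"
    by (intro iter_diff_bound) (auto intro: K)
  moreover have "iter_diff (\<lambda>b. L (replicate ?k b @ [])) ?ws a = fact ?k * (c ^ ?k * L vs)"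
    using iter_diff_power[of ?k ?ws "[]" a] scale_all[of c vs "[]"] by simp
  ultimately have "fact ?k * (c ^ ?k * \<bar>L vs\<bar>) \<le> 2 ^ ?k * K" using c by (simp add: abs_mult)
  then have "\<bar>L vs\<bar> \<le> K * ((2 / c) ^ ?k / fact ?k)" using c by (simp add: field_simps power_divide)
  also have "(2 / c) ^ ?k / fact ?k = (4 / r) ^ ?k * (real ?k ^ ?k / fact ?k)"
    using r k by (simp add: c_def power_divide power_mult_distrib)
  also have "real ?k ^ ?k / fact ?k \<le> 3 ^ ?k"
  proof -
    have "real ?k ^ ?k / fact ?k \<le> exp (real ?k)"
    proof -
      have "(\<Sum>n\<in>{?k}. real ?k ^ n /\<^sub>R fact n) \<le> (\<Sum>n. real ?k ^ n /\<^sub>R fact n)"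
        by (rule sum_le_suminf[OF summable_exp_generic]) auto
      then show ?thesis by (simp add: exp_def divide_inverse mult.commute)
    qed
    also have "exp (real ?k) = exp 1 ^ ?k" by (simp add: exp_of_nat_mult[symmetric])
    also have "\<dots> \<le> 3 ^ ?k" using exp_le by (intro power_mono) auto
    finally show ?thesis .
  qed
  then have "K * ((4 / r) ^ ?k * (real ?k ^ ?k / fact ?k)) \<le> K * ((4 / r) ^ ?k * 3 ^ ?k)"
    using K0 r by (intro mult_left_mono) auto
  also have "(4 / r) ^ ?k * 3 ^ ?k = (12 / r) ^ ?k" by (simp add: power_mult_distrib[symmetric])
  finally show ?thesis by (simp add: mult_left_mono K0)
qed

end

lemma smooth_jet_sym_multilinear:
  assumes D: "smooth_jet U g D" and U: "open U" and y: "y \<in> U"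
  shows "sym_multilinear (\<lambda>vs. D (length vs) y vs)"
proof
  have lin: "linear (\<lambda>v. D (Suc (length us)) y (v # us))" for us
    using smooth_jetD[OF D y] by (rule has_derivative_linear)
  show "D (length (us @ v # ws)) y (us @ v # ws) = D (length (v # us @ ws)) y (v # us @ ws)" for us v ws
    by (rule smooth_jet_move_front[OF D U y])
  show "D (length ((a + b) # us)) y ((a + b) # us) = D (length (a # us)) y (a # us) + D (length (b # us)) y (b # us)" for a b us
    using linear_add[OF lin[of us], of a b] by simp
  show "D (length ((r *\<^sub>R a) # us)) y ((r *\<^sub>R a) # us) = r * D (length (a # us)) y (a # us)" for r a us
    using linear_scale[OF lin[of us], of r a] by simp
qed

section \<open>From cone directions to full derivatives up to the boundary\<close>

lemma local_ext_line_deriv: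
  assumes l: "local_ext X f x U g D" and y: "y \<in> interior X" "y \<in> U"
  shows "(deriv ^^ k) (\<lambda>s. f (y + s *\<^sub>R v)) 0 = D k y (replicate k v)"
proof -
  have U: "open U" and D: "smooth_jet U g D" and gf: "\<forall>y\<in>X \<inter> U. g y = f y" using l by (auto simp: local_ext_def)
  let ?I = "(\<lambda>s. y + s *\<^sub>R v) -` (interior X \<inter> U)"
  have I: "open ?I" using U by (intro open_vimage open_Int open_interior continuous_intros) auto
  define Q where "Q = (\<lambda>k s. D k (y + s *\<^sub>R v) (replicate k v))"
  have "jets_on ?I Q"
    unfolding jets_on_def has_real_derivative_iff_has_vector_derivative[symmetric]
  proof (intro allI ballI)
    fix k s assume "s \<in> ?I"
    then show "(Q k has_real_derivative Q (Suc k) s) (at s)"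
      using smooth_jet_line_derivative[OF D, of y s v "replicate k v"] by (simp add: Q_def)
  qed
  moreover have "f (y + s *\<^sub>R v) = Q 0 s" if "s \<in> ?I" for s
    using that gf D interior_subset[of X] by (auto simp: Q_def smooth_jet_def)
  moreover have "0 \<in> ?I" using y by simp
  ultimately have "(deriv ^^ k) (\<lambda>s. f (y + s *\<^sub>R v)) 0 = Q k 0" by (intro jets_on_deriv[OF I]) auto
  then show ?thesis by (simp add: Q_def)
qed

lemma arc_class_local_bound:
  fixes X :: "'a::euclidean_space set"
  assumes M: "positive_seq M" "log_convex M" "non_quasianalytic M" and X: "lipschitz_set X"
    and f: "f \<in> arc_class M X" and x0: "x0 \<in> X"
  shows "\<exists>\<delta>>0. \<exists>C>0. \<exists>\<rho>>0. \<forall>x\<in>X \<inter> ball x0 \<delta>. \<forall>U g D vs. local_ext X f x U g D \<longrightarrow>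
    (\<forall>v\<in>set vs. norm v \<le> 1) \<longrightarrow> \<bar>D (length vs) x vs\<bar> \<le> C * \<rho> ^ length vs * fact (length vs) * M (2 * length vs)"
proof -
  obtain \<epsilon> c \<tau> e where cone: "cone_at X x0 \<epsilon> c \<tau> e" using lipschitz_set_cone_at[OF X x0] by blast
  have c: "c > 0" using cone by (simp add: cone_at_def)
  obtain \<delta> C \<rho> where C: "\<delta> > 0" "C > 0" "\<rho> > 0" "\<And>y v k. y \<in> interior X \<Longrightarrow> dist x0 y < \<delta> \<Longrightarrow> dist e v < c/2 \<Longrightarrow>
    \<bar>(deriv ^^ k) (\<lambda>s. f (y + s *\<^sub>R v)) 0\<bar> \<le> C * \<rho> ^ k * fact k * M (2 * k)"
    using arc_class_line_deriv_bound[OF M f x0 cone] by auto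
  define \<rho>' where "\<rho>' = \<rho> * (12 / (c/2))"
  have "\<bar>D (length vs) x vs\<bar> \<le> C * \<rho>' ^ length vs * fact (length vs) * M (2 * length vs)"
    if x: "x \<in> X" "dist x0 x < \<delta>" and l: "local_ext X f x U g D" and vs: "\<forall>v\<in>set vs. norm v \<le> 1" for x U g D vs
  proof (rule ccontr)
    let ?k = "length vs"
    let ?K = "C * \<rho> ^ ?k * fact ?k * M (2 * ?k)"
    let ?b = "C * \<rho>' ^ ?k * fact ?k * M (2 * ?k)"
    assume "\<not> \<bar>D ?k x vs\<bar> \<le> ?b"
    then have gt: "?b < \<bar>D ?k x vs\<bar>" by simp
    have U: "open U" "x \<in> U" "smooth_jet U g D" using l by (auto simp: local_ext_def)
    have "isCont (\<lambda>y. \<bar>D ?k y vs\<bar>) x" using smooth_jet_isCont[OF U(3,2)] by (intro continuous_intros)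
    then have "((\<lambda>y. \<bar>D ?k y vs\<bar>) \<longlongrightarrow> \<bar>D ?k x vs\<bar>) (nhds x)"
      unfolding isCont_def by (rule iffD1[OF tendsto_at_iff_tendsto_nhds[where g = "\<lambda>y. \<bar>D ?k y vs\<bar>" and l = x]])
    from order_tendstoD(1)[OF this gt] obtain T where T: "open T" "x \<in> T" "\<And>y. y \<in> T \<Longrightarrow> ?b < \<bar>D ?k y vs\<bar>"
      unfolding eventually_nhds by blast
    let ?V = "T \<inter> U \<inter> ball x0 \<delta>"
    have "x \<in> ?V \<inter> closure (interior X)" using T U x X by (auto simp: lipschitz_set_def)
    moreover have "open ?V" using T U by auto
    \<comment> \<open>A violation at \<open>x\<close> persists nearby by continuity, and
      \<open>X\<close> is the closure of its interior; so it occurs at an interior point, where the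
      bounds in cone directions and polarization around \<open>e\<close> refute it.\<close>
    ultimately have "?V \<inter> interior X \<noteq> {}" using open_Int_closure_eq_empty[of ?V "interior X"] by blast
    then obtain y where y: "y \<in> T" "y \<in> U" "dist x0 y < \<delta>" "y \<in> interior X" by auto
    interpret L: sym_multilinear "\<lambda>vs. D (length vs) y vs" by (rule smooth_jet_sym_multilinear[OF U(3,1) y(2)])
    have "\<bar>D ?k y vs\<bar> \<le> ?K * (12 / (c/2)) ^ ?k"
    proof (rule L.polarization_bound[where a = e])
      fix b assume "norm (b - e) < c/2"
      then have "dist e b < c/2" by (simp add: dist_norm norm_minus_commute)
      from C(4)[OF y(4,3) this, of ?k] show "\<bar>D (length (replicate ?k b)) y (replicate ?k b)\<bar> \<le> ?K"
        using local_ext_line_deriv[OF l y(4,2), of ?k b] by simp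
    qed (use c vs in auto)
    also have "\<dots> = ?b" by (simp only: \<rho>'_def power_mult_distrib mult_ac)
    finally show False using T(3)[OF y(1)] by simp
  qed
  moreover have "\<rho>' > 0" using C c by (simp add: \<rho>'_def)
  ultimately show ?thesis using C(1,2) by (intro exI[of _ \<delta>] conjI exI[of _ C] exI[of _ \<rho>']) auto
qed

theorem arc_class_subset_ultra_class:
  fixes X :: "'a::euclidean_space set"
  assumes M: "positive_seq M" "log_convex M" "non_quasianalytic M" and X: "lipschitz_set X"
  shows "arc_class M X \<subseteq> ultra_class (seq2 M) X"
proof
  fix f assume f: "f \<in> arc_class M X"
  have Mp: "M i > 0" for i using M(1) by (simp add: positive_seq_def)
  have bd: "\<exists>C \<rho>. C > 0 \<and> \<rho> > 0 \<and> (\<forall>k. \<forall>x\<in>K. \<forall>U g D. local_ext X f x U g D \<longrightarrow>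
      (\<forall>vs. length vs = k \<and> (\<forall>v\<in>set vs. norm v \<le> 1) \<longrightarrow> \<bar>D k x vs\<bar> \<le> C * \<rho> ^ k * fact k * seq2 M k))"
    if K: "compact K" "K \<subseteq> X" for K
  proof -
    define R where "R = (\<lambda>x0 \<delta> C \<rho>. \<forall>x\<in>X \<inter> ball x0 \<delta>. \<forall>U g D vs. local_ext X f x U g D \<longrightarrow>
      (\<forall>v\<in>set vs. norm v \<le> 1) \<longrightarrow> \<bar>D (length vs) x vs\<bar> \<le> C * \<rho> ^ length vs * fact (length vs) * M (2 * length vs))"
    have "\<exists>\<delta>>0. \<exists>C>0. \<exists>\<rho>>0. R x0 \<delta> C \<rho>" if "x0 \<in> K" for x0
      unfolding R_def using K(2) that by (intro arc_class_local_bound[OF M X f]) auto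
    then obtain \<delta> C \<rho> where B: "\<And>x0. x0 \<in> K \<Longrightarrow> \<delta> x0 > 0 \<and> C x0 > 0 \<and> \<rho> x0 > 0 \<and> R x0 (\<delta> x0) (C x0) (\<rho> x0)"
      by metis
    obtain F where F: "F \<subseteq> K" "finite F" "K \<subseteq> (\<Union>x\<in>F. ball x (\<delta> x))"
    proof (rule compactE_image[OF K(1), of K "\<lambda>x. ball x (\<delta> x)"])
      show "K \<subseteq> (\<Union>x\<in>K. ball x (\<delta> x))" using B by force
    qed auto
    define C' where "C' = (\<Sum>x\<in>F. C x) + 1"
    define \<rho>' where "\<rho>' = (\<Sum>x\<in>F. \<rho> x) + 1"
    have pos: "0 < C x" "0 < \<rho> x" if "x \<in> F" for x using B F(1) that by auto
    have le: "C x \<le> C'" "\<rho> x \<le> \<rho>'" if "x \<in> F" for x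
      using member_le_sum[of x F C] member_le_sum[of x F \<rho>] that F(2) pos
      by (auto simp: C'_def \<rho>'_def less_imp_le intro: order_trans)
    have C'0: "C' > 0" "\<rho>' > 0" unfolding C'_def \<rho>'_def using sum_nonneg[of F C] sum_nonneg[of F \<rho>] pos
      by (simp_all add: less_imp_le add_nonneg_pos)
    have "\<bar>D k x vs\<bar> \<le> C' * \<rho>' ^ k * fact k * seq2 M k"
      if x: "x \<in> K" and l: "local_ext X f x U g D" and vs: "length vs = k" "\<forall>v\<in>set vs. norm v \<le> 1" for k x U g D vs
    proof -
      obtain x0 where x0: "x0 \<in> F" "x \<in> ball x0 (\<delta> x0)" using F(3) x by blast
      then have "\<bar>D k x vs\<bar> \<le> C x0 * \<rho> x0 ^ k * fact k * M (2 * k)"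
      proof -
        have "R x0 (\<delta> x0) (C x0) (\<rho> x0)" "x \<in> X \<inter> ball x0 (\<delta> x0)" using B[of x0] F(1) x0 x K(2) by auto
        then show ?thesis using l vs(2) unfolding R_def vs(1)[symmetric] by blast
      qed
      also have "\<dots> \<le> C' * \<rho>' ^ k * fact k * M (2 * k)"
        using le[OF x0(1)] pos[OF x0(1)] C'0 Mp[of "2 * k"]
        by (intro mult_right_mono mult_mono power_mono) (auto simp: less_imp_le)
      finally show ?thesis by (simp add: seq2_def)
    qed
    then show ?thesis using C'0 by (intro exI[of _ C'] exI[of _ \<rho>']) simp
  qed
  show "f \<in> ultra_class (seq2 M) X"
    unfolding ultra_class_def
  proof (intro CollectI conjI allI impI)
    show "f \<in> smooth_on_set X" by (rule arc_class_smooth_on_set[OF M X f])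
  qed (rule bd, auto)
qed

theorem theorem1p19:
  fixes M :: "nat \<Rightarrow> real" and X :: "'a::euclidean_space set"
  assumes "positive_seq M" and "log_convex M" and "non_quasianalytic M"
    and "lipschitz_set X"
  shows "ultra_class M X \<subseteq> arc_class M X \<and> arc_class M X \<subseteq> ultra_class (seq2 M) X"
  using ultra_class_subset_arc_class[OF assms(1,2)] arc_class_subset_ultra_class[OF assms] by simp

end
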